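(* Let $\mathbf{A}\in\mathbb{R}^{d\times d}$ be symmetric positive definite with eigenvalues $\lambda_1\ge\cdots\ge\lambda_d$, and let $\mathbf{b}\in\mathbb{R}^d$ be nonzero. Let $\mathbf{\Omega}\in\mathbb{R}^{d\times (r+p)q}$ be a random Gaussian matrix, where $q\ge\log(1/\delta)/\log(100)$. Suppose that $p\ge2$ and $$s\ge\min\left\{3+\frac{\log(d)}{2},\ \frac32+\frac14\log\left(4+\frac{4r}{p-1}\sum_{i>r}\frac{\lambda_i^2}{\lambda_{r+1}^2}\right)\right\}.$$ Then the block-CG iterate $\mathrm{bcg}_t^{(1)}(\mu)$ with starting block $\mathbf{B}=[\mathbf{b}~\mathbf{\Omega}]$ satisfies, with probability at least $1-\delta$, $$\left\{\forall\mu\ge0:\ \frac{\|\mathbf{A}_\mu^{-1}\mathbf{b}-\mathrm{bcg}_t^{(1)}(\mu)\|_{\mathbf{A}_\mu}}{\|\mathbf{A}_\mu^{-1}\mathbf{b}\|_{\mathbf{A}_\mu}}\le2\exp\left(-\frac{t-s}{3\sqrt{\kappa_{r+1}(\mu)}}\right)\right\}.$$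
   Context: $\mathbf{A}_\mu=\mathbf{A}+\mu\mathbf{I}$; $\kappa_{r+1}(\mu)=(\lambda_{r+1}+\mu)/(\lambda_d+\mu)$; $\|\mathbf{x}\|_{\mathbf{M}}=\sqrt{\mathbf{x}^{\mathsf T}\mathbf{M}\mathbf{x}}$. Here $\delta\in(0,1)$, $r,p,q,s,t$ are integers with $0\le r<d$, $q\ge 1$, $t\ge 0$, and $\log$ is the natural logarithm. A (random) Gaussian matrix has independent standard normal entries. Krylov subspaces: $\mathcal{K}_t(\mathbf{M},\mathbf{v})=\operatorname{span}\{\mathbf{v},\mathbf{M}\mathbf{v},\dots,\mathbf{M}^{t-1}\mathbf{v}\}$, and for a matrix $\mathbf{V}$ with columns $\mathbf{v}^{(1)},\dots,\mathbf{v}^{(k)}$, $\mathcal{K}_t(\mathbf{M},\mathbf{V})=\mathcal{K}_t(\mathbf{M},\mathbf{v}^{(1)})+\cdots+\mathcal{K}_t(\mathbf{M},\mathbf{v}^{(k)})$. Block-CG: for $\mathbf{B}$ with columns $\mathbf{b}^{(1)},\mathbf{b}^{(2)},\dots$, $\mathrm{bcg}_t^{(i)}(\mu)=\operatorname{argmin}\{\|\mathbf{A}_\mu^{-1}\mathbf{b}^{(i)}-\mathbf{x}\|_{\mathbf{A}_\mu}:\mathbf{x}\in\mathcal{K}_t(\mathbf{A}_\mu,\mathbf{B})\}$ (so for $\mathbf{B}=[\mathbf{b}~\mathbf{\Omega}]$, $\mathbf{b}^{(1)}=\mathbf{b}$). *)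

theory Defs
  imports "HOL-Analysis.Analysis" "HOL-Probability.Probability"
begin

definition symmetric_pos_def :: "real^'d^'d \<Rightarrow> bool" where
  "symmetric_pos_def A \<longleftrightarrow> transpose A = A \<and> (\<forall>x. x \<noteq> 0 \<longrightarrow> x \<bullet> (A *v x) > 0)"

text \<open>The values of \<open>lam\<close> at \<open>1, \<dots>, d\<close> are the roots of the characteristic polynomial in
  nonincreasing order, repeated according to multiplicity; other values of \<open>lam\<close> are irrelevant.
  The matrix \<open>mat x\<close> is \<open>x\<close> times the identity.\<close>

definition ordered_eigenvalues :: "real^'d^'d \<Rightarrow> (nat \<Rightarrow> real) \<Rightarrow> bool" where
  "ordered_eigenvalues A lam \<longleftrightarrow>
     (\<forall>x. det (mat x - A) = (\<Prod>i = 1..CARD('d). x - lam i)) \<and>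
     antimono_on {1..CARD('d)} lam"

definition shifted :: "real^'d^'d \<Rightarrow> real \<Rightarrow> real^'d^'d" where
  "shifted A \<mu> = A + mat \<mu>"

text \<open>With \<open>lam\<close> the eigenvalues of a \<open>d \<times> d\<close> matrix in nonincreasing order, numbered from 1,
  \<open>shifted_cond lam d k \<mu>\<close> is the quantity usually written \<open>\<kappa>\<^sub>k(\<mu>)\<close>.\<close>

definition shifted_cond :: "(nat \<Rightarrow> real) \<Rightarrow> nat \<Rightarrow> nat \<Rightarrow> real \<Rightarrow> real" where
  "shifted_cond lam d k \<mu> = (lam k + \<mu>) / (lam d + \<mu>)"

definition mat_norm :: "real^'d^'d \<Rightarrow> real^'d \<Rightarrow> real" where
  "mat_norm M x = sqrt (x \<bullet> (M *v x))"

definition krylov :: "nat \<Rightarrow> real^'d^'d \<Rightarrow> real^'d \<Rightarrow> (real^'d) set" where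
  "krylov t M v = span ((\<lambda>i. ((*v) M ^^ i) v) ` {..<t})"

definition block_krylov :: "nat \<Rightarrow> real^'d^'d \<Rightarrow> real^'k^'d \<Rightarrow> (real^'d) set" where
  "block_krylov t M V = {\<Sum>j\<in>UNIV. x j | x. \<forall>j. x j \<in> krylov t M (column j V)}"

text \<open>The horizontal concatenation of two matrices. Its columns are indexed by a disjoint sum, so
  in the concatenation of \<open>columnvector b :: real^1^'d\<close> with another matrix, the first column
  \<open>b\<close> has index \<open>Inl 1\<close>.\<close>

definition hconcat :: "real^'k^'d \<Rightarrow> real^'m^'d \<Rightarrow> real^('k + 'm)^'d" where
  "hconcat V W = (\<chi> i j. case j of Inl k \<Rightarrow> V $ i $ k | Inr m \<Rightarrow> W $ i $ m)"

definition bcg :: "real^'d^'d \<Rightarrow> real^'k^'d \<Rightarrow> nat \<Rightarrow> 'k \<Rightarrow> real \<Rightarrow> real^'d" where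
  "bcg A B t i \<mu> =
     arg_min_on (\<lambda>x. mat_norm (shifted A \<mu>) (matrix_inv (shifted A \<mu>) *v column i B - x))
       (block_krylov t (shifted A \<mu>) B)"

definition (in prob_space) gaussian_matrix :: "('a \<Rightarrow> real^'m^'d) \<Rightarrow> bool" where
  "gaussian_matrix \<Omega> \<longleftrightarrow>
     indep_vars (\<lambda>_. borel) (\<lambda>(i, j) \<omega>. \<Omega> \<omega> $ i $ j) UNIV \<and>
     (\<forall>i j. distributed M lborel (\<lambda>\<omega>. \<Omega> \<omega> $ i $ j) std_normal_density)"

end

theory Submission
  imports Defs "HOL-Real_Asymp.Real_Asymp"
begin

text \<open>
  The Krylov spaces of \<open>A + \<mu> I\<close> are those of \<open>A\<close>, and the iterate minimises the error over them.
  So it suffices to exhibit, for every \<open>\<mu>\<close>, one element of a single block Krylov space that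
  approximates \<open>A\<^sub>\<mu>\<^sup>-\<^sup>1 b\<close> well. Put \<open>k = s - 1\<close> and \<open>m = t - s\<close> (for \<open>t \<le> k\<close> the claimed bound is at
  least 1 and the zero vector will do), and let \<open>W\<close> be the span of the columns of \<open>A\<^sup>k \<Omega>\<close>. Remove
  from \<open>A\<^sub>\<mu>\<^sup>-\<^sup>1 b\<close> its \<open>A\<^sub>\<mu>\<close>-orthogonal projection onto \<open>W\<close> and apply \<open>m\<close> steps of Chebyshev iteration
  with the compression of \<open>A\<^sub>\<mu>\<close> to the \<open>A\<^sub>\<mu>\<close>-orthogonal complement \<open>H\<close> of \<open>W\<close>. Every step multiplies by
  \<open>A\<close> once and otherwise only adds elements of \<open>W\<close>, so the result differs from a multiple of
  \<open>A\<^sub>\<mu>\<^sup>-\<^sup>1 b\<close> by an element of the block Krylov space (\<open>deflated_chebyshev_iterate\<close>).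

  The rate depends on the spectrum of the compression, which is bounded below by \<open>\<lambda>\<^sub>d + \<mu>\<close>. For the
  upper end note that \<open>v = A\<^sub>\<mu> h\<close> is orthogonal to \<open>W\<close>, in the Euclidean sense, whenever \<open>h \<in> H\<close>.
  Hence an upper end of \<open>36 (\<lambda>\<^sub>r\<^sub>+\<^sub>1 + \<mu>)\<close> follows once \<open>v \<bullet> A v \<le> 36 \<lambda>\<^sub>r\<^sub>+\<^sub>1 (v \<bullet> v)\<close> for all \<open>v\<close> orthogonal
  to \<open>W\<close>, a condition without \<open>\<mu>\<close>. This is why a single event serves all shifts, and
  \<open>2 / sqrt 36\<close> is the factor \<open>1 / 3\<close> in the exponent (\<open>block_krylov_error\<close>).

  That condition is probabilistic. By Jensen's inequality a bound on the moment of order \<open>2 k\<close>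
  suffices: \<open>y = (A / \<lambda>\<^sub>r\<^sub>+\<^sub>1)\<^sup>k z\<close> should satisfy \<open>y \<bullet> y \<le> 36\<^sup>2\<^sup>k (z \<bullet> z)\<close> when \<open>z\<close> is orthogonal to \<open>W\<close>,
  that is, when \<open>y\<close> is orthogonal to the columns of \<open>\<Omega>\<close>. The part of \<open>y\<close> along the trailing
  eigenvectors is no longer than \<open>z\<close>; the part along the \<open>r\<close> leading ones solves a linear system whose matrix
  \<open>G\<close> consists of the leading rows of \<open>\<Omega>\<close> in the eigenbasis (\<open>tail_form_bound\<close>). Its size is
  controlled in expectation by the trace of \<open>(G G\<^sup>T)\<^sup>-\<^sup>1\<close>, whose mean is \<open>r / (p - 1)\<close> when \<open>G\<close> has
  \<open>r + p\<close> columns. This mean comes from Stein's identity, applied to the regularised inverse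
  \<open>(G G\<^sup>T + \<epsilon> I)\<^sup>-\<^sup>1\<close>, which is a smooth and bounded function of \<open>\<Omega>\<close>
  (\<open>expectation_trace_inverse_gram_le\<close>, \<open>expectation_cross_term_le\<close>). Markov's inequality then makes one
  block of \<open>r + p\<close> columns fail with probability at most \<open>1 / 100\<close>. A single successful block
  is enough, and disjoint blocks are independent, so all \<open>q\<close> of them fail with probability at
  most \<open>100\<^sup>-\<^sup>q \<le> \<delta>\<close>.

  The event in the theorem is an intersection over all real \<open>\<mu> \<ge> 0\<close> of conditions on a minimum over a
  random subspace, and it has to be shown to be measurable (\<open>uniform_accuracy_measurable\<close>).
\<close>

section \<open>Spectral theorem for self-adjoint operators\<close>

text \<open>A maximiser of the Rayleigh quotient on the unit sphere of \<open>S\<close> is an eigenvector, and its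
  \<open>B\<close>-orthogonal complement in \<open>S\<close> is again invariant. The inner product is arbitrary because
  compressions of a positive definite matrix are self-adjoint for the form of that matrix and not
  for the Euclidean one; taking \<open>T\<close> to be the identity yields orthonormal bases of subspaces.\<close>

lemma spectral_theorem_form:
  fixes B :: "'a::euclidean_space \<Rightarrow> 'a \<Rightarrow> real" and T :: "'a \<Rightarrow> 'a"
  assumes bil: "bounded_bilinear B" and sym: "\<And>x y. B x y = B y x"
    and pos: "\<And>x. x \<noteq> 0 \<Longrightarrow> 0 < B x x" and lin: "linear T"
    and "subspace S" and "\<And>x. x \<in> S \<Longrightarrow> T x \<in> S"
    and "\<And>x y. x \<in> S \<Longrightarrow> y \<in> S \<Longrightarrow> B (T x) y = B x (T y)"
  shows "\<exists>E. finite E \<and> E \<subseteq> S \<and> card E = dim S \<and>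
           (\<forall>e\<in>E. \<exists>\<theta>. T e = \<theta> *\<^sub>R e) \<and> (\<forall>e\<in>E. \<forall>f\<in>E. B e f = (if e = f then 1 else 0)) \<and>
           (\<forall>x\<in>S. x = (\<Sum>e\<in>E. B x e *\<^sub>R e))"
  using assms(5-7)
proof (induction "dim S" arbitrary: S)
  case 0
  then have "S \<subseteq> {0}" by (simp add: dim_eq_0)
  then show ?case using 0 by (intro exI[of _ "{}"]) auto
next
  case (Suc n)
  interpret B: bounded_bilinear B by fact
  note bsimps = B.add_left B.add_right B.diff_left B.diff_right B.scaleR_left B.scaleR_right
  have "dim S \<noteq> 0" using Suc.hyps(2) by linarith
  then obtain v where v: "v \<in> S" "v \<noteq> 0"
    by (auto simp: dim_eq_0)
  define U where "U = S \<inter> sphere 0 1"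
  have "compact U"
    unfolding U_def using Suc.prems(1) by (auto intro!: closed_Int_compact closed_subspace)
  moreover have "v /\<^sub>R norm v \<in> U"
    using v Suc.prems(1) by (auto simp: U_def subspace_scale)
  moreover have bT: "bounded_linear T" using lin by (simp add: linear_conv_bounded_linear)
  have cont: "continuous_on U (\<lambda>x. B (T x) x / B x x)"
  proof -
    have "B x x \<noteq> 0" if "x \<in> U" for x
      using that pos[of x] by (cases "x = 0") (auto simp: U_def)
    then show ?thesis
      by (intro continuous_intros B.continuous_on linear_continuous_on[OF bT]) auto
  qed
  ultimately obtain x0 where x0: "x0 \<in> U" and max: "\<And>y. y \<in> U \<Longrightarrow> B (T y) y / B y y \<le> B (T x0) x0 / B x0 x0"
    using continuous_attains_sup[OF _ _ cont] by blast
  define \<theta> where "\<theta> = B (T x0) x0 / B x0 x0"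
  have x0S: "x0 \<in> S" and x0n: "x0 \<noteq> 0" using x0 by (auto simp: U_def)
  have bx0: "B x0 x0 > 0" using pos x0n by blast
  define Q where "Q x y = \<theta> * B x y - B (T x) y" for x y
  have Q0: "Q x0 x0 = 0" using bx0 by (simp add: Q_def \<theta>_def)
  have Qpos: "Q y y \<ge> 0" if "y \<in> S" for y
  proof (cases "y = 0")
    case False
    then have "y /\<^sub>R norm y \<in> U" using that Suc.prems(1) by (auto simp: U_def subspace_scale)
    from max[OF this] have "B (T y) y / B y y \<le> \<theta>"
      using False unfolding \<theta>_def
      by (simp add: linear_scale[OF lin] bsimps)
    then show ?thesis using pos[OF False] by (simp add: Q_def divide_simps)
  qed (simp add: Q_def B.zero_right)
  \<comment> \<open>A positive semidefinite form that vanishes at a vector annihilates it; at the maximiser this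
    is the eigenvalue equation.\<close>
  have Qx0: "Q x0 y = 0" if "y \<in> S" for y
  proof -
    have key: "0 \<le> 2 * c * Q x0 y + c\<^sup>2 * Q y y" for c
    proof -
      have "0 \<le> Q (x0 + c *\<^sub>R y) (x0 + c *\<^sub>R y)"
        using Qpos that x0S Suc.prems(1) by (simp add: subspace_add subspace_scale)
      moreover have "B (T y) x0 = B (T x0) y"
        using Suc.prems(3)[OF that x0S] sym by simp
      ultimately show ?thesis
        using Q0 sym[of y x0]
        by (simp add: Q_def linear_add[OF lin] linear_scale[OF lin] bsimps algebra_simps power2_eq_square)
    qed
    have q: "Q y y \<ge> 0" using Qpos that by blast
    show ?thesis
    proof (rule ccontr)
      assume n: "Q x0 y \<noteq> 0"
      \<comment> \<open>Close to the minimiser of the quadratic in \<open>key\<close>; the summand 1 allows for \<open>Q y y = 0\<close>.\<close>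
      define c where "c = - Q x0 y / (Q y y + 1)"
      have "2 * c * Q x0 y + c\<^sup>2 * Q y y = - (Q x0 y)\<^sup>2 * (Q y y + 2) / (Q y y + 1)\<^sup>2"
        using q unfolding c_def by (simp add: divide_simps) (simp add: power2_eq_square algebra_simps)
      also have "\<dots> < 0" using q n by (intro divide_neg_pos mult_neg_pos) auto
      finally show False using key[of c] by simp
    qed
  qed
  have Tx0: "T x0 = \<theta> *\<^sub>R x0"
  proof -
    have "\<theta> *\<^sub>R x0 - T x0 \<in> S"
      using x0S Suc.prems by (simp add: subspace_diff subspace_scale)
    from Qx0[OF this] have "B (\<theta> *\<^sub>R x0 - T x0) (\<theta> *\<^sub>R x0 - T x0) = 0"
      by (simp add: Q_def bsimps algebra_simps)
    then show ?thesis using pos[of "\<theta> *\<^sub>R x0 - T x0"] by fastforce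
  qed
  define e0 where "e0 = x0 /\<^sub>R sqrt (B x0 x0)"
  have "inverse (sqrt (B x0 x0)) * (inverse (sqrt (B x0 x0)) * B x0 x0) = 1"
    using bx0 by (simp add: field_simps)
  then have e0: "e0 \<in> S" "B e0 e0 = 1" "T e0 = \<theta> *\<^sub>R e0"
    using x0S Suc.prems(1) Tx0
    by (simp_all add: e0_def subspace_scale bsimps linear_scale[OF lin])
  define S' where "S' = {y \<in> S. B e0 y = 0}"
  have S': "subspace S'"
    using Suc.prems(1) by (auto simp: S'_def subspace_def bsimps B.zero_right)
  have decomp: "x - B x e0 *\<^sub>R e0 \<in> S'" if "x \<in> S" for x
    using that e0 Suc.prems(1) by (auto simp: S'_def subspace_diff subspace_scale bsimps sym)
  have span: "S = span (insert e0 S')"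
  proof
    show "S \<subseteq> span (insert e0 S')"
    proof
      fix x assume "x \<in> S"
      then have "(x - B x e0 *\<^sub>R e0) + B x e0 *\<^sub>R e0 \<in> span (insert e0 S')"
        using decomp by (intro span_add span_scale) (auto intro: span_base)
      then show "x \<in> span (insert e0 S')" by simp
    qed
    show "span (insert e0 S') \<subseteq> S"
      using e0 Suc.prems(1) by (intro span_minimal) (auto simp: S'_def)
  qed
  have "e0 \<notin> S'" using e0(2) by (simp add: S'_def)
  moreover have "span S' = S'" using S' by (simp add: span_eq_iff)
  ultimately have "e0 \<notin> span S'" by (simp only: not_False_eq_True)
  then have "dim S = dim S' + 1"
    unfolding span dim_span by (simp add: dim_insert)
  then have n: "n = dim S'" using Suc.hyps(2) by simp
  have "\<exists>E. finite E \<and> E \<subseteq> S' \<and> card E = dim S' \<and>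
           (\<forall>e\<in>E. \<exists>\<theta>. T e = \<theta> *\<^sub>R e) \<and> (\<forall>e\<in>E. \<forall>f\<in>E. B e f = (if e = f then 1 else 0)) \<and>
           (\<forall>x\<in>S'. x = (\<Sum>e\<in>E. B x e *\<^sub>R e))"
  proof (rule Suc.hyps(1)[OF n S'])
    show "T x \<in> S'" if "x \<in> S'" for x
      using that Suc.prems(2) Suc.prems(3)[OF e0(1), of x] e0(3) by (auto simp: S'_def bsimps)
    show "B (T x) y = B x (T y)" if "x \<in> S'" "y \<in> S'" for x y
      using that Suc.prems(3) by (auto simp: S'_def)
  qed
  then obtain E where E: "finite E" "E \<subseteq> S'" "card E = dim S'" "\<forall>e\<in>E. \<exists>\<theta>. T e = \<theta> *\<^sub>R e"
    "\<forall>e\<in>E. \<forall>f\<in>E. B e f = (if e = f then 1 else 0)" "\<forall>x\<in>S'. x = (\<Sum>e\<in>E. B x e *\<^sub>R e)"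
    by auto
  have new: "e0 \<notin> E" using E(2) e0(2) by (auto simp: S'_def)
  have orth: "B e0 f = 0" "B f e0 = 0" if "f \<in> E" for f
    using E(2) that sym by (auto simp: S'_def)
  show ?case
  proof (intro exI[of _ "insert e0 E"] conjI)
    show "finite (insert e0 E)" "insert e0 E \<subseteq> S" using E e0 by (auto simp: S'_def)
    show "card (insert e0 E) = dim S" using E new n Suc.hyps(2) by simp
    show "\<forall>e\<in>insert e0 E. \<exists>\<theta>. T e = \<theta> *\<^sub>R e" using E(4) e0(3) by auto
    show "\<forall>e\<in>insert e0 E. \<forall>f\<in>insert e0 E. B e f = (if e = f then 1 else 0)"
      using E(5) e0(2) orth new by auto
    show "\<forall>x\<in>S. x = (\<Sum>e\<in>insert e0 E. B x e *\<^sub>R e)"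
    proof
      fix x assume "x \<in> S"
      then have "x - B x e0 *\<^sub>R e0 = (\<Sum>e\<in>E. B (x - B x e0 *\<^sub>R e0) e *\<^sub>R e)"
        using decomp E(6) by blast
      also have "\<dots> = (\<Sum>e\<in>E. B x e *\<^sub>R e)"
        by (intro sum.cong) (auto simp: bsimps orth)
      finally show "x = (\<Sum>e\<in>insert e0 E. B x e *\<^sub>R e)"
        using E(1) new by (simp add: algebra_simps)
    qed
  qed
qed

section \<open>Eigenbases of symmetric matrices\<close>

lemma dot_matrix_vector_transpose:
  fixes M :: "real^'n^'m"
  shows "x \<bullet> (M *v y) = (transpose M *v x) \<bullet> y"
  by (metis dot_lmul_matrix transpose_matrix_vector)

lemma mat_mult_vector: "mat c *v (x :: real^'n) = c *\<^sub>R x"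
proof -
  have "linear ((*\<^sub>R) c :: real^'n \<Rightarrow> real^'n)" by (simp add: linear_scale_self)
  from matrix_vector_mul(2)[OF this] show ?thesis
    unfolding matrix_scaleR by (rule fun_cong)
qed

lemma prod_linear_factors_unique:
  fixes f :: "'a \<Rightarrow> real" and g :: "'b \<Rightarrow> real"
  assumes "finite A" "finite B" and eq: "\<And>x. (\<Prod>i\<in>A. x - f i) = (\<Prod>j\<in>B. x - g j)"
  shows "image_mset f (mset_set A) = image_mset g (mset_set B)"
proof -
  have roots: "proots (\<Prod>i\<in>C. [:- h i, 1:]) = image_mset h (mset_set C)" if "finite C"
    for C :: "'c set" and h :: "'c \<Rightarrow> real"
    using that by (subst proots_prod) (auto simp: sum_unfold_sum_mset)
  have "poly (\<Prod>i\<in>A. [:- f i, 1:]) = poly (\<Prod>j\<in>B. [:- g j, 1:])"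
    using eq by (auto simp: poly_prod fun_eq_iff)
  then have "(\<Prod>i\<in>A. [:- f i, 1:]) = (\<Prod>j\<in>B. [:- g j, 1:])"
    using poly_eq_poly_eq_iff by blast
  then show ?thesis using roots[OF assms(1), of f] roots[OF assms(2), of g] by simp
qed

definition eigenbasis :: "real^'d^'d \<Rightarrow> (nat \<Rightarrow> real) \<Rightarrow> (nat \<Rightarrow> real^'d) \<Rightarrow> bool" where
  "eigenbasis A lam u \<longleftrightarrow>
     (\<forall>i\<in>{1..CARD('d)}. A *v u i = lam i *\<^sub>R u i) \<and>
     (\<forall>i\<in>{1..CARD('d)}. \<forall>j\<in>{1..CARD('d)}. u i \<bullet> u j = (if i = j then 1 else 0)) \<and>
     (\<forall>x. x = (\<Sum>i = 1..CARD('d). (u i \<bullet> x) *\<^sub>R u i))"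

text \<open>The spectral theorem produces eigenvalues in no particular order. They are the roots of the
  characteristic polynomial with multiplicity, as are the numbers \<open>lam i\<close>, so a permutation matches
  the two families.\<close>

lemma ex_eigenbasis:
  fixes A :: "real^'d^'d"
  assumes sym: "transpose A = A"
    and charpoly: "\<And>x. det (mat x - A) = (\<Prod>i = 1..CARD('d). x - lam i)"
  shows "\<exists>u. eigenbasis A lam u"
proof -
  have "linear ((*v) A)" by (rule matrix_vector_mul_linear)
  note spectral_theorem_form[of inner "(*v) A" UNIV, OF bounded_bilinear_inner inner_commute _ this,
      unfolded ball_UNIV]
  then obtain E :: "(real^'d) set" where E: "finite E" "card E = CARD('d)"
    "\<And>e. e \<in> E \<Longrightarrow> \<exists>\<theta>. A *v e = \<theta> *\<^sub>R e"
    "\<And>e f. e \<in> E \<Longrightarrow> f \<in> E \<Longrightarrow> e \<bullet> f = (if e = f then 1 else 0)"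
    "\<And>x. x = (\<Sum>e\<in>E. (x \<bullet> e) *\<^sub>R e)"
    using sym by (auto simp: dot_matrix_vector_transpose)
  obtain \<theta> where \<theta>: "\<And>e. e \<in> E \<Longrightarrow> A *v e = \<theta> e *\<^sub>R e" using E(3) by metis
  obtain \<beta> :: "'d \<Rightarrow> real^'d" where \<beta>: "bij_betw \<beta> UNIV E"
    using E(1,2) finite_same_card_bij[of "UNIV :: 'd set" E] by auto
  have \<beta>E: "\<beta> i \<in> E" for i using \<beta> by (auto simp: bij_betw_def)
  have \<beta>o: "\<beta> i \<bullet> \<beta> j = (if i = j then 1 else 0)" for i j
    using E(4)[OF \<beta>E \<beta>E] \<beta> by (auto simp: bij_betw_def inj_eq)
  define U :: "real^'d^'d" where "U = (\<chi> i j. \<beta> j $ i)"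
  have UU: "transpose U ** U = mat 1"
  proof -
    have "column j U = \<beta> j" for j by (simp add: U_def column_def vec_eq_iff)
    then show ?thesis by (simp add: matrix_mult_transpose_dot_column \<beta>o mat_def)
  qed
  have diag: "transpose U ** ((mat x - A) ** U) = (\<chi> i j. if i = j then x - \<theta> (\<beta> i) else 0)" for x
  proof -
    have "((mat x - A) ** U) $ k $ j = (x - \<theta> (\<beta> j)) * \<beta> j $ k" for k j
    proof -
      have "((mat x - A) ** U) $ k $ j = ((mat x - A) *v \<beta> j) $ k"
        by (simp add: matrix_matrix_mult_def matrix_vector_mult_def U_def)
      also have "(mat x - A) *v \<beta> j = x *\<^sub>R \<beta> j - \<theta> (\<beta> j) *\<^sub>R \<beta> j"
      proof -
        show ?thesis by (simp add: matrix_vector_mult_diff_rdistrib mat_mult_vector \<theta>[OF \<beta>E])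
      qed
      finally show ?thesis by (simp add: algebra_simps)
    qed
    then have "(transpose U ** ((mat x - A) ** U)) $ i $ j = (x - \<theta> (\<beta> j)) * (\<beta> i \<bullet> \<beta> j)" for i j
      by (subst matrix_matrix_mult_def) (simp add: transpose_def U_def inner_vec_def sum_distrib_left ac_simps)
    then show ?thesis by (simp add: vec_eq_iff \<beta>o)
  qed
  have "det (mat x - A) = (\<Prod>e\<in>E. x - \<theta> e)" for x
  proof -
    have dU: "det (transpose U) * det U = 1" using arg_cong[OF UU, of det] by (simp add: det_mul)
    have "det (mat x - A) = det (transpose U) * det (mat x - A) * det U"
      using dU by (simp add: algebra_simps)
    also have "\<dots> = det (transpose U ** ((mat x - A) ** U))" by (simp add: det_mul)
    also have "\<dots> = (\<Prod>i\<in>UNIV. x - \<theta> (\<beta> i))"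
      unfolding diag by (subst det_diagonal) auto
    also have "\<dots> = (\<Prod>e\<in>E. x - \<theta> e)"
      using prod.reindex_bij_betw[OF \<beta>, of "\<lambda>e. x - \<theta> e"] .
    finally show ?thesis .
  qed
  moreover obtain h where h: "bij_betw h {1..CARD('d)} E"
    using E(1,2) finite_same_card_bij[of "{1..CARD('d)}" E] by auto
  ultimately have "(\<Prod>i = 1..CARD('d). x - lam i) = (\<Prod>i = 1..CARD('d). x - \<theta> (h i))" for x
    using charpoly prod.reindex_bij_betw[OF h, of "\<lambda>e. x - \<theta> e"] by metis
  then have "image_mset lam (mset_set {1..CARD('d)}) = image_mset (\<lambda>i. \<theta> (h i)) (mset_set {1..CARD('d)})"
    by (intro prod_linear_factors_unique) auto
  from image_mset_eq_implies_permutes[OF finite_atLeastAtMost this]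
  obtain p where p: "p permutes {1..CARD('d)}"
    and "\<forall>i\<in>{1..CARD('d)}. lam i = \<theta> (h (p i))" by blast
  then have p2: "lam i = \<theta> (h (p i))" if "i \<in> {1..CARD('d)}" for i
    using that by blast
  define u where "u i = h (p i)" for i
  have u: "bij_betw u {1..CARD('d)} E"
    unfolding u_def using bij_betw_trans[OF permutes_imp_bij[OF p] h] by (simp add: o_def)
  then have uE: "u i \<in> E" if "i \<in> {1..CARD('d)}" for i using that by (auto simp: bij_betw_def)
  show ?thesis unfolding eigenbasis_def
  proof (intro exI[of _ u] conjI ballI allI)
    show "A *v u i = lam i *\<^sub>R u i" if "i \<in> {1..CARD('d)}" for i
      using \<theta>[OF uE[OF that]] p2[OF that] by (simp add: u_def)
    show "u i \<bullet> u j = (if i = j then 1 else 0)" if "i \<in> {1..CARD('d)}" "j \<in> {1..CARD('d)}" for i j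
      using E(4)[OF uE[OF that(1)] uE[OF that(2)]] u that by (auto simp: bij_betw_def inj_on_eq_iff)
    show "x = (\<Sum>i = 1..CARD('d). (u i \<bullet> x) *\<^sub>R u i)" for x
      using E(5)[of x] sum.reindex_bij_betw[OF u, of "\<lambda>e. (x \<bullet> e) *\<^sub>R e"] by (simp add: inner_commute)
  qed
qed

section \<open>Chebyshev iteration with deflation\<close>

text \<open>The Chebyshev polynomials of the first kind.\<close>

fun cheb :: "nat \<Rightarrow> real \<Rightarrow> real" where
  "cheb 0 x = 1"
| "cheb (Suc 0) x = x"
| "cheb (Suc (Suc n)) x = 2 * x * cheb (Suc n) x - cheb n x"

lemma cheb_cos: "cheb n (cos \<theta>) = cos (real n * \<theta>)"
proof (induction n "cos \<theta>" rule: cheb.induct)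
  case (3 n)
  have "cos (real (Suc (Suc n)) * \<theta>) + cos (real n * \<theta>) = 2 * cos \<theta> * cos (real (Suc n) * \<theta>)"
    using cos_times_cos[of \<theta> "real (Suc n) * \<theta>"] cos_minus[of "\<theta> - real (Suc n) * \<theta>"]
    by (simp add: algebra_simps)
  then show ?case using 3 by simp
qed simp_all

lemma cheb_bounded: "\<bar>x\<bar> \<le> 1 \<Longrightarrow> \<bar>cheb n x\<bar> \<le> 1"
  using cheb_cos[of n "arccos x"] by (simp add: cos_arccos_abs)

text \<open>Outside \<open>[-1, 1]\<close> the substitution \<open>x = (z + 1 / z) / 2\<close> takes the place of \<open>x = cos \<theta>\<close>.\<close>

lemma cheb_joukowski:
  assumes "z * w = 1"
  shows "cheb n ((z + w) / 2) = (z ^ n + w ^ n) / 2"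
proof (induction n "(z + w) / 2" rule: cheb.induct)
  case (3 n)
  have "(z + w) * (z ^ Suc n + w ^ Suc n) = z ^ Suc (Suc n) + w ^ Suc (Suc n) + (z * w) * (z ^ n + w ^ n)"
    by (simp add: algebra_simps)
  then have "(z + w) * (z ^ Suc n + w ^ Suc n) = z ^ Suc (Suc n) + w ^ Suc (Suc n) + (z ^ n + w ^ n)"
    by (simp only: assms mult_1)
  then show ?case using 3 by (simp del: power_Suc) (simp add: field_simps del: power_Suc)
qed simp_all

lemma exp_double_le:
  fixes q :: real
  assumes "0 \<le> q" "q < 1"
  shows "exp (2 * q) \<le> (1 + q) / (1 - q)"
proof -
  let ?f = "\<lambda>q. ln (1 + q) - ln (1 - q) - 2 * q"
  have "?f 0 \<le> ?f q"
  proof (rule DERIV_nonneg_imp_nondecreasing[OF assms(1)])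
    fix x assume x: "0 \<le> x" "x \<le> q"
    have "(?f has_real_derivative (1 / (1 + x) + 1 / (1 - x) - 2)) (at x)"
      using x assms by (auto intro!: derivative_eq_intros simp: divide_simps)
    moreover have "1 / (1 + x) + 1 / (1 - x) - 2 = 2 * x\<^sup>2 / ((1 + x) * (1 - x))"
      using x assms by (simp add: divide_simps) (simp add: algebra_simps power2_eq_square)
    ultimately show "\<exists>y. (?f has_real_derivative y) (at x) \<and> 0 \<le> y"
      using x assms by (intro exI[of _ "2 * x\<^sup>2 / ((1 + x) * (1 - x))"]) auto
  qed
  then have "2 * q \<le> ln ((1 + q) / (1 - q))"
    using assms by (simp add: ln_div)
  then show ?thesis using assms by (simp add: ln_ge_iff)
qed

text \<open>The point \<open>(c + a) / (c - a)\<close> is the image of \<open>0\<close> under the decreasing affine map from \<open>[a, c]\<close> to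
  \<open>[-1, 1]\<close>. With \<open>q = sqrt (a / c)\<close> it equals \<open>(z + 1 / z) / 2\<close> for \<open>z = (1 + q) / (1 - q) \<ge> exp (2 q)\<close>.\<close>

lemma cheb_growth:
  assumes "0 < a" "a < c"
  shows "exp (2 * real m * sqrt (a / c)) \<le> 2 * cheb m ((c + a) / (c - a))"
proof -
  define q where "q = sqrt (a / c)"
  have q: "0 < q" "q < 1" "q\<^sup>2 = a / c" using assms by (auto simp: q_def)
  define z where "z = (1 + q) / (1 - q)"
  define w where "w = (1 - q) / (1 + q)"
  have zw: "z * w = 1" "0 < w" using q by (simp_all add: z_def w_def)
  have "(z + w) / 2 = (1 + q\<^sup>2) / (1 - q\<^sup>2)"
  proof -
    have "1 - q\<^sup>2 = (1 - q) * (1 + q)" by (simp add: power2_eq_square algebra_simps)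
    then show ?thesis using q(1,2)
      by (simp add: z_def w_def divide_simps) (simp add: power2_eq_square algebra_simps)
  qed
  also have "\<dots> = (c + a) / (c - a)" using assms unfolding q(3) by (simp add: divide_simps)
  finally have \<sigma>: "(c + a) / (c - a) = (z + w) / 2" by (rule sym)
  have "exp (2 * real m * q) = exp (2 * q) ^ m"
    by (simp add: exp_of_nat_mult[symmetric] algebra_simps)
  also have "\<dots> \<le> z ^ m" using exp_double_le[of q] q by (intro power_mono) (auto simp: z_def)
  also have "\<dots> \<le> 2 * cheb m ((c + a) / (c - a))"
    unfolding \<sigma> cheb_joukowski[OF zw(1)] using zw(2) by simp
  finally show ?thesis by (simp add: q_def)
qed

lemma ex_form_projection:
  fixes N :: "real^'d^'d"
  assumes N: "symmetric_pos_def N" and W: "subspace W"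
  shows "\<exists>P. linear P \<and> (\<forall>x. P x \<in> W) \<and> (\<forall>x. \<forall>w\<in>W. w \<bullet> (N *v (x - P x)) = 0)"
proof -
  define B where "B x y = x \<bullet> (N *v y)" for x y
  have sym: "B x y = B y x" for x y
    using N dot_matrix_vector_transpose[of x N y]
    by (simp add: B_def symmetric_pos_def_def inner_commute)
  have pos: "0 < B x x" if "x \<noteq> 0" for x using N that by (simp add: B_def symmetric_pos_def_def)
  have bil: "bounded_bilinear B"
    unfolding B_def
    by (rule bounded_bilinear.comp[OF bounded_bilinear_inner bounded_linear_ident matrix_vector_mul_bounded_linear])
  interpret B: bounded_bilinear B by (fact bil)
  note bsimps = B.add_left B.add_right B.diff_left B.diff_right B.scaleR_left B.scaleR_right
    B.sum_left B.sum_right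
  \<comment> \<open>The identity operator on \<open>W\<close>: every vector is an eigenvector, so this is just an orthonormal basis.\<close>
  obtain D where D: "finite D" "D \<subseteq> W" "\<And>e f. e \<in> D \<Longrightarrow> f \<in> D \<Longrightarrow> B e f = (if e = f then 1 else 0)"
    "\<And>x. x \<in> W \<Longrightarrow> x = (\<Sum>e\<in>D. B x e *\<^sub>R e)"
    using spectral_theorem_form[of B id W, OF bil sym pos linear_id W] by (simp add: Ball_def) blast
  define prj where "prj x = (\<Sum>e\<in>D. B x e *\<^sub>R e)" for x
  have prjW: "prj x \<in> W" for x
    unfolding prj_def using D(2) W by (intro subspace_sum subspace_scale) auto
  have prjlin: "linear prj"
    unfolding prj_def
    by (auto intro!: linearI simp: bsimps scaleR_add_left sum.distrib scaleR_sum_right)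
  have orthD: "B (x - prj x) e = 0" if "e \<in> D" for x e
  proof -
    have "B (prj x) e = (\<Sum>f\<in>D. B x f * (if f = e then 1 else 0))"
      unfolding prj_def bsimps by (intro sum.cong refl) (simp add: D(3) that)
    then show ?thesis using D(1) that by (simp add: bsimps if_distrib cong: if_cong)
  qed
  have orthW: "B w (x - prj x) = 0" if "w \<in> W" for w x
  proof -
    have "B (x - prj x) (\<Sum>e\<in>D. B w e *\<^sub>R e) = 0" by (simp add: bsimps(6,8) orthD)
    then show ?thesis using D(4)[OF that] sym by simp
  qed

  show ?thesis using prjlin prjW orthW unfolding B_def by blast
qed

text \<open>Chebyshev iteration deflated by \<open>W\<close>. The compression \<open>T\<close> of \<open>N\<close> to the \<open>N\<close>-orthogonal complement \<open>H\<close>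
  of \<open>W\<close> is self-adjoint for the form of \<open>N\<close>, and the hypothesis \<open>range\<close> says that its spectrum lies in \<open>[a, c]\<close>. The
  residual polynomial of degree \<open>m\<close> is the scaled Chebyshev polynomial normalised at \<open>0\<close>. The spaces \<open>K n\<close>
  are left abstract: only their behaviour under one multiplication by \<open>N\<close> matters.\<close>

lemma deflated_chebyshev_iterate:
  fixes N :: "real^'d^'d" and K :: "nat \<Rightarrow> (real^'d) set"
  assumes N: "symmetric_pos_def N"
    and K: "\<And>n. subspace (K n)" "\<And>n. K n \<subseteq> K (Suc n)" "\<And>n x. x \<in> K n \<Longrightarrow> N *v x \<in> K (Suc n)"
    and start: "N *v xs \<in> K 1"
    and W: "subspace W" "W \<subseteq> K 0"
    and ac: "0 < a" "a < c"
    and range: "\<And>h. (\<And>w. w \<in> W \<Longrightarrow> w \<bullet> (N *v h) = 0) \<Longrightarrow>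
        a * (h \<bullet> (N *v h)) \<le> (N *v h) \<bullet> (N *v h) \<and> (N *v h) \<bullet> (N *v h) \<le> c * (h \<bullet> (N *v h))"
  shows "\<exists>x\<in>K m. mat_norm N (xs - x) \<le> 2 * exp (- 2 * real m * sqrt (a / c)) * mat_norm N xs"
proof -
  define B where "B x y = x \<bullet> (N *v y)" for x y
  have sym: "B x y = B y x" for x y
    using N dot_matrix_vector_transpose[of x N y]
    by (simp add: B_def symmetric_pos_def_def inner_commute)
  have pos: "0 < B x x" if "x \<noteq> 0" for x using N that by (simp add: B_def symmetric_pos_def_def)
  have bil: "bounded_bilinear B"
    unfolding B_def
    by (rule bounded_bilinear.comp[OF bounded_bilinear_inner bounded_linear_ident matrix_vector_mul_bounded_linear])
  interpret B: bounded_bilinear B by (fact bil)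
  note bsimps = B.add_left B.add_right B.diff_left B.diff_right B.scaleR_left B.scaleR_right
    B.sum_left B.sum_right
  have nonneg: "0 \<le> B x x" for x using pos[of x] by (cases "x = 0") (auto simp: B.zero_left)
  have Kmono: "K n \<subseteq> K n'" if "n \<le> n'" for n n' using K(2) that by (rule lift_Suc_mono_le)

  obtain prj where prjlin: "linear prj" and prjW: "\<And>x. prj x \<in> W"
    and orthW: "\<And>w x. w \<in> W \<Longrightarrow> B w (x - prj x) = 0"
    using ex_form_projection[OF N W(1)] unfolding B_def by blast
  define H where "H = {h. \<forall>w\<in>W. B w h = 0}"
  have H: "subspace H" by (auto simp: H_def subspace_def bsimps B.zero_right)
  define T where "T h = N *v h - prj (N *v h)" for h
  have Tlin: "linear T"
    unfolding T_def
    by (intro linear_compose_sub linear_compose[OF matrix_vector_mul_linear prjlin, unfolded o_def]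
        matrix_vector_mul_linear)
  have TH: "T h \<in> H" for h using orthW by (auto simp: H_def T_def)
  have BT: "B (T h) g = (N *v h) \<bullet> (N *v g)" if "g \<in> H" for h g
  proof -
    have "B (prj (N *v h)) g = 0" using that prjW by (auto simp: H_def)
    then show ?thesis by (simp add: T_def bsimps) (simp add: B_def)
  qed
  have BTsym: "B (T h) g = B h (T g)" if "h \<in> H" "g \<in> H" for h g
    using BT[OF that(1), of g] BT[OF that(2), of h] sym by (simp add: inner_commute)
  obtain E where E: "finite E" "E \<subseteq> H" "\<And>e. e \<in> E \<Longrightarrow> \<exists>\<theta>. T e = \<theta> *\<^sub>R e"
    "\<And>e f. e \<in> E \<Longrightarrow> f \<in> E \<Longrightarrow> B e f = (if e = f then 1 else 0)"
    "\<And>x. x \<in> H \<Longrightarrow> x = (\<Sum>e\<in>E. B x e *\<^sub>R e)"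
    using spectral_theorem_form[of B T H, OF bil sym pos Tlin H TH BTsym] by (simp add: Ball_def) blast
  obtain \<theta> where \<theta>: "\<And>e. e \<in> E \<Longrightarrow> T e = \<theta> e *\<^sub>R e" using E(3) by metis
  have \<theta>_bounds: "a \<le> \<theta> e" "\<theta> e \<le> c" if "e \<in> E" for e
  proof -
    have "e \<in> H" using E(2) that by blast
    then have "\<theta> e = (N *v e) \<bullet> (N *v e)" using BT[of e e] \<theta>[OF that] E(4)[OF that that] by (simp add: bsimps)
    moreover have "e \<bullet> (N *v e) = 1" using E(4)[OF that that] by (simp add: B_def)
    moreover have "w \<bullet> (N *v e) = 0" if "w \<in> W" for w using \<open>e \<in> H\<close> that by (auto simp: H_def B_def)
    ultimately show "a \<le> \<theta> e" "\<theta> e \<le> c" using range[of e] by auto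
  qed

  \<comment> \<open>The map \<open>x \<mapsto> \<sigma> - \<rho> x\<close> takes \<open>[a, c]\<close> onto \<open>[-1, 1]\<close>.\<close>
  define \<sigma> where "\<sigma> = (c + a) / (c - a)"
  define \<rho> where "\<rho> = 2 / (c - a)"
  have node: "\<bar>\<sigma> - \<rho> * \<theta> e\<bar> \<le> 1" if "e \<in> E" for e
    using \<theta>_bounds[OF that] ac by (auto simp: \<sigma>_def \<rho>_def abs_le_iff divide_simps)
  define h0 where "h0 = xs - prj xs"
  have h0: "h0 \<in> H" using orthW by (auto simp: h0_def H_def)
  define v where "v n = (\<Sum>e\<in>E. (cheb n (\<sigma> - \<rho> * \<theta> e) * B h0 e) *\<^sub>R e)" for n
  define L where "L x = \<sigma> *\<^sub>R x - \<rho> *\<^sub>R T x" for x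
  have Lv: "L (v n) = (\<Sum>e\<in>E. ((\<sigma> - \<rho> * \<theta> e) * cheb n (\<sigma> - \<rho> * \<theta> e) * B h0 e) *\<^sub>R e)" for n
    unfolding L_def v_def
    by (simp add: linear_sum[OF Tlin] linear_scale[OF Tlin] \<theta> scaleR_sum_right flip: sum_subtractf)
      (simp add: algebra_simps)
  have v0: "v 0 = h0" using E(5)[OF h0] by (simp add: v_def)
  have v1: "v (Suc 0) = L (v 0)" unfolding Lv by (simp add: v_def)
  have v2: "v (Suc (Suc n)) = 2 *\<^sub>R L (v (Suc n)) - v n" for n
    unfolding Lv unfolding v_def by (simp add: scaleR_sum_right algebra_simps flip: sum_subtractf)

  \<comment> \<open>The three-term recurrence never leaves the Krylov spaces, because projecting onto \<open>W\<close>
    only adds elements of \<open>W\<close>.\<close>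
  have step: "L y - (\<sigma> * \<tau>) *\<^sub>R xs \<in> K (Suc n)" if "y - \<tau> *\<^sub>R xs \<in> K n" for y \<tau> n
  proof -
    have "N *v y = \<tau> *\<^sub>R (N *v xs) + N *v (y - \<tau> *\<^sub>R xs)"
      by (simp add: matrix_vector_mult_diff_distrib matrix_vector_mult_scaleR)
    also have "\<dots> \<in> K (Suc n)"
      using start Kmono[of 1 "Suc n"] K(3)[OF that] by (intro subspace_add subspace_scale K(1)) auto
    finally have "N *v y \<in> K (Suc n)" .
    moreover have "prj (N *v y) \<in> K (Suc n)" using prjW W(2) Kmono[of 0 "Suc n"] by auto
    moreover have "y - \<tau> *\<^sub>R xs \<in> K (Suc n)" using that K(2) by blast
    ultimately have "\<sigma> *\<^sub>R (y - \<tau> *\<^sub>R xs) - \<rho> *\<^sub>R (N *v y - prj (N *v y)) \<in> K (Suc n)"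
      using K(1)[of "Suc n"] by (meson subspace_diff subspace_scale)
    then show ?thesis by (simp add: L_def T_def algebra_simps)
  qed
  have vK: "v n - cheb n \<sigma> *\<^sub>R xs \<in> K n" for n
  proof (induction n rule: cheb.induct[of "\<lambda>n _. v n - cheb n \<sigma> *\<^sub>R xs \<in> K n" _ undefined])
    case 1
    have "- prj xs \<in> K 0" using prjW W K(1)[of 0] by (auto intro!: subspace_neg)
    then show ?case by (simp add: v0 h0_def)
  next
    case 2
    have "v 0 - 1 *\<^sub>R xs \<in> K 0" using prjW W K(1) by (auto simp: v0 h0_def intro!: subspace_neg)
    from step[OF this] show ?case by (simp add: v1)
  next
    case (3 n)
    have "2 *\<^sub>R (L (v (Suc n)) - (\<sigma> * cheb (Suc n) \<sigma>) *\<^sub>R xs) - (v n - cheb n \<sigma> *\<^sub>R xs) \<in> K (Suc (Suc n))"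
      using step[OF 3(1)] subsetD[OF Kmono 3(2), of "Suc (Suc n)"] K(1)[of "Suc (Suc n)"]
      by (meson subspace_diff subspace_scale le_SucI order_refl)
    then show ?case by (simp add: v2 algebra_simps)
  qed

  define \<tau> where "\<tau> = cheb m \<sigma>"
  have \<tau>: "exp (2 * real m * sqrt (a / c)) \<le> 2 * \<tau>"
    unfolding \<tau>_def \<sigma>_def by (rule cheb_growth[OF ac])
  then have \<tau>pos: "0 < \<tau>" using exp_gt_zero[of "2 * real m * sqrt (a / c)"] by linarith
  have Bsum: "B (\<Sum>e\<in>E. f e *\<^sub>R e) (\<Sum>e\<in>E. f e *\<^sub>R e) = (\<Sum>e\<in>E. (f e)\<^sup>2)" for f
  proof -
    have "B (\<Sum>e\<in>E. f e *\<^sub>R e) (\<Sum>e\<in>E. f e *\<^sub>R e) = (\<Sum>e\<in>E. \<Sum>g\<in>E. f e * (f g * (if g = e then 1 else 0)))"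
      unfolding B.sum_left B.sum_right B.scaleR_left B.scaleR_right real_scaleR_def sum_distrib_left
      by (intro sum.cong refl) (auto simp: E(4))
    then show ?thesis using E(1) by (simp add: if_distrib power2_eq_square cong: if_cong)
  qed
  have "B (v m) (v m) \<le> (\<Sum>e\<in>E. (B h0 e)\<^sup>2)"
    unfolding v_def Bsum
  proof (intro sum_mono)
    fix e assume "e \<in> E"
    from cheb_bounded[OF node[OF this], of m]
    have "(cheb m (\<sigma> - \<rho> * \<theta> e))\<^sup>2 \<le> 1" by (simp add: abs_square_le_1)
    then show "(cheb m (\<sigma> - \<rho> * \<theta> e) * B h0 e)\<^sup>2 \<le> (B h0 e)\<^sup>2"
      by (simp add: power_mult_distrib mult_left_le_one_le)
  qed
  also have "\<dots> = B h0 h0" using E(5)[OF h0] Bsum[of "B h0"] by simp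
  also have "\<dots> \<le> B xs xs"
  proof -
    have "B (prj xs) h0 = 0" "B h0 (prj xs) = 0" using h0 prjW sym by (auto simp: H_def)
    then have "B (h0 + prj xs) (h0 + prj xs) = B h0 h0 + B (prj xs) (prj xs)" by (simp add: bsimps)
    then show ?thesis using nonneg[of "prj xs"] by (simp add: h0_def)
  qed
  finally have vm: "B (v m) (v m) \<le> B xs xs" .
  let ?x = "- (1 / \<tau>) *\<^sub>R (v m - \<tau> *\<^sub>R xs)"
  show ?thesis
  proof (intro bexI[of _ "?x"])
    show "?x \<in> K m"
      using vK[of m] K(1) by (intro subspace_scale) (auto simp: \<tau>_def)
    have "xs - ?x = (1 / \<tau>) *\<^sub>R v m"
      using \<tau>pos by (simp add: algebra_simps)
    then have "mat_norm N (xs - ?x) = sqrt ((1 / \<tau>)\<^sup>2 * B (v m) (v m))"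
      using \<tau>pos by (simp add: mat_norm_def B_def matrix_vector_mult_scaleR power2_eq_square)
    also have "\<dots> = (1 / \<tau>) * sqrt (B (v m) (v m))"
      using \<tau>pos by (simp add: real_sqrt_mult real_sqrt_divide)
    also have "\<dots> \<le> (2 * exp (- 2 * real m * sqrt (a / c))) * sqrt (B xs xs)"
    proof (intro mult_mono)
      have "1 / \<tau> \<le> 2 / exp (2 * real m * sqrt (a / c))" using \<tau> \<tau>pos by (simp add: divide_simps)
      then show "1 / \<tau> \<le> 2 * exp (- 2 * real m * sqrt (a / c))" by (simp add: exp_minus divide_inverse)
    qed (use vm nonneg in auto)
    also have "sqrt (B xs xs) = mat_norm N xs" by (simp add: mat_norm_def B_def)
    finally show "mat_norm N (xs - ?x)
        \<le> 2 * exp (- 2 * real m * sqrt (a / c)) * mat_norm N xs" .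
  qed
qed

section \<open>Block Krylov spaces and the block-CG iterate\<close>

lemma funpow_matrix_Suc: "((*v) M ^^ Suc i) v = M *v ((*v) M ^^ i) v"
  by simp

lemma krylov_mono: "t \<le> t' \<Longrightarrow> krylov t M v \<subseteq> krylov t' M v"
  unfolding krylov_def by (intro span_mono image_mono) auto

lemma matrix_span_image:
  fixes M :: "real^'n^'n"
  assumes "x \<in> span S" "\<And>y. y \<in> S \<Longrightarrow> M *v y \<in> span S'"
  shows "M *v x \<in> span S'"
  using assms(1)
proof (induction rule: span_induct_alt)
  case base
  then show ?case by (simp add: span_zero matrix_vector_mult_0_right)
next
  case (step c y z)
  then show ?case using assms(2)
    by (simp add: matrix_vector_right_distrib matrix_vector_mult_scaleR span_add span_scale)
qed

lemma krylov_step: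
  assumes "x \<in> krylov t M v"
  shows "M *v x \<in> krylov (Suc t) M v"
  using assms unfolding krylov_def
proof (rule matrix_span_image)
  fix y assume "y \<in> (\<lambda>i. ((*v) M ^^ i) v) ` {..<t}"
  then obtain i where "i < t" "y = ((*v) M ^^ i) v" by auto
  then have "M *v y = ((*v) M ^^ Suc i) v" "Suc i < Suc t" by auto
  then show "M *v y \<in> span ((\<lambda>i. ((*v) M ^^ i) v) ` {..<Suc t})"
    by (intro span_base) (auto intro: image_eqI[of _ _ "Suc i"])
qed

lemma shifted_mult_vector: "shifted A \<mu> *v x = A *v x + \<mu> *\<^sub>R x"
  by (simp add: shifted_def matrix_vector_mult_add_rdistrib mat_mult_vector)

text \<open>Powers of the shifted matrix are linear combinations of powers of \<open>M\<close> of at most the same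
  exponent, and the opposite shift undoes the first. One space therefore serves all shifts.\<close>

lemma krylov_shifted: "krylov t (shifted A \<mu>) v = krylov t A v"
proof -
  have sub: "krylov t (shifted M \<nu>) v \<subseteq> krylov t M v" for M \<nu>
  proof -
    have "((*v) (shifted M \<nu>) ^^ i) v \<in> krylov (Suc i) M v" for i
    proof (induction i)
      case 0
      then show ?case by (auto simp: krylov_def intro: span_base)
    next
      case (Suc i)
      have "M *v ((*v) (shifted M \<nu>) ^^ i) v + \<nu> *\<^sub>R ((*v) (shifted M \<nu>) ^^ i) v \<in> krylov (Suc (Suc i)) M v"
        using Suc krylov_step[OF Suc] krylov_mono[of "Suc i" "Suc (Suc i)" M v]
        unfolding krylov_def by (intro span_add span_scale) auto
      then show ?case unfolding funpow_matrix_Suc by (subst shifted_mult_vector)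
    qed
    then have "(\<lambda>i. ((*v) (shifted M \<nu>) ^^ i) v) ` {..<t} \<subseteq> krylov t M v"
      using krylov_mono[of "Suc _" t M v] by (intro image_subsetI) (meson Suc_leI lessThan_iff subsetD)
    then show ?thesis unfolding krylov_def by (intro span_minimal) auto
  qed
  have "shifted (shifted A \<mu>) (- \<mu>) = A"
    by (simp add: shifted_def vec_eq_iff mat_def)
  then show ?thesis using sub[of A \<mu>] sub[of "shifted A \<mu>" "- \<mu>"] by auto
qed

lemma block_krylov_shifted: "block_krylov t (shifted A \<mu>) V = block_krylov t A V"
  by (simp add: block_krylov_def krylov_shifted)

lemma subspace_block_krylov: "subspace (block_krylov t M V)"
proof -
  have sub: "subspace (krylov t M v)" for v by (simp add: krylov_def)
  show ?thesis
    unfolding subspace_def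
  proof (intro conjI ballI allI)
    show "0 \<in> block_krylov t M V"
      using subspace_0[OF sub] by (auto simp: block_krylov_def intro!: exI[of _ "\<lambda>_. 0"])
    show "x + y \<in> block_krylov t M V" if "x \<in> block_krylov t M V" "y \<in> block_krylov t M V" for x y
    proof -
      from that obtain f g where "x = sum f UNIV" "\<forall>j. f j \<in> krylov t M (column j V)"
        "y = sum g UNIV" "\<forall>j. g j \<in> krylov t M (column j V)" by (auto simp: block_krylov_def)
      then show ?thesis using subspace_add[OF sub]
        by (auto simp: block_krylov_def sum.distrib intro!: exI[of _ "\<lambda>j. f j + g j"])
    qed
    show "c *\<^sub>R x \<in> block_krylov t M V" if "x \<in> block_krylov t M V" for c x
    proof -
      from that obtain f where "x = sum f UNIV" "\<forall>j. f j \<in> krylov t M (column j V)"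
        by (auto simp: block_krylov_def)
      then show ?thesis using subspace_scale[OF sub]
        by (auto simp: block_krylov_def scaleR_sum_right intro!: exI[of _ "\<lambda>j. c *\<^sub>R f j"])
    qed
  qed
qed

lemma power_column_in_block_krylov:
  assumes "i < t"
  shows "((*v) M ^^ i) (column j V) \<in> block_krylov t M V"
proof -
  let ?v = "((*v) M ^^ i) (column j V)"
  have "?v = (\<Sum>l\<in>UNIV. if l = j then ?v else 0)" by simp
  moreover have "(if l = j then ?v else 0) \<in> krylov t M (column l V)" for l
    using assms by (auto simp: krylov_def intro: span_base span_zero)
  ultimately show ?thesis unfolding block_krylov_def by blast
qed

text \<open>The minimum is attained at the projection of \<open>v\<close> that is orthogonal for the form of \<open>N\<close>.\<close>

lemma ex_form_minimizer:
  fixes N :: "real^'d^'d"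
  assumes N: "symmetric_pos_def N" and S: "subspace S"
  shows "\<exists>y\<in>S. \<forall>x\<in>S. mat_norm N (v - y) \<le> mat_norm N (v - x)"
proof -
  obtain P where P: "\<And>x. P x \<in> S" "\<And>x w. w \<in> S \<Longrightarrow> w \<bullet> (N *v (x - P x)) = 0"
    using ex_form_projection[OF N S] by blast
  have "mat_norm N (v - P v) \<le> mat_norm N (v - x)" if "x \<in> S" for x
  proof -
    define e w where "e = v - P v" and "w = P v - x"
    have "w \<in> S" using P(1) that S by (simp add: w_def subspace_diff)
    then have "w \<bullet> (N *v e) = 0" using P(2) by (simp add: e_def)
    moreover have "e \<bullet> (N *v w) = w \<bullet> (N *v e)"
      using N by (metis dot_matrix_vector_transpose inner_commute symmetric_pos_def_def)
    moreover have "0 \<le> w \<bullet> (N *v w)" using N by (cases "w = 0") (auto simp: symmetric_pos_def_def less_imp_le)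
    ultimately have "e \<bullet> (N *v e) \<le> (e + w) \<bullet> (N *v (e + w))"
      by (simp add: matrix_vector_right_distrib inner_add_left inner_add_right)
    then show ?thesis by (simp add: mat_norm_def e_def w_def)
  qed
  then show ?thesis using P(1) by blast
qed

text \<open>An arbitrary choice among the minimisers is harmless because the minimum is attained.\<close>

lemma bcg_optimal:
  fixes A :: "real^'d^'d" and V :: "real^'k^'d" and i :: 'k and \<mu> :: real
  assumes "symmetric_pos_def (shifted A \<mu>)"
  defines "xs \<equiv> matrix_inv (shifted A \<mu>) *v column i V"
  shows "bcg A V t i \<mu> \<in> block_krylov t A V"
    and "x \<in> block_krylov t A V \<Longrightarrow>
      mat_norm (shifted A \<mu>) (xs - bcg A V t i \<mu>) \<le> mat_norm (shifted A \<mu>) (xs - x)"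
proof -
  let ?S = "block_krylov t (shifted A \<mu>) V"
  let ?f = "\<lambda>x. mat_norm (shifted A \<mu>) (xs - x)"
  obtain y where y: "y \<in> ?S" "\<And>x. x \<in> ?S \<Longrightarrow> ?f y \<le> ?f x"
    using ex_form_minimizer[OF assms(1) subspace_block_krylov] by blast
  have "bcg A V t i \<mu> \<in> ?S \<and> (\<forall>x\<in>?S. ?f (bcg A V t i \<mu>) \<le> ?f x)"
    unfolding bcg_def arg_min_on_def xs_def[symmetric]
    by (rule arg_minI[where x = y and f = ?f and P = "\<lambda>x. x \<in> ?S"])
      (use y in \<open>auto simp: not_less\<close>)
  then show "bcg A V t i \<mu> \<in> block_krylov t A V"
    "x \<in> block_krylov t A V \<Longrightarrow> ?f (bcg A V t i \<mu>) \<le> ?f x"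
    by (auto simp: block_krylov_shifted)
qed

lemma symmetric_pos_def_shifted:
  assumes "symmetric_pos_def A" "0 \<le> \<mu>"
  shows "symmetric_pos_def (shifted A \<mu>)"
proof -
  have "transpose (shifted A \<mu>) = shifted A \<mu>"
  proof -
    have "transpose A $ i $ j = A $ i $ j" for i j using assms(1) by (simp add: symmetric_pos_def_def)
    then show ?thesis by (auto simp: shifted_def vec_eq_iff transpose_def mat_def)
  qed
  moreover have "0 < x \<bullet> (shifted A \<mu> *v x)" if "x \<noteq> 0" for x
    using assms that by (simp add: shifted_mult_vector inner_add_right symmetric_pos_def_def add_pos_nonneg)
  ultimately show ?thesis by (simp add: symmetric_pos_def_def)
qed

lemma symmetric_pos_def_invertible:
  fixes N :: "real^'n^'n"
  assumes "symmetric_pos_def N"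
  shows "invertible N"
proof -
  have "x = 0" if "N *v x = 0" for x
    using assms that by (auto simp: symmetric_pos_def_def)
  then show ?thesis
    by (simp add: invertible_left_inverse matrix_left_invertible_ker)
qed

lemma matrix_inv_mult:
  fixes N :: "real^'n^'n"
  assumes "invertible N"
  shows "N ** matrix_inv N = mat 1" "matrix_inv N ** N = mat 1"
  using assms unfolding invertible_def matrix_inv_def by (metis (mono_tags, lifting) someI_ex)+

lemma matrix_inv_mult_vector:
  fixes N :: "real^'n^'n"
  assumes "invertible N"
  shows "N *v (matrix_inv N *v x) = x" "matrix_inv N *v (N *v x) = x"
  using matrix_inv_mult[OF assms] by (simp_all add: matrix_vector_mul_assoc)

lemma mat_norm_pos: "symmetric_pos_def N \<Longrightarrow> x \<noteq> 0 \<Longrightarrow> 0 < mat_norm N x"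
  by (simp add: mat_norm_def symmetric_pos_def_def)

lemma column_hconcat [simp]:
  "column (Inl i) (hconcat V W) = column i V" "column (Inr j) (hconcat V W) = column j W"
  by (simp_all add: column_def hconcat_def vec_eq_iff)

lemma column_columnvector [simp]: "column i (columnvector b) = b"
  by (simp add: column_def columnvector_def vec_eq_iff)

text \<open>Trades the iterate, which involves a choice, for the existence of one good element.\<close>

lemma bcg_ratio_iff:
  fixes A :: "real^'d^'d" and X :: "real^'m^'d"
  assumes "symmetric_pos_def A" "0 \<le> \<mu>" "b \<noteq> 0"
  defines "V \<equiv> hconcat (columnvector b :: real^1^'d) X"
    and "xs \<equiv> matrix_inv (shifted A \<mu>) *v b"
  shows "mat_norm (shifted A \<mu>) (xs - bcg A V t (Inl 1) \<mu>) / mat_norm (shifted A \<mu>) xs \<le> c \<longleftrightarrow>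
    (\<exists>x\<in>block_krylov t A V. mat_norm (shifted A \<mu>) (xs - x) \<le> c * mat_norm (shifted A \<mu>) xs)"
proof -
  have N: "symmetric_pos_def (shifted A \<mu>)" by (rule symmetric_pos_def_shifted) fact+
  have "xs \<noteq> 0"
    using matrix_inv_mult_vector(1)[OF symmetric_pos_def_invertible[OF N], of b] assms(3)
    by (auto simp: xs_def)
  then have pos: "0 < mat_norm (shifted A \<mu>) xs" by (rule mat_norm_pos[OF N])
  have V: "column (Inl 1) V = b" by (simp add: V_def)
  note opt = bcg_optimal[OF N, where V = V and t = t and i = "Inl 1", unfolded V, folded xs_def]
  show ?thesis
    using opt pos by (auto simp: divide_le_eq intro: order_trans)
qed

lemma eigenbasis_inner:
  fixes A :: "real^'d^'d"
  assumes "eigenbasis A lam u"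
  shows "x \<bullet> y = (\<Sum>i = 1..CARD('d). (u i \<bullet> x) * (u i \<bullet> y))"
proof -
  have "y = (\<Sum>i = 1..CARD('d). (u i \<bullet> y) *\<^sub>R u i)" using assms by (simp add: eigenbasis_def)
  then have "x \<bullet> y = x \<bullet> (\<Sum>i = 1..CARD('d). (u i \<bullet> y) *\<^sub>R u i)" by simp
  also have "\<dots> = (\<Sum>i = 1..CARD('d). (u i \<bullet> x) * (u i \<bullet> y))"
    by (simp add: inner_sum_right inner_commute mult.commute)
  finally show ?thesis .
qed

lemma eigenbasis_coeff:
  fixes A :: "real^'d^'d"
  assumes "eigenbasis A lam u" "transpose A = A" "i \<in> {1..CARD('d)}"
  shows "u i \<bullet> (A *v x) = lam i * (u i \<bullet> x)"
  using assms by (simp add: dot_matrix_vector_transpose eigenbasis_def)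

lemma eigenvalue_pos:
  fixes A :: "real^'d^'d"
  assumes "eigenbasis A lam u" "symmetric_pos_def A" "i \<in> {1..CARD('d)}"
  shows "0 < lam i"
proof -
  have "u i \<bullet> u i = 1" "A *v u i = lam i *\<^sub>R u i" using assms by (simp_all add: eigenbasis_def)
  moreover from this have "u i \<noteq> 0" by auto
  ultimately show ?thesis using assms(2) by (fastforce simp: symmetric_pos_def_def)
qed

text \<open>With \<open>W\<close> the span of the columns of \<open>A\<^sup>k X\<close> and \<open>K n\<close> the sum of the Krylov spaces of length
  \<open>n\<close> for \<open>b\<close> and \<open>k + 1 + n\<close> for the columns of \<open>X\<close>, the space \<open>K (t - k - 1)\<close> fits into the block Krylov
  space. Every eigenvalue of the compression has the form \<open>(N h \<bullet> N h) / (h \<bullet> N h)\<close> with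
  \<open>N h\<close> orthogonal to \<open>W\<close>, and the \<open>\<mu>\<close>-free hypothesis \<open>tail\<close> bounds it.\<close>

lemma block_krylov_error:
  fixes A :: "real^'d^'d" and X :: "real^'m^'d"
  assumes A: "symmetric_pos_def A" and u: "eigenbasis A lam u" and mono: "antimono_on {1..CARD('d)} lam"
    and r: "r < CARD('d)" and \<mu>: "0 \<le> \<mu>" and s: "k < t"
    and tail: "\<And>z. (\<And>j. z \<bullet> ((*v) A ^^ k) (column j X) = 0) \<Longrightarrow>
        z \<bullet> (A *v z) \<le> 36 * lam (r + 1) * (z \<bullet> z)"
  defines "N \<equiv> shifted A \<mu>"
  shows "\<exists>x\<in>block_krylov t A (hconcat (columnvector b :: real^1^'d) X).
    mat_norm N (matrix_inv N *v b - x) \<le>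
      2 * exp (- ((real t - (real k + 1)) / (3 * sqrt (shifted_cond lam CARD('d) (r + 1) \<mu>)))) *
        mat_norm N (matrix_inv N *v b)"
proof -
  have N: "symmetric_pos_def N" unfolding N_def by (rule symmetric_pos_def_shifted) fact+
  define a where "a = lam CARD('d) + \<mu>"
  define l where "l = lam (r + 1) + \<mu>"
  have a: "0 < a" using eigenvalue_pos[OF u A, of "CARD('d)"] \<mu> by (simp add: a_def Suc_le_eq)
  have amin: "a \<le> lam i + \<mu>" if "i \<in> {1..CARD('d)}" for i
    using monotone_onD[OF mono that, of "CARD('d)"] that by (auto simp: a_def)
  have al: "a \<le> l" using amin[of "r + 1"] r by (simp add: l_def)
  define m where "m = t - Suc k"
  define K where "K n = span ((\<lambda>i. ((*v) A ^^ i) b) ` {..<n} \<union>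
      (\<Union>j. (\<lambda>i. ((*v) A ^^ i) (column j X)) ` {..<k + 1 + n}))" for n
  define W where "W = span (range (\<lambda>j. ((*v) A ^^ k) (column j X)))"
  have "\<exists>x\<in>K m. mat_norm N (matrix_inv N *v b - x) \<le>
      2 * exp (- 2 * real m * sqrt (a / (36 * l))) * mat_norm N (matrix_inv N *v b)"
  proof (rule deflated_chebyshev_iterate[OF N, where W = W])
    show "subspace (K n)" "subspace W" for n by (simp_all add: K_def W_def)
    show mono: "K n \<subseteq> K (Suc n)" for n
      unfolding K_def by (intro span_mono Un_mono UN_mono image_mono) auto
    show "N *v x \<in> K (Suc n)" if "x \<in> K n" for n x
    proof -
      have "A *v x \<in> K (Suc n)"
        using that unfolding K_def
      proof (rule matrix_span_image)
        fix y assume "y \<in> (\<lambda>i. ((*v) A ^^ i) b) ` {..<n} \<union>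
            (\<Union>j. (\<lambda>i. ((*v) A ^^ i) (column j X)) ` {..<k + 1 + n})"
        then consider i where "i < n" "y = ((*v) A ^^ i) b"
          | i j where "i < k + 1 + n" "y = ((*v) A ^^ i) (column j X)" by auto
        then show "A *v y \<in> span ((\<lambda>i. ((*v) A ^^ i) b) ` {..<Suc n} \<union>
            (\<Union>j. (\<lambda>i. ((*v) A ^^ i) (column j X)) ` {..<k + 1 + Suc n}))"
        proof cases
          case 1
          then show ?thesis
            by (intro span_base UnI1 image_eqI[of _ _ "Suc i"]) auto
        next
          case 2
          then show ?thesis
            by (intro span_base UnI2 UN_I[of j] image_eqI[of _ _ "Suc i"]) auto
        qed
      qed
      moreover have "x \<in> K (Suc n)" using that mono by blast
      ultimately show ?thesis
        unfolding N_def shifted_mult_vector K_def by (intro span_add span_scale)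
    qed
    show "N *v (matrix_inv N *v b) \<in> K 1"
      unfolding matrix_inv_mult_vector(1)[OF symmetric_pos_def_invertible[OF N]] K_def
      by (intro span_base UnI1 image_eqI[of _ _ 0]) auto
    show "W \<subseteq> K 0"
      unfolding W_def K_def by (intro span_mono) auto
    show "0 < a" "a < 36 * l" using a al by auto
    show "a * (h \<bullet> (N *v h)) \<le> (N *v h) \<bullet> (N *v h) \<and> (N *v h) \<bullet> (N *v h) \<le> 36 * l * (h \<bullet> (N *v h))"
      if orth: "\<And>w. w \<in> W \<Longrightarrow> w \<bullet> (N *v h) = 0" for h
    proof
      have uN: "u i \<bullet> (N *v h) = (lam i + \<mu>) * (u i \<bullet> h)" if "i \<in> {1..CARD('d)}" for i
        using eigenbasis_coeff[OF u _ that] A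
        by (simp add: N_def shifted_mult_vector inner_add_right symmetric_pos_def_def algebra_simps)
      show "a * (h \<bullet> (N *v h)) \<le> (N *v h) \<bullet> (N *v h)"
        unfolding eigenbasis_inner[OF u, of h] eigenbasis_inner[OF u, of "N *v h"] sum_distrib_left
      proof (rule sum_mono)
        fix i assume i: "i \<in> {1..CARD('d)}"
        have "a * ((lam i + \<mu>) * (u i \<bullet> h)\<^sup>2) \<le> (lam i + \<mu>) * ((lam i + \<mu>) * (u i \<bullet> h)\<^sup>2)"
          using amin[OF i] a by (intro mult_right_mono) auto
        then show "a * ((u i \<bullet> h) * (u i \<bullet> (N *v h))) \<le> (u i \<bullet> (N *v h)) * (u i \<bullet> (N *v h))"
          unfolding uN[OF i] by (simp add: power2_eq_square algebra_simps)
      qed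
      \<comment> \<open>The vector \<open>N h\<close> is itself orthogonal to \<open>W\<close>, so the hypothesis applies to it.\<close>
      define v where "v = N *v h"
      have "v \<bullet> (A *v v) \<le> 36 * lam (r + 1) * (v \<bullet> v)"
      proof (rule tail)
        fix j
        have "((*v) A ^^ k) (column j X) \<in> W" unfolding W_def by (rule span_base) simp
        from orth[OF this] show "v \<bullet> ((*v) A ^^ k) (column j X) = 0"
          by (simp add: v_def inner_commute)
      qed
      then have "v \<bullet> (N *v v) \<le> (36 * lam (r + 1) + \<mu>) * (v \<bullet> v)"
        by (simp add: N_def shifted_mult_vector inner_add_right algebra_simps)
      also have "\<dots> \<le> 36 * l * (v \<bullet> v)" using \<mu> by (intro mult_right_mono) (auto simp: l_def)
      finally have vv: "v \<bullet> (N *v v) \<le> 36 * l * (v \<bullet> v)" .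
      \<comment> \<open>Expanding the form at \<open>h - c v\<close> with this \<open>c\<close> is the Cauchy-Schwarz inequality for \<open>h\<close> and \<open>v\<close>.\<close>
      define c where "c = 1 / (36 * l)"
      have c: "0 < c" "36 * l * c = 1" using a al by (auto simp: c_def)
      have hv: "h \<bullet> (N *v v) = v \<bullet> v"
        using N by (simp add: v_def dot_matrix_vector_transpose symmetric_pos_def_def)
      have "0 \<le> (h - c *\<^sub>R v) \<bullet> (N *v (h - c *\<^sub>R v))"
        using N by (cases "h - c *\<^sub>R v = 0") (auto simp: symmetric_pos_def_def less_imp_le)
      also have "\<dots> = h \<bullet> v - 2 * c * (v \<bullet> v) + c\<^sup>2 * (v \<bullet> (N *v v))"
        using hv by (simp add: matrix_vector_mult_diff_distrib matrix_vector_mult_scaleR inner_diff_left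
            inner_diff_right v_def[symmetric] power2_eq_square algebra_simps)
      also have "\<dots> \<le> h \<bullet> v - 2 * c * (v \<bullet> v) + c\<^sup>2 * (36 * l * (v \<bullet> v))"
        using vv by (intro add_left_mono mult_left_mono) auto
      also have "\<dots> = h \<bullet> v - c * (v \<bullet> v)"
        using c(2) by (simp add: power2_eq_square algebra_simps)
      finally have "36 * l * (c * (v \<bullet> v)) \<le> 36 * l * (h \<bullet> v)"
        using a al by (intro mult_left_mono) auto
      then show "(N *v h) \<bullet> (N *v h) \<le> 36 * l * (h \<bullet> (N *v h))"
        using c(2) by (simp add: v_def mult.assoc[symmetric])
    qed
  qed
  moreover have "K m \<subseteq> block_krylov t A (hconcat (columnvector b :: real^1^'d) X)"
  proof -
    let ?V = "hconcat (columnvector b :: real^1^'d) X"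
    have "((*v) A ^^ i) b \<in> block_krylov t A ?V" if "i < m" for i
      using power_column_in_block_krylov[of i t A "Inl 1" ?V] that by (simp add: m_def)
    moreover have "((*v) A ^^ i) (column j X) \<in> block_krylov t A ?V" if "i < k + 1 + m" for i j
      using power_column_in_block_krylov[of i t A "Inr j" ?V] that s by (simp add: m_def)
    ultimately show ?thesis
      unfolding K_def by (intro span_minimal subspace_block_krylov) auto
  qed
  moreover have "- 2 * real m * sqrt (a / (36 * l)) =
      - ((real t - (real k + 1)) / (3 * sqrt (shifted_cond lam CARD('d) (r + 1) \<mu>)))"
  proof -
    have "sqrt (36 :: real) = 6" by (rule real_sqrt_unique) auto
    moreover have mt: "real t = real m + (real k + 1)" using s by (simp add: m_def of_nat_diff)
    moreover have sc: "shifted_cond lam CARD('d) (r + 1) \<mu> = l / a"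
      by (simp add: shifted_cond_def a_def l_def)
    ultimately show ?thesis
      unfolding sc mt using a al by (simp add: real_sqrt_divide real_sqrt_mult field_simps)
  qed
  ultimately show ?thesis by auto
qed

section \<open>Gaussian integration by parts\<close>

lemma one_plus_abs_power_le: "(1 + \<bar>x\<bar>) ^ k \<le> 2 ^ k * (1 + \<bar>x\<bar> ^ k)" for x :: real
proof -
  have "1 + \<bar>x\<bar> \<le> 2 * max 1 \<bar>x\<bar>" by (simp add: max_def)
  then have "(1 + \<bar>x\<bar>) ^ k \<le> (2 * max 1 \<bar>x\<bar>) ^ k" by (intro power_mono) auto
  also have "\<dots> = 2 ^ k * max 1 (\<bar>x\<bar> ^ k)"
    by (auto simp: power_mult_distrib max_def one_le_power power_le_one dest: antisym)
  also have "\<dots> \<le> 2 ^ k * (1 + \<bar>x\<bar> ^ k)" by (intro mult_left_mono) auto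
  finally show ?thesis .
qed

lemma integrable_std_normal_poly_growth:
  fixes f :: "real \<Rightarrow> real"
  assumes [measurable]: "f \<in> borel_measurable borel" and bound: "\<And>x. \<bar>f x\<bar> \<le> C * (1 + \<bar>x\<bar>) ^ k"
  shows "integrable lborel (\<lambda>x. std_normal_density x * f x)"
proof (rule Bochner_Integration.integrable_bound)
  show "integrable lborel (\<lambda>x. \<bar>C\<bar> * 2 ^ k * (std_normal_density x * \<bar>x\<bar> ^ 0 + std_normal_density x * \<bar>x\<bar> ^ k))"
    by (intro integrable_mult_right Bochner_Integration.integrable_add integrable_std_normal_moment_abs)
  have "\<bar>f x\<bar> \<le> \<bar>C\<bar> * 2 ^ k * (1 + \<bar>x\<bar> ^ k)" for x
  proof -
    have "\<bar>f x\<bar> \<le> \<bar>C\<bar> * (1 + \<bar>x\<bar>) ^ k"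
      using bound[of x] by (rule order_trans) (intro mult_right_mono, auto)
    also have "\<dots> \<le> \<bar>C\<bar> * (2 ^ k * (1 + \<bar>x\<bar> ^ k))"
      by (intro mult_left_mono one_plus_abs_power_le) auto
    finally show ?thesis by (simp add: mult.assoc)
  qed
  then have "std_normal_density x * \<bar>f x\<bar> \<le> std_normal_density x * (\<bar>C\<bar> * 2 ^ k * (1 + \<bar>x\<bar> ^ k))" for x
    by (intro mult_left_mono) auto
  then show "AE x in lborel. norm (std_normal_density x * f x) \<le>
      norm (\<bar>C\<bar> * 2 ^ k * (std_normal_density x * \<bar>x\<bar> ^ 0 + std_normal_density x * \<bar>x\<bar> ^ k))"
    by (intro AE_I2) (simp add: abs_mult algebra_simps)
qed simp

text \<open>Integration by parts for the standard normal density \<open>\<phi>\<close>, using \<open>\<phi>' x = - x \<phi> x\<close>.\<close>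

lemma std_normal_integration_by_parts:
  fixes f f' :: "real \<Rightarrow> real"
  assumes deriv: "\<And>x. (f has_real_derivative f' x) (at x)" and cont: "continuous_on UNIV f'"
    and bounds: "\<And>x. \<bar>f x\<bar> \<le> C * (1 + \<bar>x\<bar>) ^ k" "\<And>x. \<bar>f' x\<bar> \<le> C * (1 + \<bar>x\<bar>) ^ k"
  shows "(\<integral>x. std_normal_density x * (x * f x) \<partial>lborel) = (\<integral>x. std_normal_density x * f' x \<partial>lborel)"
proof -
  let ?\<phi> = std_normal_density
  have contf: "continuous_on UNIV f"
    using deriv by (meson DERIV_continuous continuous_at_imp_continuous_on)
  have mf[measurable]: "f \<in> borel_measurable borel" "f' \<in> borel_measurable borel"
    using contf cont by (auto intro: borel_measurable_continuous_onI)
  have C: "0 \<le> C" using bounds(1)[of 0] by simp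
  have i1: "integrable lborel (\<lambda>x. ?\<phi> x * f' x)"
    using bounds(2) by (intro integrable_std_normal_poly_growth) auto
  have i2: "integrable lborel (\<lambda>x. ?\<phi> x * (x * f x))"
  proof (rule integrable_std_normal_poly_growth)
    show "\<bar>x * f x\<bar> \<le> C * (1 + \<bar>x\<bar>) ^ Suc k" for x
    proof -
      have "\<bar>x\<bar> * \<bar>f x\<bar> \<le> (1 + \<bar>x\<bar>) * (C * (1 + \<bar>x\<bar>) ^ k)"
        using bounds(1)[of x] by (intro mult_mono) auto
      then show ?thesis by (simp add: abs_mult algebra_simps)
    qed
  qed simp
  have d\<phi>: "(?\<phi> has_real_derivative - x * ?\<phi> x) (at x)" for x
  proof -
    have "((\<lambda>x. c * exp (- x\<^sup>2 / 2)) has_real_derivative - x * (c * exp (- x\<^sup>2 / 2))) (at x)" for c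
      by (auto intro!: derivative_eq_intros)
    then show ?thesis unfolding std_normal_density_def .
  qed
  have tend: "((\<lambda>x. ?\<phi> x * f x) \<longlongrightarrow> 0) F" if F: "((\<lambda>x. ?\<phi> x * (C * (1 + \<bar>x\<bar>) ^ k)) \<longlongrightarrow> 0) F" for F
  proof (rule Lim_null_comparison[OF _ F])
    have "?\<phi> x * \<bar>f x\<bar> \<le> ?\<phi> x * (C * (1 + \<bar>x\<bar>) ^ k)" for x
      using bounds(1)[of x] by (intro mult_left_mono) auto
    then show "\<forall>\<^sub>F x in F. norm (?\<phi> x * f x) \<le> ?\<phi> x * (C * (1 + \<bar>x\<bar>) ^ k)"
      by (intro always_eventually) (simp add: abs_mult)
  qed
  have "((\<lambda>x::real. exp (- x\<^sup>2 / 2) * (1 + x) ^ k) \<longlongrightarrow> 0) at_top" by real_asymp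
  then have "((\<lambda>x::real. C / sqrt (2 * pi) * (exp (- x\<^sup>2 / 2) * (1 + x) ^ k)) \<longlongrightarrow> 0) at_top"
    by (rule tendsto_mult_right_zero)
  then have top: "((\<lambda>x. ?\<phi> x * (C * (1 + \<bar>x\<bar>) ^ k)) \<longlongrightarrow> 0) at_top"
    by (rule Lim_transform_eventually)
      (auto simp: std_normal_density_def eventually_at_top_linorder intro!: exI[of _ 0])
  have "(\<lambda>x. ?\<phi> (- x) * (C * (1 + \<bar>- x\<bar>) ^ k)) = (\<lambda>x. ?\<phi> x * (C * (1 + \<bar>x\<bar>) ^ k))"
    by (simp add: std_normal_density_def)
  with top have bot: "((\<lambda>x. ?\<phi> x * (C * (1 + \<bar>x\<bar>) ^ k)) \<longlongrightarrow> 0) at_bot"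
    unfolding filterlim_at_bot_mirror by simp
  have "(LBINT x=-\<infinity>..\<infinity>. ?\<phi> x * f' x - ?\<phi> x * (x * f x)) = 0 - 0"
  proof (rule interval_integral_FTC_integrable[where F = "\<lambda>x. ?\<phi> x * f x"])
    show "((\<lambda>x. ?\<phi> x * f x) has_vector_derivative ?\<phi> x * f' x - ?\<phi> x * (x * f x)) (at x)" for x
      unfolding has_real_derivative_iff_has_vector_derivative[symmetric]
      by (rule derivative_eq_intros d\<phi> deriv | simp add: algebra_simps)+
    have "continuous_on UNIV (\<lambda>x. ?\<phi> x * f' x - ?\<phi> x * (x * f x))"
      unfolding std_normal_density_def by (intro continuous_intros cont contf) auto
    then show "isCont (\<lambda>x. ?\<phi> x * f' x - ?\<phi> x * (x * f x)) x" for x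
      by (simp add: continuous_on_eq_continuous_at)
    show "set_integrable lborel (einterval (-\<infinity>) \<infinity>) (\<lambda>x. ?\<phi> x * f' x - ?\<phi> x * (x * f x))"
      unfolding einterval_eq_UNIV set_integrable_def using i1 i2 by simp
    show "(((\<lambda>x. ?\<phi> x * f x) \<circ> real_of_ereal) \<longlongrightarrow> 0) (at_right (-\<infinity>))"
      using tend[OF bot] by (simp add: ereal_tendsto_simps)
    show "(((\<lambda>x. ?\<phi> x * f x) \<circ> real_of_ereal) \<longlongrightarrow> 0) (at_left \<infinity>)"
      using tend[OF top] by (simp add: ereal_tendsto_simps)
  qed simp
  then have "(\<integral>x. ?\<phi> x * f' x - ?\<phi> x * (x * f x) \<partial>lborel) = 0"
    by (simp add: interval_lebesgue_integral_def set_lebesgue_integral_def einterval_eq_UNIV)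
  then show ?thesis using i1 i2 by simp
qed

text \<open>Product measures live on functions of index pairs; this carries them to matrices.\<close>

definition of_entries :: "('d \<times> 'm \<Rightarrow> real) \<Rightarrow> real^'m^'d" where
  "of_entries x = (\<chi> i j. x (i, j))"

abbreviation unit_matrix :: "'d \<Rightarrow> 'm \<Rightarrow> real^'m^'d" where
  "unit_matrix i j \<equiv> axis i (axis j 1)"

lemma of_entries_measurable [measurable]: "of_entries \<in> borel_measurable (PiM UNIV (\<lambda>_. borel))"
  unfolding borel_measurable_euclidean_space[of of_entries] of_entries_def
  by (auto simp: Basis_vec_def inner_axis)

lemma of_entries_upd: "of_entries (x(p := y)) = of_entries (x(p := 0)) + y *\<^sub>R unit_matrix (fst p) (snd p)"
  by (cases p) (auto simp: of_entries_def vec_eq_iff axis_def)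

lemma matrix_eq_sum_unit: "(X :: real^'m^'d) = (\<Sum>p\<in>UNIV. (X $ fst p $ snd p) *\<^sub>R unit_matrix (fst p) (snd p))"
proof -
  have "(\<Sum>p\<in>UNIV. (X $ fst p $ snd p) *\<^sub>R unit_matrix (fst p) (snd p)) $ i $ j = X $ i $ j" for i j
  proof -
    have "(\<Sum>p\<in>UNIV. (X $ fst p $ snd p) *\<^sub>R unit_matrix (fst p) (snd p)) $ i $ j
        = (\<Sum>p\<in>UNIV. if p = (i, j) then X $ i $ j else 0)"
      unfolding sum_component vector_scaleR_component
      by (intro sum.cong refl) (auto simp: axis_def)
    then show ?thesis by simp
  qed
  then show ?thesis by (simp add: vec_eq_iff)
qed

lemma norm_unit_matrix [simp]: "norm (unit_matrix i j) = 1"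
  by (simp add: norm_eq_1 inner_axis_axis)

lemma norm_matrix_le_sum_entries: "norm (X :: real^'m^'d) \<le> (\<Sum>p\<in>UNIV. \<bar>X $ fst p $ snd p\<bar>)"
  by (subst matrix_eq_sum_unit, rule order_trans[OF norm_sum]) simp

context prob_space
begin

lemma gaussian_matrix_distr:
  fixes \<Omega> :: "'a \<Rightarrow> real^'m^'d"
  assumes "gaussian_matrix \<Omega>"
  shows "distr M (PiM UNIV (\<lambda>_. borel)) (\<lambda>\<omega> (i, j). \<Omega> \<omega> $ i $ j) =
    PiM UNIV (\<lambda>_. density lborel std_normal_density)"
proof -
  have dist: "distributed M lborel (\<lambda>\<omega>. \<Omega> \<omega> $ i $ j) std_normal_density" for i j
    using assms by (simp add: gaussian_matrix_def)
  have rv: "random_variable borel (case p of (i, j) \<Rightarrow> \<lambda>\<omega>. \<Omega> \<omega> $ i $ j)" for p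
    using distributed_measurable[OF dist] by (cases p) simp
  have "indep_vars (\<lambda>_. borel) (\<lambda>(i, j) \<omega>. \<Omega> \<omega> $ i $ j) UNIV"
    using assms by (simp add: gaussian_matrix_def)
  then have "distr M (PiM UNIV (\<lambda>_. borel)) (\<lambda>\<omega>. \<lambda>p\<in>UNIV. (case p of (i, j) \<Rightarrow> \<lambda>\<omega>. \<Omega> \<omega> $ i $ j) \<omega>) =
      PiM UNIV (\<lambda>p. distr M borel (case p of (i, j) \<Rightarrow> \<lambda>\<omega>. \<Omega> \<omega> $ i $ j))"
    using indep_vars_iff_distr_eq_PiM[where I = UNIV and M' = "\<lambda>_. borel" and
        X = "\<lambda>(i, j) \<omega>. \<Omega> \<omega> $ i $ j", OF _ rv] by simp
  moreover have "distr M borel (\<lambda>\<omega>. \<Omega> \<omega> $ i $ j) = density lborel std_normal_density" for i j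
    using distributed_distr_eq_density[OF dist, of i j] by (metis distr_cong sets_lborel)
  ultimately show ?thesis
    by (simp add: case_prod_beta split_beta' restrict_UNIV cong: PiM_cong)
qed

lemma gaussian_matrix_measurable:
  fixes \<Omega> :: "'a \<Rightarrow> real^'m^'d"
  assumes "gaussian_matrix \<Omega>"
  shows "\<Omega> \<in> borel_measurable M"
proof -
  have "(\<lambda>\<omega>. \<Omega> \<omega> $ i $ j) \<in> borel_measurable M" for i j
    using assms distributed_measurable by (fastforce simp: gaussian_matrix_def)
  then show ?thesis
    unfolding borel_measurable_euclidean_space[of \<Omega>] by (auto simp: Basis_vec_def inner_axis)
qed

text \<open>All moments of the entries are finite, and a power of the norm is dominated, up to a constant, by 1
  plus the sum of the same powers of the entries.\<close>

lemma gaussian_matrix_integrable: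
  fixes \<Omega> :: "'a \<Rightarrow> real^'m^'d" and \<Phi> :: "real^'m^'d \<Rightarrow> real"
  assumes G: "gaussian_matrix \<Omega>" and [measurable]: "\<Phi> \<in> borel_measurable borel"
    and bound: "\<And>X. \<bar>\<Phi> X\<bar> \<le> C * (1 + norm X) ^ k"
  shows "integrable M (\<lambda>\<omega>. \<Phi> (\<Omega> \<omega>))"
proof -
  note [measurable] = gaussian_matrix_measurable[OF G]
  define n where "n = CARD('d \<times> 'm)"
  have pw: "(1 + norm X) ^ k \<le> (1 + real n) ^ k * (1 + (\<Sum>p\<in>UNIV. \<bar>X $ fst p $ snd p\<bar> ^ k))"
    for X :: "real^'m^'d"
  proof -
    let ?S = "range (\<lambda>p. \<bar>X $ fst p $ snd p\<bar>)"
    have "Max ?S \<in> ?S" by (rule Max_in) auto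
    then obtain q where "Max ?S = \<bar>X $ fst q $ snd q\<bar>" by blast
    then have q: "\<bar>X $ fst p $ snd p\<bar> \<le> \<bar>X $ fst q $ snd q\<bar>" for p
      using Max_ge[of ?S "\<bar>X $ fst p $ snd p\<bar>"] by simp
    let ?b = "max 1 \<bar>X $ fst q $ snd q\<bar>"
    have "norm X \<le> (\<Sum>p\<in>(UNIV :: ('d \<times> 'm) set). ?b)"
      using q by (intro order_trans[OF norm_matrix_le_sum_entries] sum_mono) (auto intro: le_max_iff_disj[THEN iffD2])
    then have "1 + norm X \<le> (1 + real n) * ?b" by (simp add: n_def algebra_simps)
    then have "(1 + norm X) ^ k \<le> ((1 + real n) * ?b) ^ k" by (intro power_mono) auto
    also have "\<dots> = (1 + real n) ^ k * max 1 (\<bar>X $ fst q $ snd q\<bar> ^ k)"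
      by (auto simp: power_mult_distrib max_def one_le_power power_le_one dest: antisym)
    also have "\<dots> \<le> (1 + real n) ^ k * (1 + (\<Sum>p\<in>UNIV. \<bar>X $ fst p $ snd p\<bar> ^ k))"
    proof -
      have "\<bar>X $ fst q $ snd q\<bar> ^ k \<le> (\<Sum>p\<in>UNIV. \<bar>X $ fst p $ snd p\<bar> ^ k)"
        by (rule member_le_sum) auto
      then show ?thesis by (intro mult_left_mono) (auto intro: sum_nonneg)
    qed
    finally show ?thesis .
  qed
  have moment: "integrable M (\<lambda>\<omega>. \<bar>\<Omega> \<omega> $ i $ j\<bar> ^ k)" for i j
  proof -
    have D: "distributed M lborel (\<lambda>\<omega>. \<Omega> \<omega> $ i $ j) std_normal_density"
      using G by (simp add: gaussian_matrix_def)
    show ?thesis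
      using distributed_integrable[OF D, of "\<lambda>x. \<bar>x\<bar> ^ k"] integrable_std_normal_moment_abs[of k] by simp
  qed
  show ?thesis
  proof (rule Bochner_Integration.integrable_bound)
    show "integrable M (\<lambda>\<omega>. \<bar>C\<bar> * ((1 + real n) ^ k * (1 + (\<Sum>p\<in>UNIV. \<bar>\<Omega> \<omega> $ fst p $ snd p\<bar> ^ k))))"
      using moment by (intro integrable_mult_right Bochner_Integration.integrable_add Bochner_Integration.integrable_sum) auto
    have "\<bar>\<Phi> X\<bar> \<le> \<bar>C\<bar> * ((1 + real n) ^ k * (1 + (\<Sum>p\<in>UNIV. \<bar>X $ fst p $ snd p\<bar> ^ k)))" for X
    proof -
      have "\<bar>\<Phi> X\<bar> \<le> \<bar>C\<bar> * (1 + norm X) ^ k"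
        using bound[of X] by (rule order_trans) (intro mult_right_mono, auto)
      also have "\<dots> \<le> \<bar>C\<bar> * ((1 + real n) ^ k * (1 + (\<Sum>p\<in>UNIV. \<bar>X $ fst p $ snd p\<bar> ^ k)))"
        by (intro mult_left_mono pw) auto
      finally show ?thesis .
    qed
    then show "AE \<omega> in M. norm (\<Phi> (\<Omega> \<omega>)) \<le>
        norm (\<bar>C\<bar> * ((1 + real n) ^ k * (1 + (\<Sum>p\<in>UNIV. \<bar>\<Omega> \<omega> $ fst p $ snd p\<bar> ^ k))))"
      unfolding real_norm_def by (intro AE_I2 order_trans[OF _ abs_ge_self])
  qed simp
qed

text \<open>Fubini isolates the entry at position \<open>(i, j)\<close>; with the others held fixed the claim is one-dimensional.\<close>

lemma gaussian_stein_entry: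
  fixes \<Omega> :: "'a \<Rightarrow> real^'m^'d" and \<Phi> :: "real^'m^'d \<Rightarrow> real"
  assumes G: "gaussian_matrix \<Omega>"
    and deriv: "\<And>X. (\<Phi> has_derivative \<Phi>' X) (at X)"
    and cont: "\<And>V. continuous_on UNIV (\<lambda>X. \<Phi>' X V)"
    and bound: "\<And>X. \<bar>\<Phi> X\<bar> \<le> C * (1 + norm X) ^ k" "\<And>X. \<bar>\<Phi>' X (unit_matrix i j)\<bar> \<le> C * (1 + norm X) ^ k"
  shows "(\<integral>\<omega>. \<Omega> \<omega> $ i $ j * \<Phi> (\<Omega> \<omega>) \<partial>M) = (\<integral>\<omega>. \<Phi>' (\<Omega> \<omega>) (unit_matrix i j) \<partial>M)"
proof -
  let ?E = "unit_matrix i j :: real^'m^'d"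
  let ?N = "\<lambda>_::'d \<times> 'm. density lborel std_normal_density"
  have prob: "prob_space (density lborel std_normal_density)"
    by (rule prob_space_normal_density) simp
  interpret product_sigma_finite ?N
    unfolding product_sigma_finite_def using prob by (simp add: prob_space_imp_sigma_finite)
  note [measurable] = gaussian_matrix_measurable[OF G]
  have cont\<Phi>: "continuous_on UNIV \<Phi>"
    using deriv by (meson continuous_at_imp_continuous_on has_derivative_continuous)
  have [measurable]: "\<Phi> \<in> borel_measurable borel" "(\<lambda>X. \<Phi>' X ?E) \<in> borel_measurable borel"
    using cont\<Phi> cont by (auto intro: borel_measurable_continuous_onI)
  have [measurable]: "(\<lambda>X::real^'m^'d. X $ i $ j) \<in> borel_measurable borel"
    by (intro borel_measurable_continuous_onI continuous_intros)
  have C: "0 \<le> C" using bound(1)[of 0] by simp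
  let ?L = "\<lambda>x. of_entries (x((i, j) := 0)) :: real^'m^'d"
  let ?\<phi> = std_normal_density
  let ?N' = "PiM (UNIV - {(i, j)}) ?N"
  have transfer: "(\<integral>\<omega>. F (\<Omega> \<omega>) \<partial>M) = (\<integral>x. (\<integral>y. ?\<phi> y *
        F (?L x + y *\<^sub>R ?E) \<partial>lborel) \<partial>?N')"
    if [measurable]: "F \<in> borel_measurable borel" and int: "integrable M (\<lambda>\<omega>. F (\<Omega> \<omega>))"
    for F :: "real^'m^'d \<Rightarrow> real"
  proof -
    let ?X = "\<lambda>\<omega> (i, j). \<Omega> \<omega> $ i $ j"
    have entry: "(\<lambda>\<omega>. \<Omega> \<omega> $ i $ j) \<in> borel_measurable M" for i j
      using G distributed_measurable by (fastforce simp: gaussian_matrix_def)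
    have X[measurable]: "?X \<in> measurable M (PiM UNIV (\<lambda>_. borel))"
      by (rule measurable_PiM_single') (auto simp: entry)
    have oe: "of_entries (?X \<omega>) = \<Omega> \<omega>" for \<omega> by (simp add: of_entries_def vec_eq_iff)
    have "(\<integral>\<omega>. F (\<Omega> \<omega>) \<partial>M) = (\<integral>x. F (of_entries x) \<partial>distr M (PiM UNIV (\<lambda>_. borel)) ?X)"
      by (subst integral_distr) (auto simp: oe)
    also have "\<dots> = (\<integral>x. F (of_entries x) \<partial>PiM (insert (i, j) (UNIV - {(i, j)})) ?N)"
      by (simp add: gaussian_matrix_distr[OF G] insert_absorb)
    also have "\<dots> = (\<integral>x. (\<integral>y. F (of_entries (x((i, j) := y))) \<partial>density lborel std_normal_density)
        \<partial>?N')"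
    proof (rule product_integral_insert)
      have "integrable (distr M (PiM UNIV (\<lambda>_. borel)) ?X) (\<lambda>x. F (of_entries x))"
        using int by (subst integrable_distr_eq) (auto simp: oe)
      then show "integrable (PiM (insert (i, j) (UNIV - {(i, j)})) ?N) (\<lambda>x. F (of_entries x))"
        by (simp add: gaussian_matrix_distr[OF G] insert_absorb)
    qed auto
    also have "\<dots> = (\<integral>x. (\<integral>y. ?\<phi> y *
        F (?L x + y *\<^sub>R ?E) \<partial>lborel) \<partial>?N')"
    proof (rule Bochner_Integration.integral_cong[OF refl])
      fix x :: "'d \<times> 'm \<Rightarrow> real"
      have [measurable]: "(\<lambda>y. ?L x + y *\<^sub>R ?E) \<in> borel_measurable borel"
        by (intro borel_measurable_continuous_onI continuous_intros)
      show "(\<integral>y. F (of_entries (x((i, j) := y))) \<partial>density lborel std_normal_density) =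
          (\<integral>y. ?\<phi> y * F (?L x + y *\<^sub>R ?E) \<partial>lborel)"
      proof -
        have "F (of_entries (x((i, j) := y))) = F (?L x + y *\<^sub>R ?E)" for y
          by (subst of_entries_upd) simp
        then show ?thesis by (simp only:) (subst integral_density; simp)
      qed
    qed
    finally show ?thesis .
  qed
  have "(\<integral>\<omega>. \<Omega> \<omega> $ i $ j * \<Phi> (\<Omega> \<omega>) \<partial>M) = (\<integral>x. (\<integral>y. ?\<phi> y *
      (y * \<Phi> (?L x + y *\<^sub>R ?E)) \<partial>lborel) \<partial>?N')"
  proof (subst transfer[of "\<lambda>X. X $ i $ j * \<Phi> X"])
    show "integrable M (\<lambda>\<omega>. \<Omega> \<omega> $ i $ j * \<Phi> (\<Omega> \<omega>))"
    proof (rule gaussian_matrix_integrable[OF G, of "\<lambda>X. X $ i $ j * \<Phi> X" C "Suc k"])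
      show "\<bar>X $ i $ j * \<Phi> X\<bar> \<le> C * (1 + norm X) ^ Suc k" for X
      proof -
        have "\<bar>X $ i $ j\<bar> \<le> norm X"
          by (rule order_trans[OF component_le_norm_cart Finite_Cartesian_Product.norm_nth_le])
        then have "\<bar>X $ i $ j\<bar> * \<bar>\<Phi> X\<bar> \<le> (1 + norm X) * (C * (1 + norm X) ^ k)"
          using bound(1)[of X] by (intro mult_mono) auto
        then show ?thesis by (simp add: abs_mult algebra_simps)
      qed
    qed simp
  qed (auto simp: of_entries_def)
  also have "\<dots> = (\<integral>x. (\<integral>y. ?\<phi> y *
      \<Phi>' (?L x + y *\<^sub>R ?E) ?E \<partial>lborel) \<partial>?N')"
  proof (rule Bochner_Integration.integral_cong[OF refl])
    fix x :: "'d \<times> 'm \<Rightarrow> real"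
    define A where "A = ?L x"
    show "(\<integral>y. ?\<phi> y * (y * \<Phi> (A + y *\<^sub>R ?E)) \<partial>lborel) =
        (\<integral>y. ?\<phi> y * \<Phi>' (A + y *\<^sub>R ?E) ?E \<partial>lborel)"
    proof (rule std_normal_integration_by_parts)
      have "((\<lambda>y. A + y *\<^sub>R ?E) has_vector_derivative ?E) (at y)" for y
        by (auto intro!: derivative_eq_intros)
      from vector_derivative_diff_chain_within[OF this has_derivative_at_withinI[OF deriv]]
      show "((\<lambda>y. \<Phi> (A + y *\<^sub>R ?E)) has_real_derivative \<Phi>' (A + y *\<^sub>R ?E) ?E) (at y)" for y
        unfolding has_real_derivative_iff_has_vector_derivative by (simp add: o_def)
      show "continuous_on UNIV (\<lambda>y. \<Phi>' (A + y *\<^sub>R ?E) ?E)"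
        by (rule continuous_on_compose2[OF cont]) (auto intro!: continuous_intros)
      have "C * (1 + norm (A + y *\<^sub>R ?E)) ^ k \<le> C * (1 + norm A) ^ k * (1 + \<bar>y\<bar>) ^ k" for y
      proof -
        have "1 + norm (A + y *\<^sub>R ?E) \<le> 1 + norm A + \<bar>y\<bar>"
          using norm_triangle_ineq[of A "y *\<^sub>R ?E"] by simp
        also have "\<dots> \<le> (1 + norm A) * (1 + \<bar>y\<bar>)" by (simp add: algebra_simps)
        finally have "(1 + norm (A + y *\<^sub>R ?E)) ^ k \<le> ((1 + norm A) * (1 + \<bar>y\<bar>)) ^ k"
          by (intro power_mono) auto
        then show ?thesis using C by (simp add: power_mult_distrib mult.assoc mult_left_mono)
      qed
      then show "\<bar>\<Phi> (A + y *\<^sub>R ?E)\<bar> \<le> C * (1 + norm A) ^ k * (1 + \<bar>y\<bar>) ^ k"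
        "\<bar>\<Phi>' (A + y *\<^sub>R ?E) ?E\<bar> \<le> C * (1 + norm A) ^ k * (1 + \<bar>y\<bar>) ^ k" for y
        using bound order_trans by blast+
    qed
  qed
  also have "\<dots> = (\<integral>\<omega>. \<Phi>' (\<Omega> \<omega>) ?E \<partial>M)"
    by (rule transfer[of "\<lambda>X. \<Phi>' X ?E", symmetric])
      (auto intro: gaussian_matrix_integrable[OF G _ bound(2)])
  finally show ?thesis .
qed

end

section \<open>Matrix calculus and polynomial growth\<close>

lemma bounded_bilinear_matrix_mult:
  "bounded_bilinear ((**) :: real^'n^'m \<Rightarrow> real^'k^'n \<Rightarrow> real^'k^'m)"
proof -
  have "bilinear ((**) :: real^'n^'m \<Rightarrow> real^'k^'n \<Rightarrow> real^'k^'m)"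
    unfolding bilinear_def
    by (auto intro!: linearI sum.cong simp: matrix_matrix_mult_def vec_eq_iff sum.distrib sum_distrib_left
        algebra_simps)
  then show ?thesis by (simp add: bilinear_conv_bounded_bilinear)
qed

lemma bounded_linear_transpose: "bounded_linear (transpose :: real^'n^'m \<Rightarrow> real^'m^'n)"
  unfolding linear_conv_bounded_linear[symmetric]
  by (auto intro!: linearI simp: transpose_def vec_eq_iff)

interpretation mm: bounded_bilinear "(**) :: real^'n^'m \<Rightarrow> real^'k^'n \<Rightarrow> real^'k^'m"
  by (rule bounded_bilinear_matrix_mult)

lemma inner_matrix_mult_left:
  fixes A :: "real^'n^'m" and X :: "real^'k^'n"
  shows "(A ** X) \<bullet> Y = X \<bullet> (transpose A ** Y)"
proof -
  have "(A ** X) \<bullet> Y = (\<Sum>i\<in>UNIV. \<Sum>j\<in>UNIV. \<Sum>l\<in>UNIV. A $ i $ l * X $ l $ j * Y $ i $ j)"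
    by (simp add: inner_vec_def matrix_matrix_mult_def sum_distrib_right)
  also have "\<dots> = (\<Sum>i\<in>UNIV. \<Sum>l\<in>UNIV. \<Sum>j\<in>UNIV. A $ i $ l * X $ l $ j * Y $ i $ j)"
    by (intro sum.cong refl sum.swap)
  also have "\<dots> = (\<Sum>l\<in>UNIV. \<Sum>i\<in>UNIV. \<Sum>j\<in>UNIV. A $ i $ l * X $ l $ j * Y $ i $ j)"
    by (rule sum.swap)
  also have "\<dots> = (\<Sum>l\<in>UNIV. \<Sum>j\<in>UNIV. \<Sum>i\<in>UNIV. A $ i $ l * X $ l $ j * Y $ i $ j)"
    by (intro sum.cong refl sum.swap)
  also have "\<dots> = X \<bullet> (transpose A ** Y)"
    by (simp add: inner_vec_def matrix_matrix_mult_def transpose_def sum_distrib_left ac_simps)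
  finally show ?thesis .
qed

lemma inner_transpose: "transpose X \<bullet> transpose Y = (X :: real^'n^'m) \<bullet> Y"
  by (simp add: inner_vec_def transpose_def) (rule sum.swap)

lemma inner_matrix_mult_right:
  fixes X :: "real^'n^'m" and B :: "real^'k^'n"
  shows "(X ** B) \<bullet> Y = X \<bullet> (Y ** transpose B)"
proof -
  have "(X ** B) \<bullet> Y = (transpose B ** transpose X) \<bullet> transpose Y"
    by (simp add: inner_transpose flip: matrix_transpose_mul)
  also have "\<dots> = X \<bullet> (Y ** transpose B)"
    by (metis inner_matrix_mult_left inner_transpose matrix_transpose_mul transpose_transpose)
  finally show ?thesis .
qed

lemma trace_eq_inner: "trace (A :: real^'n^'n) = mat 1 \<bullet> A"
  by (simp add: trace_def inner_vec_def mat_def if_distrib if_distribR cong: if_cong)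

lemma trace_transpose_mult: "trace (transpose X ** Y) = (X :: real^'n^'m) \<bullet> Y"
  using inner_matrix_mult_left[of X "mat 1" Y] by (simp add: trace_eq_inner)

lemma conj_unit_matrix_nth:
  fixes A :: "real^'d^'k" and B :: "real^'l^'m"
  shows "(A ** unit_matrix i j ** B) $ a $ c = A $ a $ i * B $ j $ c"
proof -
  have *: "(A ** unit_matrix i j) $ a $ b = (if b = j then A $ a $ i else 0)" for b :: 'm
  proof -
    have "(A ** unit_matrix i j) $ a $ b = (\<Sum>k\<in>UNIV. if k = i then (if b = j then A $ a $ i else 0) else 0)"
      unfolding matrix_matrix_mult_def vec_lambda_beta by (intro sum.cong refl) (auto simp: axis_def)
    then show ?thesis by simp
  qed
  have "(A ** unit_matrix i j ** B) $ a $ c = (\<Sum>b\<in>UNIV. (A ** unit_matrix i j) $ a $ b * B $ b $ c)"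
    by (simp add: matrix_matrix_mult_def)
  also have "\<dots> = (\<Sum>b\<in>UNIV. if b = j then A $ a $ i * B $ j $ c else 0)"
    by (intro sum.cong refl) (simp add: *)
  finally show ?thesis by simp
qed

lemma transpose_unit_matrix: "transpose (unit_matrix i j) = unit_matrix j i"
  by (auto simp: transpose_def axis_def vec_eq_iff)

lemma sum_pairs: "(\<Sum>p\<in>UNIV. f (fst p) (snd p)) = (\<Sum>i\<in>UNIV. \<Sum>j\<in>UNIV. f i j)"
  for f :: "'a::finite \<Rightarrow> 'b::finite \<Rightarrow> real"
  by (simp add: sum.cartesian_product case_prod_beta flip: UNIV_Times_UNIV)

lemma sum_entry_conj_unit_matrix:
  fixes A :: "real^'d^'d" and B :: "real^'m^'m"
  shows "(\<Sum>p\<in>UNIV. (A ** unit_matrix (fst p) (snd p) ** B) $ fst p $ snd p) = trace A * trace B"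
  by (simp add: conj_unit_matrix_nth sum_pairs[of "\<lambda>i j. A $ i $ i * B $ j $ j"] trace_def sum_product)

lemma sum_entry_conj_unit_matrix_transpose:
  fixes A B :: "real^'m^'d"
  shows "(\<Sum>p\<in>UNIV. (A ** transpose (unit_matrix (fst p) (snd p)) ** B) $ fst p $ snd p) = A \<bullet> B"
  by (simp add: transpose_unit_matrix conj_unit_matrix_nth sum_pairs[of "\<lambda>i j. A $ i $ j * B $ i $ j"]
      inner_vec_def)

text \<open>The class of functions for which Gaussian integration by parts is justified. It contains every
  function met below because regularisation keeps the inverse Gram matrices bounded.\<close>

definition poly_growth :: "('a::real_normed_vector \<Rightarrow> 'b::real_normed_vector) \<Rightarrow> bool" where
  "poly_growth f \<longleftrightarrow> (\<exists>C k. \<forall>x. norm (f x) \<le> C * (1 + norm x) ^ k)"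

lemma poly_growthI: "(\<And>x. norm (f x) \<le> C * (1 + norm x) ^ k) \<Longrightarrow> poly_growth f"
  unfolding poly_growth_def by blast

lemma poly_growthE:
  fixes f :: "'a::real_normed_vector \<Rightarrow> 'b::real_normed_vector"
  assumes "poly_growth f"
  obtains C k where "0 \<le> C" "\<And>x l. k \<le> l \<Longrightarrow> norm (f x) \<le> C * (1 + norm x) ^ l"
proof -
  obtain C k where *: "\<And>x. norm (f x) \<le> C * (1 + norm x) ^ k"
    using assms by (auto simp: poly_growth_def)
  have C: "0 \<le> C" using order_trans[OF norm_ge_zero *[of 0]] by simp
  show ?thesis
  proof (rule that[OF C])
    fix x :: 'a and l assume "k \<le> l"
    then have "C * (1 + norm x) ^ k \<le> C * (1 + norm x) ^ l"
      using C by (intro mult_left_mono power_increasing) auto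
    with *[of x] show "norm (f x) \<le> C * (1 + norm x) ^ l" by linarith
  qed
qed

lemma poly_growth_bounded: "(\<And>x. norm (f x) \<le> C) \<Longrightarrow> poly_growth f"
  by (rule poly_growthI[of _ C 0]) simp

lemma poly_growth_const: "poly_growth (\<lambda>_. c)"
  by (rule poly_growth_bounded[of _ "norm c"]) simp

lemma poly_growth_ident: "poly_growth (\<lambda>x. x)"
  by (rule poly_growthI[of _ 1 1]) simp

lemma poly_growth_linear:
  assumes "bounded_linear L" "poly_growth f"
  shows "poly_growth (\<lambda>x. L (f x))"
proof -
  obtain K where K: "0 \<le> K" "\<And>y. norm (L y) \<le> norm y * K"
    using bounded_linear.nonneg_bounded[OF assms(1)] by auto
  obtain C k where Ck: "0 \<le> C" "\<And>x l. k \<le> l \<Longrightarrow> norm (f x) \<le> C * (1 + norm x) ^ l"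
    by (rule poly_growthE[OF assms(2)]) blast
  show ?thesis
  proof (rule poly_growthI)
    show "norm (L (f x)) \<le> (K * C) * (1 + norm x) ^ k" for x
      using K(2)[of "f x"] mult_right_mono[OF Ck(2)[OF order_refl, of x] K(1)] by (simp add: ac_simps)
  qed
qed

lemma poly_growth_add:
  assumes "poly_growth f" "poly_growth g"
  shows "poly_growth (\<lambda>x. f x + g x)"
proof -
  obtain C k where Ck: "0 \<le> C" "\<And>x l. k \<le> l \<Longrightarrow> norm (f x) \<le> C * (1 + norm x) ^ l"
    by (rule poly_growthE[OF assms(1)]) blast
  obtain D j where Dj: "0 \<le> D" "\<And>x l. j \<le> l \<Longrightarrow> norm (g x) \<le> D * (1 + norm x) ^ l"
    by (rule poly_growthE[OF assms(2)]) blast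
  show ?thesis
  proof (rule poly_growthI)
    show "norm (f x + g x) \<le> (C + D) * (1 + norm x) ^ max k j" for x
      using Ck(2)[of "max k j" x] Dj(2)[of "max k j" x] norm_triangle_ineq[of "f x" "g x"]
      by (simp add: algebra_simps)
  qed
qed

lemma poly_growth_bilinear:
  assumes "bounded_bilinear L" "poly_growth f" "poly_growth g"
  shows "poly_growth (\<lambda>x. L (f x) (g x))"
proof -
  obtain K where K: "0 \<le> K" "\<And>y z. norm (L y z) \<le> norm y * norm z * K"
    using bounded_bilinear.nonneg_bounded[OF assms(1)] by auto
  obtain C k where Ck: "0 \<le> C" "\<And>x l. k \<le> l \<Longrightarrow> norm (f x) \<le> C * (1 + norm x) ^ l"
    by (rule poly_growthE[OF assms(2)]) blast
  obtain D j where Dj: "0 \<le> D" "\<And>x l. j \<le> l \<Longrightarrow> norm (g x) \<le> D * (1 + norm x) ^ l"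
    by (rule poly_growthE[OF assms(3)]) blast
  show ?thesis
  proof (rule poly_growthI)
    fix x
    have "norm (f x) * norm (g x) * K \<le> (C * (1 + norm x) ^ k) * (D * (1 + norm x) ^ j) * K"
      using Ck Dj K by (intro mult_mono) auto
    then show "norm (L (f x) (g x)) \<le> (C * D * K) * (1 + norm x) ^ (k + j)"
      using K(2)[of "f x" "g x"] by (simp add: power_add ac_simps)
  qed
qed

lemmas poly_growth_intros =
  poly_growth_const poly_growth_ident poly_growth_add
  poly_growth_bilinear[OF bounded_bilinear_matrix_mult]
  poly_growth_linear[OF bounded_linear_transpose]

lemma poly_growth_minus: "poly_growth f \<Longrightarrow> poly_growth (\<lambda>x. - f x)"
  by (simp add: poly_growth_def)

lemma poly_growth_diff: "poly_growth f \<Longrightarrow> poly_growth g \<Longrightarrow> poly_growth (\<lambda>x. f x - g x)"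
  using poly_growth_add[OF _ poly_growth_minus] by fastforce

lemma poly_growth_entry: "poly_growth f \<Longrightarrow> poly_growth (\<lambda>x. f x $ i $ j)"
  for f :: "'a::real_normed_vector \<Rightarrow> real^'m^'d"
  by (rule poly_growth_linear[of "\<lambda>X. X $ i $ j"])
    (auto intro!: bounded_linear_compose[OF bounded_linear_vec_nth bounded_linear_vec_nth])

lemma matrix_inv_difference:
  fixes S T :: "real^'d^'d"
  assumes "invertible S" "invertible T"
  shows "matrix_inv T - matrix_inv S = - (matrix_inv T ** (T - S) ** matrix_inv S)"
proof -
  have "matrix_inv T ** (T - S) ** matrix_inv S
      = (matrix_inv T ** T) ** matrix_inv S - matrix_inv T ** (S ** matrix_inv S)"
    by (simp add: mm.diff_left mm.diff_right matrix_mul_assoc)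
  then show ?thesis by (simp add: matrix_inv_mult assms)
qed

text \<open>The uniform bound on the inverses makes the remainder in the second-order resolvent expansion
  quadratic in the increment of \<open>S\<close>, hence negligible.\<close>

lemma has_derivative_matrix_inv:
  fixes S :: "'a::real_normed_vector \<Rightarrow> real^'d^'d"
  assumes S: "(S has_derivative S') (at x)" and inv: "\<And>y. invertible (S y)"
    and bound: "\<And>y. norm (matrix_inv (S y)) \<le> C"
  shows "((\<lambda>y. matrix_inv (S y)) has_derivative (\<lambda>h. - (matrix_inv (S x) ** S' h ** matrix_inv (S x)))) (at x)"
proof -
  define R where "R y = matrix_inv (S y)" for y
  define \<Delta> where "\<Delta> y = S y - S x" for y
  define rem where "rem y = R y ** \<Delta> y ** R x ** \<Delta> y ** R x" for y
  have diff: "R y - R x = - (R y ** \<Delta> y ** R x)" for y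
    unfolding R_def \<Delta>_def by (rule matrix_inv_difference[OF inv inv])
  \<comment> \<open>Expanding the resolvent identity once more leaves a remainder quadratic in \<open>\<Delta>\<close>.\<close>
  have expand: "R y = R x - R x ** \<Delta> y ** R x + rem y" for y
  proof -
    have once: "R x - R y ** \<Delta> y ** R x = R y"
      using diff[of y] by (simp add: algebra_simps)
    have "R y = R x - (R x - R y ** \<Delta> y ** R x) ** \<Delta> y ** R x"
      by (simp only: once)
    then show ?thesis by (simp add: rem_def mm.diff_left algebra_simps)
  qed
  have d\<Delta>: "(\<Delta> has_derivative S') (at x)"
    unfolding \<Delta>_def using has_derivative_diff[OF S has_derivative_const[of "S x"]] by simp
  obtain K where K: "0 \<le> K" "\<And>(A::real^'d^'d) (B::real^'d^'d). norm (A ** B) \<le> norm A * norm B * K"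
    using mm.nonneg_bounded by blast
  have C: "0 \<le> C" using order_trans[OF norm_ge_zero bound[of x]] .
  have "norm (rem y) \<le> C * C * C * K ^ 4 * (\<Delta> y \<bullet> \<Delta> y)" for y
  proof -
    have step: "norm (A ** B) \<le> a * b * K" if "norm A \<le> a" "norm B \<le> b" for A B :: "real^'d^'d" and a b
    proof -
      have "0 \<le> a" "0 \<le> b" using that by (auto intro: order_trans[OF norm_ge_zero])
      then show ?thesis using that K(1) by (intro order_trans[OF K(2)] mult_mono) auto
    qed
    have "norm (rem y) \<le> (((C * norm (\<Delta> y) * K) * C * K) * norm (\<Delta> y) * K) * C * K"
      unfolding rem_def using bound by (intro step) (auto simp: R_def)
    also have "\<dots> = C * C * C * K ^ 4 * (norm (\<Delta> y))\<^sup>2"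
      by (simp add: power2_eq_square power4_eq_xxxx)
    finally show ?thesis by (simp add: power2_norm_eq_inner)
  qed
  note rem_bound = this
  have "((\<lambda>y. \<Delta> y \<bullet> \<Delta> y) has_derivative (\<lambda>h. 0)) (at x)"
    using has_derivative_inner[OF d\<Delta> d\<Delta>] by (simp add: \<Delta>_def)
  then have "((\<lambda>y. norm (\<Delta> y \<bullet> \<Delta> y) / norm (y - x)) \<longlongrightarrow> 0) (at x)"
    unfolding has_derivative_iff_norm by (simp add: \<Delta>_def)
  then have lim: "((\<lambda>y. C * C * C * K ^ 4 * (norm (\<Delta> y \<bullet> \<Delta> y) / norm (y - x))) \<longlongrightarrow> 0) (at x)"
    by (rule tendsto_mult_right_zero)
  have "(rem has_derivative (\<lambda>h. 0)) (at x)"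
    unfolding has_derivative_iff_norm
  proof
    have "((\<lambda>y. norm (rem y) / norm (y - x)) \<longlongrightarrow> 0) (at x)"
    proof (rule Lim_null_comparison[OF _ lim], rule always_eventually, rule allI)
      fix y
      show "norm (norm (rem y) / norm (y - x)) \<le> C * C * C * K ^ 4 * (norm (\<Delta> y \<bullet> \<Delta> y) / norm (y - x))"
        using rem_bound[of y] by (simp add: divide_right_mono)
    qed
    then show "((\<lambda>y. norm (rem y - rem x - 0) / norm (y - x)) \<longlongrightarrow> 0) (at x)"
      by (simp add: rem_def \<Delta>_def)
  qed simp
  moreover have "((\<lambda>y. R x ** \<Delta> y ** R x) has_derivative (\<lambda>h. R x ** S' h ** R x)) (at x)"
    using bounded_linear.has_derivative[OF mm.bounded_linear_left, OF
        bounded_linear.has_derivative[OF mm.bounded_linear_right d\<Delta>]] .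
  ultimately have "((\<lambda>y. R x - R x ** \<Delta> y ** R x + rem y) has_derivative
      (\<lambda>h. 0 - R x ** S' h ** R x + 0)) (at x)"
    by (intro has_derivative_add has_derivative_diff has_derivative_const)
  then have "(R has_derivative (\<lambda>h. - (R x ** S' h ** R x))) (at x)"
    unfolding expand[symmetric] by simp
  then show ?thesis unfolding R_def .
qed

section \<open>Regularised inverse Gram matrices\<close>

lemma mat_eq_scaleR: "mat c = c *\<^sub>R (mat 1 :: real^'n^'n)"
  by (simp add: mat_def vec_eq_iff)

lemma trace_scaleR: "trace (c *\<^sub>R A) = c * trace (A :: real^'n^'n)"
  by (simp add: trace_def sum_distrib_left)

lemma reg_gram_quadratic_form:
  fixes Y :: "real^'m^'d"
  shows "x \<bullet> ((Y ** transpose Y + mat \<epsilon>) *v x) = (norm (transpose Y *v x))\<^sup>2 + \<epsilon> * (norm x)\<^sup>2"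
  by (simp add: matrix_vector_mult_add_rdistrib inner_add_right mat_mult_vector power2_norm_eq_inner
      dot_matrix_vector_transpose[of x] flip: matrix_vector_mul_assoc)

lemma reg_gram_pos_def:
  fixes Y :: "real^'m^'d"
  assumes "0 < \<epsilon>"
  shows "symmetric_pos_def (Y ** transpose Y + mat \<epsilon>)"
  unfolding symmetric_pos_def_def reg_gram_quadratic_form
proof (intro conjI allI impI)
  show "transpose (Y ** transpose Y + mat \<epsilon>) = Y ** transpose Y + mat \<epsilon>"
    unfolding linear_simps(1)[OF bounded_linear_transpose] by (simp add: matrix_transpose_mul)
  show "0 < (norm (transpose Y *v x))\<^sup>2 + \<epsilon> * (norm x)\<^sup>2" if "x \<noteq> 0" for x
    using assms that by (intro add_nonneg_pos) auto
qed

lemma norm_reg_inv_le: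
  fixes Y :: "real^'m^'d"
  assumes "0 < \<epsilon>"
  shows "norm (matrix_inv (Y ** transpose Y + mat \<epsilon>)) \<le> real CARD('d \<times> 'd) / \<epsilon>"
proof -
  define S where "S = Y ** transpose Y + mat \<epsilon>"
  have inv: "invertible S"
    unfolding S_def by (intro symmetric_pos_def_invertible reg_gram_pos_def assms)
  have vec: "norm (matrix_inv S *v v) \<le> norm v / \<epsilon>" for v
  proof (cases "matrix_inv S *v v = 0")
    case False
    let ?w = "matrix_inv S *v v"
    have "\<epsilon> * (norm ?w)\<^sup>2 \<le> ?w \<bullet> (S *v ?w)"
      unfolding S_def reg_gram_quadratic_form by simp
    also have "\<dots> \<le> norm ?w * norm v"
      using norm_cauchy_schwarz[of ?w v] by (simp add: matrix_inv_mult_vector inv)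
    finally have "norm ?w * (\<epsilon> * norm ?w) \<le> norm ?w * norm v"
      by (simp add: power2_eq_square ac_simps)
    then have "\<epsilon> * norm ?w \<le> norm v" using False by simp
    then show ?thesis using assms by (simp add: field_simps)
  qed (use assms in simp)
  have "\<bar>matrix_inv S $ i $ j\<bar> \<le> 1 / \<epsilon>" for i j
  proof -
    have "\<bar>(matrix_inv S *v axis j 1) $ i\<bar> \<le> 1 / \<epsilon>"
      using order_trans[OF component_le_norm_cart vec[of "axis j 1"]] by simp
    then show ?thesis by (simp add: matrix_vector_mul_component inner_axis)
  qed
  then have "(\<Sum>p\<in>UNIV. \<bar>matrix_inv S $ fst p $ snd p\<bar>) \<le> (\<Sum>p\<in>(UNIV :: ('d \<times> 'd) set). 1 / \<epsilon>)"
    by (intro sum_mono) auto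
  then show ?thesis using norm_matrix_le_sum_entries[of "matrix_inv S"] by (simp add: S_def)
qed

lemma continuous_on_matrix_mult [continuous_intros]:
  fixes f :: "'a::topological_space \<Rightarrow> real^'n^'m" and g :: "'a \<Rightarrow> real^'k^'n"
  shows "continuous_on S f \<Longrightarrow> continuous_on S g \<Longrightarrow> continuous_on S (\<lambda>x. f x ** g x)"
  by (rule mm.continuous_on)

lemma continuous_on_transpose [continuous_intros]:
  fixes f :: "'a::topological_space \<Rightarrow> real^'n^'m"
  shows "continuous_on S f \<Longrightarrow> continuous_on S (\<lambda>x. transpose (f x))"
  by (rule bounded_linear.continuous_on[OF bounded_linear_transpose])

text \<open>In the application \<open>P\<close> projects onto the leading eigenvectors and \<open>Q\<close> selects a block of columns.
  Working with the compression \<open>P X Q\<close> rather than with a smaller matrix keeps the types independent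
  of the rank and of the block. On the range of \<open>P\<close>, the matrix \<open>F X\<close> is a regularised transpose of
  the pseudoinverse of \<open>G X\<close>, and \<open>a X\<close> is the trace there of the inverse regularised Gram matrix.\<close>

locale masked_gram =
  fixes P :: "real^'d^'d" and Q :: "real^'m^'m" and \<epsilon> :: real
  assumes P: "transpose P = P" "P ** P = P" and Q: "transpose Q = Q" "Q ** Q = Q" and \<epsilon>: "0 < \<epsilon>"
begin

definition G :: "real^'m^'d \<Rightarrow> real^'m^'d" where "G X = P ** X ** Q"
definition S :: "real^'m^'d \<Rightarrow> real^'d^'d" where "S X = G X ** transpose (G X) + mat \<epsilon>"
definition R :: "real^'m^'d \<Rightarrow> real^'d^'d" where "R X = matrix_inv (S X)"
definition F :: "real^'m^'d \<Rightarrow> real^'m^'d" where "F X = R X ** G X"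
definition a :: "real^'m^'d \<Rightarrow> real" where "a X = trace (P ** R X)"

text \<open>The derivative of \<open>F\<close> in direction \<open>H\<close>.\<close>

definition F' :: "real^'m^'d \<Rightarrow> real^'m^'d \<Rightarrow> real^'m^'d" where
  "F' X H = R X ** (P ** H ** Q) - R X ** ((P ** H ** Q) ** transpose (G X) + G X ** transpose (P ** H ** Q)) ** R X ** G X"

lemma S_invertible: "invertible (S X)"
  unfolding S_def by (intro symmetric_pos_def_invertible reg_gram_pos_def \<epsilon>)

lemma RS: "R X ** S X = mat 1" and SR: "S X ** R X = mat 1"
  unfolding R_def by (simp_all add: matrix_inv_mult S_invertible)

lemma S_sym: "transpose (S X) = S X"
  using reg_gram_pos_def[OF \<epsilon>, of "G X"] by (simp add: S_def symmetric_pos_def_def)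

lemma R_sym: "transpose (R X) = R X"
proof -
  have "transpose (R X) ** S X = mat 1"
    using arg_cong[OF SR[of X], of transpose] by (simp add: matrix_transpose_mul S_sym)
  then have "transpose (R X) ** (S X ** R X) = R X" by (simp add: matrix_mul_assoc)
  then show ?thesis by (simp add: SR)
qed

lemma PG: "P ** G X = G X" and GQ: "G X ** Q = G X"
  unfolding G_def by (metis P(2) matrix_mul_assoc, metis Q(2) matrix_mul_assoc)

lemma GtP: "transpose (G X) ** P = transpose (G X)" and QGt: "Q ** transpose (G X) = transpose (G X)"
  using arg_cong[OF PG[of X], of transpose] arg_cong[OF GQ[of X], of transpose]
  by (simp_all add: matrix_transpose_mul P Q)

lemma PR: "P ** R X = R X ** P"
proof -
  have "S X ** P = G X ** (transpose (G X) ** P) + \<epsilon> *\<^sub>R P"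
    by (simp add: S_def mm.add_left mat_eq_scaleR[of \<epsilon>] mm.scaleR_left matrix_mul_assoc)
  also have "\<dots> = (P ** G X) ** transpose (G X) + \<epsilon> *\<^sub>R P" by (simp add: GtP PG)
  also have "\<dots> = P ** S X"
    by (simp add: S_def mm.add_right mat_eq_scaleR[of \<epsilon>] mm.scaleR_right matrix_mul_assoc)
  finally have *: "S X ** P = P ** S X" .
  have "P ** R X = R X ** (S X ** P) ** R X" by (simp add: matrix_mul_assoc RS)
  also have "\<dots> = R X ** P" unfolding * by (simp add: SR flip: matrix_mul_assoc)
  finally show ?thesis .
qed

lemma PF: "P ** F X = F X" and FQ: "F X ** Q = F X"
  unfolding F_def using PR PG GQ by (metis matrix_mul_assoc)+

lemma RP_G: "R X ** P ** G X = F X"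
  by (simp add: F_def PG flip: matrix_mul_assoc)

lemma FGt: "F X ** transpose (G X) = P - \<epsilon> *\<^sub>R (P ** R X)"
proof -
  have "G X ** transpose (G X) = S X - \<epsilon> *\<^sub>R mat 1" by (simp add: S_def mat_eq_scaleR[of \<epsilon>])
  then have "P ** (R X ** (G X ** transpose (G X))) = P ** (R X ** S X - \<epsilon> *\<^sub>R R X)"
    by (simp add: mm.diff_right mm.scaleR_right)
  moreover have "P ** (R X ** (G X ** transpose (G X))) = F X ** transpose (G X)"
    by (metis F_def PF matrix_mul_assoc)
  ultimately show ?thesis by (simp add: RS mm.diff_right mm.scaleR_right)
qed

lemma inner_G_F: "G X \<bullet> F X = trace P - \<epsilon> * a X"
proof -
  have "G X \<bullet> F X = trace (F X ** transpose (G X))"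
    by (metis trace_mul_sym trace_transpose_mult)
  then show ?thesis by (simp add: FGt trace_sub trace_scaleR a_def)
qed

text \<open>This and \<open>divergence_F\<close> are the two sides of Stein's identity for the vector field \<open>F\<close>.\<close>

lemma inner_F: "X \<bullet> F X = trace P - \<epsilon> * a X"
proof -
  have "G X \<bullet> F X = X \<bullet> (P ** (F X ** Q))"
    by (simp only: G_def inner_matrix_mult_right[of "P ** X"] inner_matrix_mult_left[of P X] P Q)
  then show ?thesis by (simp add: PF FQ inner_G_F)
qed

text \<open>Regularisation costs only the last term, which has a sign. The identity also bounds
  \<open>\<epsilon> (P R \<bullet> P R)\<close> by \<open>a\<close>, the smallness needed in \<open>tail_form_bound\<close>.\<close>

lemma norm_F: "F X \<bullet> F X = a X - \<epsilon> * ((P ** R X) \<bullet> (P ** R X))"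
proof -
  have "transpose (F X) = transpose (G X) ** R X"
    by (simp add: F_def matrix_transpose_mul R_sym)
  then have "F X \<bullet> F X = trace (transpose (G X) ** (R X ** F X))"
    unfolding trace_transpose_mult[of "F X", symmetric] by (simp add: matrix_mul_assoc)
  also have "\<dots> = trace (R X ** (F X ** transpose (G X)))"
    unfolding trace_mul_sym[of "transpose (G X)"] by (simp add: matrix_mul_assoc)
  also have "\<dots> = trace (R X ** P) - \<epsilon> * trace (R X ** P ** R X)"
    by (simp add: FGt mm.diff_right mm.scaleR_right trace_sub trace_scaleR matrix_mul_assoc)
  also have "trace (R X ** P) = a X" by (simp add: a_def PR)
  also have "R X ** P ** R X = transpose (P ** R X) ** (P ** R X)"
    by (simp add: matrix_transpose_mul P R_sym matrix_mul_assoc) (simp add: P flip: matrix_mul_assoc)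
  finally show ?thesis by (simp add: trace_transpose_mult)
qed

lemma a_nonneg: "0 \<le> a X"
  using norm_F[of X] \<epsilon> inner_ge_zero[of "F X"] inner_ge_zero[of "P ** R X"]
  by (smt (verit) mult_nonneg_nonneg)

lemma norm_F_le: "F X \<bullet> F X \<le> a X"
  using norm_F[of X] \<epsilon> by simp

lemma G_has_derivative: "(G has_derivative (\<lambda>H. P ** H ** Q)) (at X)"
  unfolding G_def
  by (intro bounded_linear_imp_has_derivative bounded_linear_compose[OF mm.bounded_linear_left mm.bounded_linear_right])

lemma norm_R_le: "norm (R X) \<le> real CARD('d \<times> 'd) / \<epsilon>"
  unfolding R_def S_def by (rule norm_reg_inv_le[OF \<epsilon>])

lemma R_has_derivative:
  "(R has_derivative (\<lambda>H. - (R X ** (G X ** transpose (P ** H ** Q) + (P ** H ** Q) ** transpose (G X)) ** R X))) (at X)"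
proof -
  have "((\<lambda>X. transpose (G X)) has_derivative (\<lambda>H. transpose (P ** H ** Q))) (at X)"
    by (rule bounded_linear.has_derivative[OF bounded_linear_transpose G_has_derivative])
  from has_derivative_add[OF mm.FDERIV[OF G_has_derivative this] has_derivative_const]
  have "(S has_derivative (\<lambda>H. G X ** transpose (P ** H ** Q) + (P ** H ** Q) ** transpose (G X))) (at X)"
    unfolding S_def[abs_def] by simp
  moreover have "norm (matrix_inv (S Y)) \<le> real CARD('d \<times> 'd) / \<epsilon>" for Y
    using norm_R_le by (simp add: R_def)
  ultimately have "((\<lambda>Y. matrix_inv (S Y)) has_derivative (\<lambda>H. - (matrix_inv (S X) **
      (G X ** transpose (P ** H ** Q) + (P ** H ** Q) ** transpose (G X)) ** matrix_inv (S X)))) (at X)"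
    by (rule has_derivative_matrix_inv[OF _ S_invertible])
  then show ?thesis by (simp only: R_def[abs_def])
qed

lemma F_has_derivative: "(F has_derivative F' X) (at X)"
  using mm.FDERIV[OF R_has_derivative G_has_derivative]
  by (simp add: F_def[abs_def] F'_def[abs_def] mm.minus_left add.commute algebra_simps)

lemma continuous_G [continuous_intros]: "continuous_on UNIV G"
  by (meson G_has_derivative continuous_at_imp_continuous_on has_derivative_continuous)

lemma continuous_R [continuous_intros]: "continuous_on UNIV R"
  by (meson R_has_derivative continuous_at_imp_continuous_on has_derivative_continuous)

lemma continuous_F [continuous_intros]: "continuous_on UNIV F"
  by (meson F_has_derivative continuous_at_imp_continuous_on has_derivative_continuous)

lemma continuous_F': "continuous_on UNIV (\<lambda>X. F' X H)"
  unfolding F'_def by (intro continuous_intros)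

lemma continuous_a: "continuous_on UNIV a"
  unfolding a_def[abs_def] trace_eq_inner by (intro continuous_intros)

lemma poly_growth_R: "poly_growth R"
  by (rule poly_growth_bounded[of _ "real CARD('d \<times> 'd) / \<epsilon>"])
    (rule norm_R_le)

lemma poly_growth_G: "poly_growth G"
  unfolding G_def[abs_def] by (intro poly_growth_intros)

lemma poly_growth_F: "poly_growth F"
  unfolding F_def[abs_def] by (intro poly_growth_intros poly_growth_R poly_growth_G)

lemma poly_growth_F': "poly_growth (\<lambda>X. F' X H)"
  unfolding F'_def by (intro poly_growth_diff poly_growth_intros poly_growth_R poly_growth_G)

text \<open>Differentiating \<open>R\<close> inside \<open>F = R G\<close> gives one term for each of the two factors of \<open>G G\<^sup>T\<close>. The sum over all
  entries turns the first into a product of traces and the second into \<open>F \<bullet> F\<close>.\<close>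

lemma divergence_F:
  "(\<Sum>p\<in>UNIV. F' X (unit_matrix (fst p) (snd p)) $ fst p $ snd p) =
    trace Q * a X - a X * (trace P - \<epsilon> * a X) - F X \<bullet> F X"
proof -
  have expand: "F' X H = (R X ** P) ** H ** Q - (R X ** P) ** H ** (transpose (G X) ** R X ** G X)
      - F X ** transpose H ** F X" for H
  proof -
    have "R X ** ((P ** H ** Q) ** transpose (G X)) ** R X ** G X
        = (R X ** P) ** H ** ((Q ** transpose (G X)) ** R X ** G X)"
      by (simp add: matrix_mul_assoc)
    moreover have "R X ** (G X ** transpose (P ** H ** Q)) ** R X ** G X
        = (R X ** (G X ** Q)) ** transpose H ** ((P ** R X) ** G X)"
      by (simp add: matrix_transpose_mul P Q matrix_mul_assoc)
    ultimately show ?thesis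
      by (simp add: F'_def mm.add_left mm.add_right GQ QGt PR RP_G flip: F_def)
        (simp add: matrix_mul_assoc)
  qed
  have "trace (transpose (G X) ** R X ** G X) = trace P - \<epsilon> * a X"
    using inner_G_F[of X] trace_transpose_mult[of "G X" "F X"] by (simp add: F_def matrix_mul_assoc)
  moreover have "trace (R X ** P) = a X" by (simp add: a_def PR)
  ultimately show ?thesis
    by (simp add: expand sum_subtractf sum_entry_conj_unit_matrix sum_entry_conj_unit_matrix_transpose)
qed

end

section \<open>Stein's identity and expected inverse Gram matrices\<close>

context prob_space
begin

lemma gaussian_poly_growth_integrable:
  fixes \<Omega> :: "'a \<Rightarrow> real^'m^'d" and \<Phi> :: "real^'m^'d \<Rightarrow> real"
  assumes "gaussian_matrix \<Omega>" "continuous_on UNIV \<Phi>" "poly_growth \<Phi>"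
  shows "integrable M (\<lambda>\<omega>. \<Phi> (\<Omega> \<omega>))"
proof -
  obtain C k where "\<And>X. norm (\<Phi> X) \<le> C * (1 + norm X) ^ k"
    using assms(3) by (auto simp: poly_growth_def)
  then show ?thesis
    using assms by (intro gaussian_matrix_integrable[of \<Omega> \<Phi> C k] borel_measurable_continuous_onI) auto
qed

text \<open>Stein's identity for an arbitrary direction \<open>V\<close>, by linearity from the coordinate directions.\<close>

lemma gaussian_stein:
  fixes \<Omega> :: "'a \<Rightarrow> real^'m^'d" and \<Phi> :: "real^'m^'d \<Rightarrow> real"
  assumes G: "gaussian_matrix \<Omega>"
    and deriv: "\<And>X. (\<Phi> has_derivative \<Phi>' X) (at X)"
    and cont: "\<And>V. continuous_on UNIV (\<lambda>X. \<Phi>' X V)"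
    and growth: "poly_growth \<Phi>" "\<And>V. poly_growth (\<lambda>X. \<Phi>' X V)"
  shows "(\<integral>\<omega>. (V \<bullet> \<Omega> \<omega>) * \<Phi> (\<Omega> \<omega>) \<partial>M) = (\<integral>\<omega>. \<Phi>' (\<Omega> \<omega>) V \<partial>M)"
proof -
  let ?E = "\<lambda>p. unit_matrix (fst p) (snd p) :: real^'m^'d"
  have cont\<Phi>: "continuous_on UNIV \<Phi>"
    using deriv by (meson continuous_at_imp_continuous_on has_derivative_continuous)
  have entry: "(\<integral>\<omega>. \<Omega> \<omega> $ fst p $ snd p * \<Phi> (\<Omega> \<omega>) \<partial>M) = (\<integral>\<omega>. \<Phi>' (\<Omega> \<omega>) (?E p) \<partial>M)" for p
  proof -
    obtain C k where C: "0 \<le> C" "\<And>X l. k \<le> l \<Longrightarrow> norm (\<Phi> X) \<le> C * (1 + norm X) ^ l"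
      by (rule poly_growthE[OF growth(1)]) blast
    obtain D j where D: "0 \<le> D" "\<And>X l. j \<le> l \<Longrightarrow> norm (\<Phi>' X (?E p)) \<le> D * (1 + norm X) ^ l"
      by (rule poly_growthE[OF growth(2)[of "?E p"]]) blast
    show ?thesis
    proof (rule gaussian_stein_entry[OF G deriv cont, where C = "C + D" and k = "max k j"])
      show "\<bar>\<Phi> X\<bar> \<le> (C + D) * (1 + norm X) ^ max k j" for X
        using C(2)[of "max k j" X] D(1) by (simp add: distrib_right add_increasing2)
      show "\<bar>\<Phi>' X (?E p)\<bar> \<le> (C + D) * (1 + norm X) ^ max k j" for X
        using D(2)[of "max k j" X] C(1) by (simp add: distrib_right add_increasing)
    qed
  qed
  have int1: "integrable M (\<lambda>\<omega>. \<Omega> \<omega> $ i $ j * \<Phi> (\<Omega> \<omega>))" for i j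
    by (rule gaussian_poly_growth_integrable[OF G, of "\<lambda>X. X $ i $ j * \<Phi> X"])
      (intro continuous_intros cont\<Phi> poly_growth_bilinear[OF bounded_bilinear_mult] poly_growth_entry
        poly_growth_ident growth)+
  have int2: "integrable M (\<lambda>\<omega>. \<Phi>' (\<Omega> \<omega>) H)" for H
    by (rule gaussian_poly_growth_integrable[OF G cont growth(2)])
  have "V \<bullet> X = (\<Sum>p\<in>UNIV. V $ fst p $ snd p * X $ fst p $ snd p)" for X :: "real^'m^'d"
    by (simp add: inner_vec_def sum_pairs[of "\<lambda>i j. V $ i $ j * X $ i $ j"])
  then have "(\<integral>\<omega>. (V \<bullet> \<Omega> \<omega>) * \<Phi> (\<Omega> \<omega>) \<partial>M)
      = (\<integral>\<omega>. (\<Sum>p\<in>UNIV. V $ fst p $ snd p * (\<Omega> \<omega> $ fst p $ snd p * \<Phi> (\<Omega> \<omega>))) \<partial>M)"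
    by (simp add: sum_distrib_right mult.assoc)
  also have "\<dots> = (\<Sum>p\<in>UNIV. V $ fst p $ snd p * (\<integral>\<omega>. \<Phi>' (\<Omega> \<omega>) (?E p) \<partial>M))"
    using int1 by (simp add: entry)
  also have "\<dots> = (\<integral>\<omega>. (\<Sum>p\<in>UNIV. V $ fst p $ snd p * \<Phi>' (\<Omega> \<omega>) (?E p)) \<partial>M)"
    using int2 by simp
  also have "\<dots> = (\<integral>\<omega>. \<Phi>' (\<Omega> \<omega>) V \<partial>M)"
  proof (rule Bochner_Integration.integral_cong[OF refl])
    fix \<omega>
    have lin: "linear (\<Phi>' (\<Omega> \<omega>))" by (rule has_derivative_linear[OF deriv])
    show "(\<Sum>p\<in>UNIV. V $ fst p $ snd p * \<Phi>' (\<Omega> \<omega>) (?E p)) = \<Phi>' (\<Omega> \<omega>) V"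
      by (subst (3) matrix_eq_sum_unit) (simp add: linear_sum[OF lin] linear_scale[OF lin])
  qed
  finally show ?thesis .
qed

end

lemma inner_unit_matrix: "unit_matrix i j \<bullet> X = X $ i $ j"
  by (simp add: inner_axis')

lemma inner_matrix_eq_sum: "(X :: real^'m^'d) \<bullet> Y = (\<Sum>p\<in>UNIV. X $ fst p $ snd p * Y $ fst p $ snd p)"
  by (simp add: inner_vec_def sum_pairs[of "\<lambda>i j. X $ i $ j * Y $ i $ j"])

lemma matrix_vector_inner_eq_sum: "(transpose X *v u) $ j = (\<chi> i l. if l = j then u $ i else 0) \<bullet> (X :: real^'m^'d)"
  by (simp add: matrix_vector_mult_def transpose_def inner_vec_def if_distrib if_distribR mult.commute cong: if_cong)

lemma norm_matrix_vector_mult_le: "norm (A *v x) \<le> norm (A :: real^'n^'m) * norm x"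
proof -
  have "(norm (A *v x))\<^sup>2 = (\<Sum>i\<in>UNIV. (A $ i \<bullet> x)\<^sup>2)"
    unfolding power2_norm_eq_inner inner_vec_def[of "A *v x" "A *v x"]
    by (simp add: matrix_vector_mul_component power2_eq_square)
  also have "\<dots> \<le> (\<Sum>i\<in>UNIV. (A $ i \<bullet> A $ i) * (x \<bullet> x))"
    by (intro sum_mono Cauchy_Schwarz_ineq)
  also have "\<dots> = (norm A * norm x)\<^sup>2"
    unfolding power_mult_distrib power2_norm_eq_inner inner_vec_def[of A A]
    by (simp add: sum_distrib_right)
  finally show ?thesis by (rule power2_le_imp_le) simp
qed

context prob_space
begin

text \<open>Stein's identity for \<open>F\<close> equates the means of \<open>trace P - \<epsilon> a\<close> and of the divergence of \<open>F\<close>, and the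
  divergence is at least \<open>(trace Q - trace P - 1) a\<close>. In the limit \<open>\<epsilon> \<rightarrow> 0\<close> the resulting
  bound is the mean trace of an inverse Wishart matrix.\<close>

lemma expectation_trace_inverse_gram_le:
  fixes \<Omega> :: "'a \<Rightarrow> real^'m^'d"
  assumes mg: "masked_gram P Q \<epsilon>" and gm: "gaussian_matrix \<Omega>"
  shows "(trace Q - trace P - 1) * expectation (\<lambda>\<omega>. masked_gram.a P Q \<epsilon> (\<Omega> \<omega>)) \<le> trace P"
    and "integrable M (\<lambda>\<omega>. masked_gram.a P Q \<epsilon> (\<Omega> \<omega>))"
proof -
  interpret masked_gram P Q \<epsilon> by fact
  have pa: "poly_growth a"
    unfolding a_def[abs_def] trace_eq_inner
    by (intro poly_growth_bilinear[OF bounded_bilinear_inner] poly_growth_intros poly_growth_R)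
  have pFF: "poly_growth (\<lambda>X. F X \<bullet> F X)"
    by (intro poly_growth_bilinear[OF bounded_bilinear_inner] poly_growth_F)
  have ia: "integrable M (\<lambda>\<omega>. a (\<Omega> \<omega>))"
    by (rule gaussian_poly_growth_integrable[OF gm continuous_a pa])
  then show "integrable M (\<lambda>\<omega>. a (\<Omega> \<omega>))" .
  have iaa: "integrable M (\<lambda>\<omega>. a (\<Omega> \<omega>) * a (\<Omega> \<omega>))"
    by (rule gaussian_poly_growth_integrable[OF gm, of "\<lambda>X. a X * a X"])
      (intro continuous_intros continuous_a poly_growth_bilinear[OF bounded_bilinear_mult] pa)+
  have iFF: "integrable M (\<lambda>\<omega>. F (\<Omega> \<omega>) \<bullet> F (\<Omega> \<omega>))"
    by (rule gaussian_poly_growth_integrable[OF gm _ pFF]) (intro continuous_intros)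
  let ?E = "\<lambda>p. unit_matrix (fst p) (snd p) :: real^'m^'d"
  have entry: "(\<integral>\<omega>. \<Omega> \<omega> $ fst p $ snd p * F (\<Omega> \<omega>) $ fst p $ snd p \<partial>M)
      = (\<integral>\<omega>. F' (\<Omega> \<omega>) (?E p) $ fst p $ snd p \<partial>M)" for p
  proof -
    have "(\<integral>\<omega>. (?E p \<bullet> \<Omega> \<omega>) * (F (\<Omega> \<omega>) $ fst p $ snd p) \<partial>M) = (\<integral>\<omega>. F' (\<Omega> \<omega>) (?E p) $ fst p $ snd p \<partial>M)"
    proof (rule gaussian_stein[OF gm])
      show "((\<lambda>X. F X $ fst p $ snd p) has_derivative (\<lambda>H. F' X H $ fst p $ snd p)) (at X)" for X
        using bounded_linear.has_derivative[OF bounded_linear_vec_nth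
            bounded_linear.has_derivative[OF bounded_linear_vec_nth F_has_derivative]] .
    qed (intro continuous_intros continuous_F' poly_growth_entry poly_growth_F poly_growth_F')+
    then show ?thesis by (simp add: inner_unit_matrix)
  qed
  have i1: "integrable M (\<lambda>\<omega>. \<Omega> \<omega> $ fst p $ snd p * F (\<Omega> \<omega>) $ fst p $ snd p)" for p
    by (rule gaussian_poly_growth_integrable[OF gm, of "\<lambda>X. X $ fst p $ snd p * F X $ fst p $ snd p"])
      (intro continuous_intros poly_growth_bilinear[OF bounded_bilinear_mult] poly_growth_entry
        poly_growth_ident poly_growth_F)+
  have i2: "integrable M (\<lambda>\<omega>. F' (\<Omega> \<omega>) (?E p) $ fst p $ snd p)" for p
    by (rule gaussian_poly_growth_integrable[OF gm, of "\<lambda>X. F' X (?E p) $ fst p $ snd p"])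
      (intro continuous_intros continuous_F' poly_growth_entry poly_growth_F')+
  have "trace P - \<epsilon> * expectation (\<lambda>\<omega>. a (\<Omega> \<omega>)) = expectation (\<lambda>\<omega>. \<Omega> \<omega> \<bullet> F (\<Omega> \<omega>))"
    using ia by (simp add: inner_F prob_space)
  also have "\<dots> = expectation (\<lambda>\<omega>. \<Sum>p\<in>UNIV. F' (\<Omega> \<omega>) (?E p) $ fst p $ snd p)"
    using i1 i2 by (simp add: inner_matrix_eq_sum entry)
  also have "\<dots> = expectation (\<lambda>\<omega>. (trace Q - trace P) * a (\<Omega> \<omega>) + \<epsilon> * (a (\<Omega> \<omega>) * a (\<Omega> \<omega>)) - F (\<Omega> \<omega>) \<bullet> F (\<Omega> \<omega>))"
    unfolding divergence_F by (simp add: algebra_simps)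
  also have "\<dots> \<ge> expectation (\<lambda>\<omega>. (trace Q - trace P - 1) * a (\<Omega> \<omega>))"
  proof (rule integral_mono)
    show "(trace Q - trace P - 1) * a X \<le> (trace Q - trace P) * a X + \<epsilon> * (a X * a X) - F X \<bullet> F X" for X
    proof -
      have "0 \<le> \<epsilon> * (a X * a X)" using \<epsilon> by simp
      then show ?thesis using norm_F_le[of X] by (simp add: algebra_simps)
    qed
  qed (use ia iaa iFF in auto)
  moreover have "0 \<le> \<epsilon> * expectation (\<lambda>\<omega>. a (\<Omega> \<omega>))"
    using \<epsilon> a_nonneg by simp
  ultimately show "(trace Q - trace P - 1) * expectation (\<lambda>\<omega>. a (\<Omega> \<omega>)) \<le> trace P"
    by simp
qed

text \<open>For a unit vector \<open>u\<close> with \<open>P u = 0\<close>, \<open>X\<^sup>T u\<close> is a standard Gaussian vector independent of \<open>F X\<close>, so the mean of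
  the square norm of \<open>F X (X\<^sup>T u)\<close> is that of \<open>F X \<bullet> F X\<close>. Stein's identity expresses the independence: \<open>F\<close> has
  derivative \<open>0\<close> in the directions \<open>V j\<close>, whose rows are multiples of the \<open>j\<close>-th unit vector by
  the entries of \<open>u\<close>.\<close>

lemma expectation_cross_term_le:
  fixes \<Omega> :: "'a \<Rightarrow> real^'m^'d" and u :: "real^'d"
  assumes mg: "masked_gram P Q \<epsilon>" and gm: "gaussian_matrix \<Omega>"
    and u: "u \<bullet> u = 1" "P *v u = 0"
  shows "expectation (\<lambda>\<omega>. (norm (masked_gram.F P Q \<epsilon> (\<Omega> \<omega>) *v (transpose (\<Omega> \<omega>) *v u)))\<^sup>2)
      \<le> expectation (\<lambda>\<omega>. masked_gram.a P Q \<epsilon> (\<Omega> \<omega>))"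
    and "integrable M (\<lambda>\<omega>. (norm (masked_gram.F P Q \<epsilon> (\<Omega> \<omega>) *v (transpose (\<Omega> \<omega>) *v u)))\<^sup>2)"
proof -
  interpret masked_gram P Q \<epsilon> by fact
  let ?g = "\<lambda>X. (norm (F X *v (transpose X *v u)))\<^sup>2"
  define N where "N X = transpose (F X) ** F X" for X
  define N' where "N' X H = transpose (F X) ** F' X H + transpose (F' X H) ** F X" for X H
  define V :: "'m \<Rightarrow> real^'m^'d" where "V j = (\<chi> i l. if l = j then u $ i else 0)" for j
  define \<Phi> where "\<Phi> j X = ((N X ** transpose X) *v u) $ j" for j X
  define \<Phi>' where "\<Phi>' j X H = ((N X ** transpose H + N' X H ** transpose X) *v u) $ j" for j X H
  have bl: "bounded_linear (\<lambda>A :: real^'d^'m. (A *v u) $ j)" for j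
    unfolding linear_conv_bounded_linear[symmetric]
    by (auto intro!: linearI simp: matrix_vector_mult_add_rdistrib scaleR_matrix_vector_assoc[symmetric])
  have cN: "continuous_on UNIV N" unfolding N_def[abs_def] by (intro continuous_intros)
  have pN: "poly_growth N" unfolding N_def[abs_def] by (intro poly_growth_intros poly_growth_F)
  have c\<Phi>: "continuous_on UNIV (\<Phi> j)" for j
    unfolding \<Phi>_def[abs_def] by (intro bounded_linear.continuous_on[OF bl] continuous_intros cN)
  have p\<Phi>: "poly_growth (\<Phi> j)" for j
    unfolding \<Phi>_def[abs_def] by (intro poly_growth_linear[OF bl] poly_growth_intros pN)
  have dN: "(N has_derivative N' X) (at X)" for X
    using mm.FDERIV[OF bounded_linear.has_derivative[OF bounded_linear_transpose F_has_derivative] F_has_derivative]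
    by (simp add: N_def[abs_def] N'_def[abs_def])
  have d\<Phi>: "(\<Phi> j has_derivative \<Phi>' j X) (at X)" for j X
    unfolding \<Phi>_def[abs_def] \<Phi>'_def[abs_def]
    by (intro bounded_linear.has_derivative[OF bl] mm.FDERIV dN
        bounded_linear_imp_has_derivative bounded_linear_transpose)
  have c\<Phi>': "continuous_on UNIV (\<lambda>X. \<Phi>' j X H)" for j H
    unfolding \<Phi>'_def N'_def
    by (intro bounded_linear.continuous_on[OF bl] continuous_intros cN continuous_F')
  have p\<Phi>': "poly_growth (\<lambda>X. \<Phi>' j X H)" for j H
    unfolding \<Phi>'_def N'_def
    by (intro poly_growth_linear[OF bl] poly_growth_intros pN poly_growth_F poly_growth_F')
  have split: "?g X = (\<Sum>j\<in>UNIV. (V j \<bullet> X) * \<Phi> j X)" for X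
  proof -
    have "(F X *v w) \<bullet> (F X *v w) = w \<bullet> (N X *v w)" for w
      unfolding N_def matrix_vector_mul_assoc[symmetric]
      by (metis dot_matrix_vector_transpose inner_commute)
    from this[of "transpose X *v u"]
    have "?g X = (transpose X *v u) \<bullet> ((N X ** transpose X) *v u)"
      by (simp only: power2_norm_eq_inner matrix_vector_mul_assoc[symmetric])
    then show ?thesis
      unfolding inner_vec_def[of "transpose X *v u"] \<Phi>_def V_def matrix_vector_inner_eq_sum by simp
  qed
  have PV: "P ** V j = 0" for j
  proof -
    have "(P ** V j) $ i $ l = (if l = j then (P *v u) $ i else 0)" for i l
      by (simp add: matrix_matrix_mult_def matrix_vector_mult_def V_def)
    then show ?thesis by (simp add: u(2) vec_eq_iff)
  qed
  have t0: "transpose (0 :: real^'m^'d) = 0" by (simp add: transpose_def vec_eq_iff)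
  have F'V: "F' X (V j) = 0" for X j
    by (simp add: F'_def PV mm.zero_left mm.zero_right t0)
  have trV: "transpose (V j) *v u = axis j 1" for j
    using u(1) by (simp add: vec_eq_iff matrix_vector_mult_def transpose_def V_def axis_def inner_vec_def)
  have \<Phi>'V: "\<Phi>' j X (V j) = N X $ j $ j" for j X
  proof -
    have "\<Phi>' j X (V j) = (N X *v (transpose (V j) *v u)) $ j"
      unfolding \<Phi>'_def N'_def F'V t0 mm.zero_left mm.zero_right matrix_vector_mul_assoc by simp
    then show ?thesis unfolding trV by (simp add: matrix_vector_mul_component inner_axis)
  qed
  have i1: "integrable M (\<lambda>\<omega>. (V j \<bullet> \<Omega> \<omega>) * \<Phi> j (\<Omega> \<omega>))" for j
    by (rule gaussian_poly_growth_integrable[OF gm, of "\<lambda>X. (V j \<bullet> X) * \<Phi> j X"])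
      (intro continuous_intros c\<Phi> poly_growth_bilinear[OF bounded_bilinear_mult] p\<Phi>
        poly_growth_bilinear[OF bounded_bilinear_inner] poly_growth_const poly_growth_ident)+
  then show int: "integrable M (\<lambda>\<omega>. ?g (\<Omega> \<omega>))"
    unfolding split by simp
  have i2: "integrable M (\<lambda>\<omega>. N (\<Omega> \<omega>) $ j $ j)" for j
    by (rule gaussian_poly_growth_integrable[OF gm, of "\<lambda>X. N X $ j $ j"])
      (intro continuous_intros cN poly_growth_entry pN)+
  have "expectation (\<lambda>\<omega>. ?g (\<Omega> \<omega>))
      = (\<Sum>j\<in>UNIV. expectation (\<lambda>\<omega>. (V j \<bullet> \<Omega> \<omega>) * \<Phi> j (\<Omega> \<omega>)))"
    unfolding split using i1 by simp
  also have "\<dots> = (\<Sum>j\<in>UNIV. expectation (\<lambda>\<omega>. N (\<Omega> \<omega>) $ j $ j))"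
    using gaussian_stein[OF gm d\<Phi> c\<Phi>' p\<Phi> p\<Phi>'] by (simp add: \<Phi>'V)
  also have "\<dots> = expectation (\<lambda>\<omega>. F (\<Omega> \<omega>) \<bullet> F (\<Omega> \<omega>))"
  proof -
    have "(\<Sum>j\<in>UNIV. N X $ j $ j) = F X \<bullet> F X" for X
      by (simp only: trace_def[symmetric] N_def trace_transpose_mult)
    then show ?thesis using i2 by (simp flip: Bochner_Integration.integral_sum)
  qed
  also have "\<dots> \<le> expectation (\<lambda>\<omega>. a (\<Omega> \<omega>))"
  proof (rule integral_mono)
    show "integrable M (\<lambda>\<omega>. F (\<Omega> \<omega>) \<bullet> F (\<Omega> \<omega>))"
      by (rule gaussian_poly_growth_integrable[OF gm, of "\<lambda>X. F X \<bullet> F X"])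
        (intro continuous_intros poly_growth_bilinear[OF bounded_bilinear_inner] poly_growth_F)+
  qed (auto intro: norm_F_le expectation_trace_inverse_gram_le(2)[OF mg gm])
  finally show "expectation (\<lambda>\<omega>. ?g (\<Omega> \<omega>))
      \<le> expectation (\<lambda>\<omega>. a (\<Omega> \<omega>))" .
qed

end

section \<open>The quadratic form off the random subspace\<close>

lemma matrix_power_sym:
  fixes A :: "real^'d^'d"
  assumes "transpose A = A"
  shows "z \<bullet> ((*v) A ^^ k) w = ((*v) A ^^ k) z \<bullet> w"
proof (induction k arbitrary: w)
  case (Suc k)
  have "z \<bullet> ((*v) A ^^ Suc k) w = z \<bullet> ((*v) A ^^ k) (A *v w)"
    by (simp add: funpow_Suc_right del: funpow.simps)
  also have "\<dots> = (A *v (((*v) A ^^ k) z)) \<bullet> w"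
    by (simp only: Suc dot_matrix_vector_transpose assms)
  finally show ?case by simp
qed simp

lemma eigenbasis_power_coeff:
  fixes A :: "real^'d^'d"
  assumes "eigenbasis A lam u" "transpose A = A" "i \<in> {1..CARD('d)}"
  shows "u i \<bullet> ((*v) A ^^ k) z = lam i ^ k * (u i \<bullet> z)"
  by (induction k) (simp_all add: eigenbasis_coeff[OF assms])

context masked_gram
begin

text \<open>Let \<open>y\<close> be \<open>(A / lam (r + 1))\<^sup>k z\<close>. Its coefficients along the trailing eigenvectors do not exceed those of
  \<open>z\<close>. As \<open>y\<close> is orthogonal to the columns of \<open>X\<close> in \<open>J\<close>, its leading part \<open>y1\<close> satisfies
  \<open>G G\<^sup>T y1 = - G X\<^sup>T y2\<close>, hence \<open>y1 = - F X\<^sup>T y2 + \<epsilon> P R y1\<close>, and for small \<open>\<epsilon>\<close> the last term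
  can be absorbed. Jensen's inequality passes from \<open>A\<^sup>2\<^sup>k\<close> to \<open>A\<close>. The base \<open>36\<close> is what
  \<open>block_krylov_error\<close> consumes.\<close>

lemma tail_form_bound:
  fixes A :: "real^'d^'d" and X :: "real^'m^'d"
  assumes A: "symmetric_pos_def A" and u: "eigenbasis A lam u" and mono: "antimono_on {1..CARD('d)} lam"
    and r: "r < CARD('d)" and k: "0 < k"
    and PP: "\<And>x. P *v x = (\<Sum>i = 1..r. (u i \<bullet> x) *\<^sub>R u i)"
    and QJ: "\<And>v. (\<And>j. j \<in> J \<Longrightarrow> v $ j = 0) \<Longrightarrow> Q *v v = 0"
    and small: "\<epsilon> * a X \<le> 1 / 4"
    and cross: "(\<Sum>i = r + 1..CARD('d). ((lam i / lam (r + 1)) ^ k)\<^sup>2 *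
        (norm (F X *v (transpose X *v u i)))\<^sup>2) \<le> T"
    and T: "4 * T + 1 \<le> 36 ^ (2 * k)"
    and z: "\<And>j. j \<in> J \<Longrightarrow> z \<bullet> ((*v) A ^^ k) (column j X) = 0"
  shows "z \<bullet> (A *v z) \<le> 36 * lam (r + 1) * (z \<bullet> z)"
proof (cases "z = 0")
  case False
  have At: "transpose A = A" using A by (simp add: symmetric_pos_def_def)
  define l where "l = lam (r + 1)"
  have l: "0 < l" using eigenvalue_pos[OF u A, of "r + 1"] r by (simp add: l_def)
  define \<psi> where "\<psi> i = (lam i / l) ^ k" for i
  define \<zeta> where "\<zeta> i = u i \<bullet> z" for i
  define y where "y = (1 / l ^ k) *\<^sub>R ((*v) A ^^ k) z"
  have uy: "u i \<bullet> y = \<psi> i * \<zeta> i" if "i \<in> {1..CARD('d)}" for i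
    using eigenbasis_power_coeff[OF u At that, of k z] by (simp add: y_def \<psi>_def \<zeta>_def power_divide)
  have zz: "z \<bullet> z = (\<Sum>i = 1..CARD('d). (\<zeta> i)\<^sup>2)"
    unfolding eigenbasis_inner[OF u, of z z] \<zeta>_def power2_eq_square by (rule refl)
  define y1 y2 where "y1 = P *v y" and "y2 = y - y1"
  have union: "{1..CARD('d)} = {1..r} \<union> {r + 1..CARD('d)}" "{1..r} \<inter> {r + 1..CARD('d)} = {}"
    using r by auto
  have y1: "y1 = (\<Sum>i = 1..r. (\<psi> i * \<zeta> i) *\<^sub>R u i)"
    unfolding y1_def PP using r by (intro sum.cong) (auto simp: uy)
  have "y = (\<Sum>i = 1..CARD('d). (\<psi> i * \<zeta> i) *\<^sub>R u i)"
  proof -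
    have "y = (\<Sum>i = 1..CARD('d). (u i \<bullet> y) *\<^sub>R u i)" using u by (simp add: eigenbasis_def)
    also have "\<dots> = (\<Sum>i = 1..CARD('d). (\<psi> i * \<zeta> i) *\<^sub>R u i)" by (intro sum.cong) (auto simp: uy)
    finally show ?thesis .
  qed
  then have y2: "y2 = (\<Sum>i = r + 1..CARD('d). (\<psi> i * \<zeta> i) *\<^sub>R u i)"
    unfolding y2_def y1 union(1) by (subst (asm) sum.union_disjoint[OF _ _ union(2)]) auto
  have Py1: "P *v y1 = y1" by (simp add: y1_def matrix_vector_mul_assoc P)

  \<comment> \<open>Solve the orthogonality relation for the component in the range of \<open>P\<close>.\<close>
  have "Q *v (transpose X *v y) = 0"
  proof (rule QJ)
    fix j assume "j \<in> J"
    then have "column j X \<bullet> y = 0"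
      using z[of j] matrix_power_sym[OF At, of z k "column j X"] by (simp add: y_def inner_commute)
    then show "(transpose X *v y) $ j = 0"
      by (simp add: matrix_vector_mul_component column_def transpose_def)
  qed
  then have "Q *v (transpose X *v y1) = - (Q *v (transpose X *v y2))"
    by (simp add: y2_def matrix_vector_mult_diff_distrib)
  moreover have "transpose (G X) *v y1 = Q *v (transpose X *v y1)"
    by (simp add: G_def matrix_transpose_mul P Q Py1 flip: matrix_vector_mul_assoc)
  ultimately have "S X *v y1 = - (G X *v (Q *v (transpose X *v y2))) + \<epsilon> *\<^sub>R y1"
    by (simp add: S_def matrix_vector_mult_add_rdistrib mat_mult_vector linear_neg[OF matrix_vector_mul_linear]
        flip: matrix_vector_mul_assoc)
  also have "G X *v (Q *v (transpose X *v y2)) = G X *v (transpose X *v y2)"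
    by (simp add: matrix_vector_mul_assoc GQ)
  finally have "R X *v (S X *v y1) = R X *v (- (G X *v (transpose X *v y2)) + \<epsilon> *\<^sub>R y1)" by simp
  moreover have "R X *v (S X *v y1) = y1" by (simp add: matrix_vector_mul_assoc RS)
  moreover have "R X *v (- (G X *v w) + \<epsilon> *\<^sub>R y1) = - (F X *v w) + \<epsilon> *\<^sub>R (R X *v y1)" for w
    by (simp add: matrix_vector_mult_diff_distrib matrix_vector_mult_scaleR F_def flip: matrix_vector_mul_assoc)
  ultimately have "y1 = - (F X *v (transpose X *v y2)) + \<epsilon> *\<^sub>R (R X *v y1)" by metis
  moreover have "R X *v y1 = (P ** R X) *v y1"
    by (metis PR Py1 matrix_vector_mul_assoc)
  ultimately have eq: "y1 = - (F X *v (transpose X *v y2)) + \<epsilon> *\<^sub>R ((P ** R X) *v y1)"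
    by metis
  define g where "g = F X *v (transpose X *v y2)"
  note eq = eq[folded g_def]
  have "\<epsilon> * norm (P ** R X) \<le> 1 / 2"
  proof -
    have "(\<epsilon> * norm (P ** R X))\<^sup>2 = \<epsilon> * (\<epsilon> * ((P ** R X) \<bullet> (P ** R X)))"
      by (simp add: power2_norm_eq_inner power_mult_distrib power2_eq_square flip: power2_norm_eq_inner)
    also have "\<dots> \<le> \<epsilon> * a X"
    proof -
      have "\<epsilon> * ((P ** R X) \<bullet> (P ** R X)) \<le> a X" using norm_F[of X] inner_ge_zero[of "F X"] by linarith
      then show ?thesis using \<epsilon> by (intro mult_left_mono) auto
    qed
    also have "\<dots> \<le> (1 / 2)\<^sup>2" using small by (simp add: power2_eq_square)
    finally show ?thesis by (rule power2_le_imp_le) simp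
  qed
  then have "\<epsilon> * norm (P ** R X) * norm y1 \<le> 1 / 2 * norm y1" by (rule mult_right_mono) simp
  moreover have "norm y1 \<le> norm g + \<epsilon> * (norm (P ** R X) * norm y1)"
  proof -
    have "norm y1 \<le> norm g + norm (\<epsilon> *\<^sub>R ((P ** R X) *v y1))"
      by (subst eq) (metis norm_minus_cancel norm_triangle_ineq)
    also have "norm (\<epsilon> *\<^sub>R ((P ** R X) *v y1)) \<le> \<epsilon> * (norm (P ** R X) * norm y1)"
      using \<epsilon> norm_matrix_vector_mult_le by simp
    finally show ?thesis by simp
  qed
  ultimately have ny1: "norm y1 \<le> 2 * norm g" by (simp add: mult.assoc)
  let ?f = "\<lambda>i. F X *v (transpose X *v u i)" and ?hi = "{r + 1..CARD('d)}" and ?all = "{1..CARD('d)}"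
  have "(norm g)\<^sup>2 \<le> (z \<bullet> z) * T"
  proof -
    have "g = (\<Sum>i\<in>?hi. \<zeta> i *\<^sub>R (\<psi> i *\<^sub>R (?f i)))"
      unfolding g_def y2 by (simp add: linear_sum[OF matrix_vector_mul_linear] matrix_vector_mult_scaleR mult.commute)
    then have "norm g \<le> (\<Sum>i\<in>?hi. \<bar>\<zeta> i\<bar> * (\<bar>\<psi> i\<bar> * norm (?f i)))"
      using norm_sum[of "\<lambda>i. \<zeta> i *\<^sub>R (\<psi> i *\<^sub>R (?f i))" "?hi"]
      by (simp add: abs_mult mult.assoc)
    then have "(norm g)\<^sup>2
        \<le> (\<Sum>i\<in>?hi. \<bar>\<zeta> i\<bar> * (\<bar>\<psi> i\<bar> * norm (?f i)))\<^sup>2"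
      by (rule power_mono) simp
    also have "\<dots> \<le> (\<Sum>i\<in>?hi. \<bar>\<zeta> i\<bar>\<^sup>2) *
        (\<Sum>i\<in>?hi. (\<bar>\<psi> i\<bar> * norm (?f i))\<^sup>2)"
      by (rule Cauchy_Schwarz_ineq_sum)
    also have "\<dots> \<le> (z \<bullet> z) * T"
    proof (rule mult_mono)
      show "(\<Sum>i\<in>?hi. \<bar>\<zeta> i\<bar>\<^sup>2) \<le> z \<bullet> z"
        unfolding zz by (simp, rule sum_mono2) auto
      show "(\<Sum>i\<in>?hi. (\<bar>\<psi> i\<bar> * norm (?f i))\<^sup>2) \<le> T"
        using cross by (simp add: power_mult_distrib \<psi>_def l_def)
    qed (auto intro: sum_nonneg)
    finally show ?thesis .
  qed
  moreover have "(norm y1)\<^sup>2 \<le> (2 * norm g)\<^sup>2"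
    using ny1 by (rule power_mono) simp
  ultimately have "(norm y1)\<^sup>2 \<le> 4 * ((z \<bullet> z) * T)" by (simp add: power_mult_distrib)
  moreover have "(norm y1)\<^sup>2 = (\<Sum>i = 1..r. (\<psi> i * \<zeta> i)\<^sup>2)"
  proof -
    have "(norm y1)\<^sup>2 = (\<Sum>i = 1..r. (\<psi> i * \<zeta> i) * (u i \<bullet> y1))"
      unfolding power2_norm_eq_inner by (subst y1) (simp add: inner_sum_left)
    also have "\<dots> = (\<Sum>i = 1..r. (\<psi> i * \<zeta> i)\<^sup>2)"
    proof (rule sum.cong[OF refl])
      fix i assume i: "i \<in> {1..r}"
      have "u i \<bullet> y1 = (\<Sum>j = 1..r. if j = i then \<psi> j * \<zeta> j else 0)"
        unfolding y1 inner_sum_right using u r i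
        by (intro sum.cong refl) (auto simp: eigenbasis_def)
      then show "(\<psi> i * \<zeta> i) * (u i \<bullet> y1) = (\<psi> i * \<zeta> i)\<^sup>2"
        using i by (simp add: power2_eq_square)
    qed
    finally show ?thesis .
  qed
  moreover have "(\<Sum>i\<in>?hi. (\<psi> i * \<zeta> i)\<^sup>2) \<le> z \<bullet> z"
  proof -
    have "(\<Sum>i\<in>?hi. (\<psi> i * \<zeta> i)\<^sup>2) \<le> (\<Sum>i\<in>?hi. (\<zeta> i)\<^sup>2)"
    proof (rule sum_mono)
      fix i assume i: "i \<in> ?hi"
      have "lam i \<le> l" using monotone_onD[OF mono, of "r + 1" i] i r by (auto simp: l_def)
      moreover have "0 < lam i" using eigenvalue_pos[OF u A, of i] i by simp
      ultimately have "0 \<le> \<psi> i" "\<psi> i \<le> 1"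
        using l by (auto simp: \<psi>_def intro!: power_le_one divide_nonneg_pos)
      then have "(\<psi> i)\<^sup>2 \<le> 1" by (simp add: power_le_one)
      then show "(\<psi> i * \<zeta> i)\<^sup>2 \<le> (\<zeta> i)\<^sup>2" by (simp add: power_mult_distrib mult_left_le_one_le)
    qed
    also have "\<dots> \<le> z \<bullet> z" unfolding zz by (rule sum_mono2) auto
    finally show ?thesis .
  qed
  moreover have "(\<Sum>i\<in>?all. (\<psi> i * \<zeta> i)\<^sup>2)
      = (\<Sum>i = 1..r. (\<psi> i * \<zeta> i)\<^sup>2) + (\<Sum>i\<in>?hi. (\<psi> i * \<zeta> i)\<^sup>2)"
    unfolding union(1) by (rule sum.union_disjoint[OF _ _ union(2)]) auto
  ultimately have "(\<Sum>i\<in>?all. (\<psi> i * \<zeta> i)\<^sup>2) \<le> (4 * T + 1) * (z \<bullet> z)"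
    by (simp add: algebra_simps)
  also have "\<dots> \<le> 36 ^ (2 * k) * (z \<bullet> z)" using T by (rule mult_right_mono) simp
  finally have power: "(\<Sum>i\<in>?all. (\<psi> i * \<zeta> i)\<^sup>2) \<le> 36 ^ (2 * k) * (z \<bullet> z)" .

  \<comment> \<open>Jensen's inequality for the spectral distribution of \<open>z\<close> turns the bound on a high moment
    into one on the mean.\<close>
  define w where "w i = (\<zeta> i)\<^sup>2 / (z \<bullet> z)" for i
  have zpos: "0 < z \<bullet> z" using False by simp
  have "(\<Sum>i\<in>?all. w i *\<^sub>R (lam i / l)) ^ (2 * k) \<le> (\<Sum>i\<in>?all. w i * (lam i / l) ^ (2 * k))"
  proof (rule convex_on_sum[OF _ _ convex_power_even])
    show "(\<Sum>i\<in>?all. w i) = 1"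
      unfolding w_def sum_divide_distrib[symmetric] zz[symmetric] using zpos by simp
  qed (auto simp: w_def)
  also have "\<dots> = (\<Sum>i\<in>?all. (\<psi> i * \<zeta> i)\<^sup>2) / (z \<bullet> z)"
    unfolding sum_divide_distrib
    by (intro sum.cong refl) (simp add: w_def \<psi>_def power_mult_distrib power_mult mult.commute flip: power_mult)
  also have "\<dots> \<le> 36 ^ (2 * k)" using power zpos by (simp add: divide_le_eq)
  finally have moment: "(\<Sum>i\<in>?all. w i *\<^sub>R (lam i / l)) ^ (2 * k) \<le> 36 ^ (2 * k)" .
  have "(\<Sum>i\<in>?all. w i *\<^sub>R (lam i / l)) \<le> 36"
  proof (rule ccontr)
    assume "\<not> ?thesis"
    then have "36 ^ (2 * k) < (\<Sum>i\<in>?all. w i *\<^sub>R (lam i / l)) ^ (2 * k)"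
      using k by (intro power_strict_mono) auto
    with moment show False by linarith
  qed
  then have "(\<Sum>i\<in>?all. lam i * (\<zeta> i)\<^sup>2) / (l * (z \<bullet> z)) \<le> 36"
    by (simp add: w_def sum_divide_distrib ac_simps)
  moreover have "z \<bullet> (A *v z) = (\<Sum>i\<in>?all. lam i * (\<zeta> i)\<^sup>2)"
    unfolding eigenbasis_inner[OF u, of z "A *v z"]
    by (intro sum.cong) (auto simp: eigenbasis_coeff[OF u At] \<zeta>_def power2_eq_square)
  ultimately show ?thesis using l zpos by (simp add: divide_le_eq l_def mult.assoc)
qed simp

end

section \<open>Failure probability of one block of columns\<close>

text \<open>The orthogonal projection onto the span of \<open>u 1, \<dots>, u r\<close>, for orthonormal \<open>u\<close>.\<close>

definition top_projection :: "(nat \<Rightarrow> real^'d) \<Rightarrow> nat \<Rightarrow> real^'d^'d" where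
  "top_projection u r = (\<chi> a b. \<Sum>i = 1..r. u i $ a * u i $ b)"

definition column_mask :: "'m set \<Rightarrow> real^'m^'m" where
  "column_mask J = (\<chi> a b. if a = b \<and> a \<in> J then 1 else 0)"

lemma top_projection_mult: "top_projection u r *v x = (\<Sum>i = 1..r. (u i \<bullet> x) *\<^sub>R u i)"
proof -
  have "(top_projection u r *v x) $ a = (\<Sum>i = 1..r. (u i \<bullet> x) *\<^sub>R u i) $ a" for a
  proof -
    have "(top_projection u r *v x) $ a = (\<Sum>b\<in>UNIV. \<Sum>i = 1..r. u i $ a * u i $ b * x $ b)"
      by (simp add: matrix_vector_mult_def top_projection_def sum_distrib_right)
    also have "\<dots> = (\<Sum>i = 1..r. \<Sum>b\<in>UNIV. u i $ a * u i $ b * x $ b)" by (rule sum.swap)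
    also have "\<dots> = (\<Sum>i = 1..r. (u i \<bullet> x) *\<^sub>R u i) $ a"
      by (simp add: inner_vec_def sum_distrib_left sum_distrib_right ac_simps)
    finally show ?thesis .
  qed
  then show ?thesis by (simp add: vec_eq_iff)
qed

lemma top_projection_sym: "transpose (top_projection u r) = top_projection u r"
  by (simp add: transpose_def top_projection_def vec_eq_iff mult.commute)

lemma matrix_eqI: "(\<And>x. A *v x = B *v x) \<Longrightarrow> A = (B :: real^'n^'m)"
  by (simp add: matrix_eq)

lemma top_projection_properties:
  fixes A :: "real^'d^'d"
  assumes u: "eigenbasis A lam u" and r: "r \<le> CARD('d)"
  shows "top_projection u r ** top_projection u r = top_projection u r"
    and "trace (top_projection u r) = real r"
    and "i \<in> {r + 1..CARD('d)} \<Longrightarrow> top_projection u r *v u i = 0"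
proof -
  have orth: "u i \<bullet> u j = (if i = j then 1 else 0)" if "i \<in> {1..CARD('d)}" "j \<in> {1..CARD('d)}" for i j
    using u that by (auto simp: eigenbasis_def)
  have fix_u: "top_projection u r *v u j = u j" if j: "j \<in> {1..r}" for j
  proof -
    have "top_projection u r *v u j = (\<Sum>i = 1..r. if i = j then u j else 0)"
      unfolding top_projection_mult using j r by (intro sum.cong refl) (auto simp: orth)
    then show ?thesis using j by simp
  qed
  show "top_projection u r ** top_projection u r = top_projection u r"
  proof (rule matrix_eqI)
    fix x
    have "top_projection u r *v (top_projection u r *v x) = (\<Sum>i = 1..r. (u i \<bullet> x) *\<^sub>R (top_projection u r *v u i))"
      unfolding top_projection_mult[of u r x]
      by (simp add: linear_sum[OF matrix_vector_mul_linear] matrix_vector_mult_scaleR)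
    also have "\<dots> = top_projection u r *v x"
      unfolding top_projection_mult[of u r x] by (intro sum.cong refl) (simp add: fix_u)
    finally show "(top_projection u r ** top_projection u r) *v x = top_projection u r *v x"
      by (simp add: matrix_vector_mul_assoc)
  qed
  have "trace (top_projection u r) = (\<Sum>i = 1..r. u i \<bullet> u i)"
    unfolding trace_def top_projection_def inner_vec_def by simp (rule sum.swap)
  also have "\<dots> = real r" using r by (simp add: orth)
  finally show "trace (top_projection u r) = real r" .
  show "top_projection u r *v u i = 0" if "i \<in> {r + 1..CARD('d)}"
    unfolding top_projection_mult using that by (intro sum.neutral) (auto simp: orth)
qed

lemma column_mask_mult: "(column_mask J *v x) $ j = (if j \<in> J then x $ j else 0)"
proof -
  have "(column_mask J *v x) $ j = (\<Sum>i\<in>UNIV. if i = j then (if j \<in> J then x $ j else 0) else 0)"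
    unfolding matrix_vector_mult_def column_mask_def vec_lambda_beta by (intro sum.cong refl) auto
  then show ?thesis by simp
qed

lemma column_mask_properties:
  shows "transpose (column_mask J) = column_mask J" "column_mask J ** column_mask J = column_mask J"
    and "trace (column_mask (J :: 'm::finite set)) = real (card J)"
proof -
  show "transpose (column_mask J) = column_mask J"
    by (auto simp: transpose_def column_mask_def vec_eq_iff)
  show "column_mask J ** column_mask J = column_mask J"
    by (rule matrix_eqI) (simp add: vec_eq_iff column_mask_mult flip: matrix_vector_mul_assoc)
  have "trace (column_mask J) = (\<Sum>j\<in>UNIV. if j \<in> J then 1 else 0)"
    by (simp add: trace_def column_mask_def)
  then show "trace (column_mask J) = real (card J)" by (simp flip: sum.inter_filter)
qed

lemma matrix_mult_column_mask_nth: "(X ** column_mask J) $ i $ j = (if j \<in> J then X $ i $ j else 0)"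
proof -
  have "(X ** column_mask J) $ i $ j = (\<Sum>l\<in>UNIV. if l = j then (if j \<in> J then X $ i $ j else 0) else 0)"
    unfolding matrix_matrix_mult_def column_mask_def vec_lambda_beta by (intro sum.cong refl) auto
  then show ?thesis by simp
qed

text \<open>The statistic adds the squared cross terms of the trailing eigenvectors, weighted by the powers
  of their eigenvalues, to a small multiple of the trace that controls the effect of regularisation.
  It is scaled so that values below 1 mean success. That it depends only on
  the columns in \<open>J\<close> is what makes different blocks independent.\<close>

lemma (in prob_space) ex_block_test:
  fixes A :: "real^'d^'d" and \<Omega> :: "'a \<Rightarrow> real^'m^'d" and J :: "'m set"
  assumes A: "symmetric_pos_def A" and u: "eigenbasis A lam u" and mono: "antimono_on {1..CARD('d)} lam"
    and r: "r < CARD('d)" and k: "0 < k" and p: "2 \<le> p" and J: "card J = r + p"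
    and gm: "gaussian_matrix \<Omega>"
    and big: "401 * (1 + real r / (real p - 1) * (\<Sum>i = r + 1..CARD('d). (lam i)\<^sup>2 / (lam (r + 1))\<^sup>2)) \<le> 36 ^ (2 * k)"
  shows "\<exists>W. continuous_on UNIV W \<and> (\<forall>X. W (X ** column_mask J) = W X) \<and>
      prob {\<omega> \<in> space M. 1 \<le> W (\<Omega> \<omega>)} \<le> 1 / 100 \<and>
      (\<forall>X :: real^'m^'d. W X < (1::real) \<longrightarrow> (\<forall>z. (\<forall>j\<in>J. z \<bullet> ((*v) A ^^ k) (column j X) = 0) \<longrightarrow>
        z \<bullet> (A *v z) \<le> 36 * lam (r + 1) * (z \<bullet> z)))"
proof -
  let ?hi = "{r + 1..CARD('d)}"
  define P where "P = top_projection u r"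
  define Q :: "real^'m^'m" where "Q = column_mask J"
  define \<rho> where "\<rho> = real r / (real p - 1)"
  define \<psi> where "\<psi> i = ((lam i / lam (r + 1)) ^ k)\<^sup>2" for i
  define Y where "Y = \<rho> * (\<Sum>i\<in>?hi. (lam i)\<^sup>2 / (lam (r + 1))\<^sup>2)"
  \<comment> \<open>\<open>T\<close> is 100 times the bound \<open>1 + Y\<close> for the mean of the statistic before scaling by \<open>T\<close>; \<open>\<eta>\<close> keeps the
    contribution of the trace to that mean at most 1, and \<open>\<epsilon>\<close> forces \<open>\<epsilon> a \<le> 1 / 4\<close> below the threshold.\<close>
  define T where "T = 100 * (1 + Y)"
  define \<eta> where "\<eta> = 1 / (1 + \<rho>)"
  define \<epsilon> where "\<epsilon> = \<eta> / (4 * T)"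
  have \<rho>: "0 \<le> \<rho>" using p by (simp add: \<rho>_def)
  have Y: "0 \<le> Y" using \<rho> by (auto simp: Y_def intro!: mult_nonneg_nonneg sum_nonneg)
  have T: "0 < T" "4 * T + 1 \<le> 36 ^ (2 * k)"
    using Y big unfolding Y_def[symmetric, unfolded \<rho>_def] by (auto simp: T_def)
  have \<eta>: "0 < \<eta>" "\<eta> * \<rho> \<le> 1" using \<rho> by (auto simp: \<eta>_def divide_simps)
  have mg: "masked_gram P Q \<epsilon>"
    using top_projection_properties(1)[OF u, of r] r T(1) \<eta>(1)
    by (simp add: masked_gram_def P_def Q_def \<epsilon>_def top_projection_sym column_mask_properties)
  interpret masked_gram P Q \<epsilon> by (fact mg)
  have trP: "trace P = real r" using top_projection_properties(2)[OF u, of r] r by (simp add: P_def)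
  have trQ: "trace Q = real (r + p)" by (simp add: Q_def column_mask_properties J)
  have Pu: "P *v u i = 0" if "i \<in> ?hi" for i
    using top_projection_properties(3)[OF u _ that] r by (simp add: P_def)
  define cr where "cr i X = (norm (F X *v (transpose X *v u i)))\<^sup>2" for i and X :: "real^'m^'d"
  define W where "W X = ((\<Sum>i\<in>?hi. \<psi> i * cr i X) + \<eta> * a X) / T" for X
  have cr_cont: "continuous_on UNIV (cr i)" for i
  proof -
    have bl: "bounded_linear (\<lambda>B :: real^'d^'d. B *v v)" for v
      unfolding linear_conv_bounded_linear[symmetric]
      by (auto intro!: linearI simp: matrix_vector_mult_add_rdistrib scaleR_matrix_vector_assoc[symmetric])
    show ?thesis
      unfolding cr_def[abs_def] matrix_vector_mul_assoc
      by (intro continuous_intros bounded_linear.continuous_on[OF bl])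
  qed
  have cont: "continuous_on UNIV W"
    unfolding W_def[abs_def] using T(1) by (intro continuous_intros cr_cont continuous_a) auto
  have maskG: "G (X ** Q) = G X" for X by (simp add: G_def Q flip: matrix_mul_assoc)
  have maskR: "R (X ** Q) = R X" for X by (simp add: R_def S_def maskG)
  have maskF: "F (X ** Q) = F X" for X by (simp add: F_def maskR maskG)
  have "F X *v (transpose (X ** Q) *v v) = F X *v (transpose X *v v)" for X v
  proof -
    have "F X *v (transpose (X ** Q) *v v) = (F X ** Q) *v (transpose X *v v)"
      by (simp only: matrix_transpose_mul Q matrix_vector_mul_assoc matrix_mul_assoc)
    then show ?thesis by (simp only: FQ)
  qed
  then have mask: "W (X ** column_mask J) = W X" for X
    unfolding Q_def[symmetric] by (simp add: W_def cr_def a_def maskF maskR)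
  have Ea: "expectation (\<lambda>\<omega>. a (\<Omega> \<omega>)) \<le> \<rho>"
    using expectation_trace_inverse_gram_le(1)[OF mg gm] p by (simp add: trP trQ \<rho>_def field_simps)
  have ia: "integrable M (\<lambda>\<omega>. a (\<Omega> \<omega>))"
    by (rule expectation_trace_inverse_gram_le(2)[OF mg gm])
  have uu: "u i \<bullet> u i = 1" if "i \<in> ?hi" for i using u that by (auto simp: eigenbasis_def)
  have Ecr: "expectation (\<lambda>\<omega>. cr i (\<Omega> \<omega>)) \<le> \<rho>" and icr: "integrable M (\<lambda>\<omega>. cr i (\<Omega> \<omega>))"
    if "i \<in> ?hi" for i
    unfolding cr_def using expectation_cross_term_le[OF mg gm uu[OF that] Pu[OF that]] Ea by auto
  have \<psi>: "0 \<le> \<psi> i" "\<psi> i \<le> (lam i)\<^sup>2 / (lam (r + 1))\<^sup>2" if i: "i \<in> ?hi" for i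
  proof -
    have l: "0 < lam i" "0 < lam (r + 1)" using eigenvalue_pos[OF u A] i r by auto
    moreover have "lam i \<le> lam (r + 1)" using monotone_onD[OF mono, of "r + 1" i] i r by auto
    ultimately have "(lam i / lam (r + 1)) ^ k \<le> (lam i / lam (r + 1)) ^ 1"
      using k by (intro power_decreasing) auto
    then have "\<psi> i \<le> (lam i / lam (r + 1))\<^sup>2"
      unfolding \<psi>_def using l by (intro power_mono) auto
    then show "\<psi> i \<le> (lam i)\<^sup>2 / (lam (r + 1))\<^sup>2" by (simp add: power_divide)
  qed (simp add: \<psi>_def)
  have iW: "integrable M (\<lambda>\<omega>. W (\<Omega> \<omega>))"
    unfolding W_def
    by (intro integrable_divide Bochner_Integration.integrable_add Bochner_Integration.integrable_sum
        integrable_mult_right ia icr)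
  have Wnn: "0 \<le> W X" for X
    unfolding W_def using T(1) \<eta>(1) a_nonneg \<psi>(1)
    by (intro divide_nonneg_pos add_nonneg_nonneg sum_nonneg mult_nonneg_nonneg) (auto simp: cr_def)
  have "expectation (\<lambda>\<omega>. W (\<Omega> \<omega>)) = ((\<Sum>i\<in>?hi. \<psi> i * expectation (\<lambda>\<omega>. cr i (\<Omega> \<omega>)))
      + \<eta> * expectation (\<lambda>\<omega>. a (\<Omega> \<omega>))) / T"
  proof -
    have "integrable M (\<lambda>\<omega>. \<Sum>i\<in>?hi. \<psi> i * cr i (\<Omega> \<omega>))"
      by (intro Bochner_Integration.integrable_sum integrable_mult_right icr)
    moreover have "expectation (\<lambda>\<omega>. \<Sum>i\<in>?hi. \<psi> i * cr i (\<Omega> \<omega>))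
        = (\<Sum>i\<in>?hi. \<psi> i * expectation (\<lambda>\<omega>. cr i (\<Omega> \<omega>)))"
      by (subst Bochner_Integration.integral_sum) (auto intro!: integrable_mult_right icr)
    ultimately show ?thesis unfolding W_def using ia by simp
  qed
  also have "\<dots> \<le> ((\<Sum>i\<in>?hi. (lam i)\<^sup>2 / (lam (r + 1))\<^sup>2 * \<rho>) + \<eta> * \<rho>) / T"
    using T(1) \<eta>(1) Ea \<rho> \<psi> Ecr
    by (intro divide_right_mono add_mono sum_mono mult_mono mult_left_mono) (auto simp: cr_def)
  also have "\<dots> \<le> (Y + 1) / T"
    using \<eta>(2) T(1)
    by (intro divide_right_mono add_mono) (simp_all only: Y_def mult.commute[of \<rho>] sum_distrib_right order_refl less_imp_le)
  also have "\<dots> = 1 / 100" using Y by (simp add: T_def field_simps)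
  finally have EW: "expectation (\<lambda>\<omega>. W (\<Omega> \<omega>)) \<le> 1 / 100" .
  have "prob {\<omega> \<in> space M. 1 \<le> W (\<Omega> \<omega>)} \<le> expectation (\<lambda>\<omega>. W (\<Omega> \<omega>)) / 1"
    by (rule integral_Markov_inequality_measure[OF iW sets.empty_sets]) (use Wnn in auto)
  with EW have markov: "prob {\<omega> \<in> space M. 1 \<le> W (\<Omega> \<omega>)} \<le> 1 / 100" by simp
  have tail: "z \<bullet> (A *v z) \<le> 36 * lam (r + 1) * (z \<bullet> z)"
    if W1: "W X < 1" and z: "\<And>j. j \<in> J \<Longrightarrow> z \<bullet> ((*v) A ^^ k) (column j X) = 0" for X z
  proof (rule tail_form_bound[OF A u mono r k _ _ _ _ T(2) z])
    have sum_nn: "0 \<le> (\<Sum>i\<in>?hi. \<psi> i * cr i X)"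
      using \<psi>(1) by (intro sum_nonneg mult_nonneg_nonneg) (auto simp: cr_def)
    have Wlt: "(\<Sum>i\<in>?hi. \<psi> i * cr i X) + \<eta> * a X < T"
      using W1 T(1) by (simp add: W_def)
    then have "\<eta> * a X \<le> T" using sum_nn by linarith
    then show "\<epsilon> * a X \<le> 1 / 4" using T(1) by (simp add: \<epsilon>_def field_simps)
    have "0 \<le> \<eta> * a X" using \<eta>(1) a_nonneg by simp
    with Wlt show "(\<Sum>i\<in>?hi. ((lam i / lam (r + 1)) ^ k)\<^sup>2 *
        (norm (F X *v (transpose X *v u i)))\<^sup>2) \<le> T"
      unfolding \<psi>_def cr_def by linarith
    show "P *v x = (\<Sum>i = 1..r. (u i \<bullet> x) *\<^sub>R u i)" for x by (simp add: P_def top_projection_mult)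
    show "Q *v v = 0" if "\<And>j. j \<in> J \<Longrightarrow> v $ j = 0" for v
      using that by (simp add: Q_def vec_eq_iff column_mask_mult)
  qed
  show ?thesis
    by (intro exI[of _ W] conjI allI impI cont mask markov tail) auto
qed

section \<open>Measurability of uniform accuracy\<close>

text \<open>Up to a term that does not depend on \<open>x\<close> this is the squared error in the norm of the shifted
  matrix, see \<open>mat_norm_diff_energy\<close>. In contrast to the error it is monotone in the shift.\<close>

definition energy :: "real^'d^'d \<Rightarrow> real^'d \<Rightarrow> real \<Rightarrow> real^'d \<Rightarrow> real" where
  "energy A b \<mu> x = x \<bullet> (A *v x) + \<mu> * (x \<bullet> x) - 2 * (b \<bullet> x)"

lemma continuous_energy: "continuous_on UNIV (energy A b \<mu>)"
  unfolding energy_def[abs_def] by (intro continuous_intros linear_continuous_on) auto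

lemma energy_mono: "\<mu> \<le> \<nu> \<Longrightarrow> energy A b \<mu> x \<le> energy A b \<nu> x"
  by (simp add: energy_def mult_right_mono)

lemma mat_norm_diff_energy:
  fixes A :: "real^'d^'d" and b x :: "real^'d"
  assumes A: "symmetric_pos_def A" and \<mu>: "0 \<le> \<mu>"
  defines "xs \<equiv> matrix_inv (shifted A \<mu>) *v b"
  shows "(mat_norm (shifted A \<mu>) (xs - x))\<^sup>2 = b \<bullet> xs + energy A b \<mu> x"
    and "(mat_norm (shifted A \<mu>) xs)\<^sup>2 = b \<bullet> xs"
proof -
  let ?N = "shifted A \<mu>"
  have N: "symmetric_pos_def ?N" by (rule symmetric_pos_def_shifted) fact+
  have Nxs: "?N *v xs = b"
    unfolding xs_def by (rule matrix_inv_mult_vector(1)[OF symmetric_pos_def_invertible[OF N]])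
  have sq: "(mat_norm ?N y)\<^sup>2 = y \<bullet> (?N *v y)" for y
    unfolding mat_norm_def
    by (rule real_sqrt_pow2) (use N in \<open>cases "y = 0"; auto simp: symmetric_pos_def_def less_imp_le\<close>)
  have "xs \<bullet> (?N *v x) = b \<bullet> x"
    using N by (simp add: dot_matrix_vector_transpose symmetric_pos_def_def Nxs)
  then show "(mat_norm ?N (xs - x))\<^sup>2 = b \<bullet> xs + energy A b \<mu> x"
    unfolding sq energy_def
    by (simp add: matrix_vector_mult_diff_distrib Nxs inner_diff_left inner_diff_right inner_commute[of _ b])
      (simp add: shifted_mult_vector inner_add_right)
  show "(mat_norm ?N xs)\<^sup>2 = b \<bullet> xs" unfolding sq Nxs by (rule inner_commute)
qed

lemma mat_norm_nonneg: "symmetric_pos_def N \<Longrightarrow> 0 \<le> mat_norm N x"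
  by (cases "x = 0") (auto simp: mat_norm_def symmetric_pos_def_def less_imp_le)

lemma mat_norm_le_iff_energy:
  fixes A :: "real^'d^'d" and b x :: "real^'d"
  assumes A: "symmetric_pos_def A" and \<mu>: "0 \<le> \<mu>" and c: "0 \<le> c"
  defines "xs \<equiv> matrix_inv (shifted A \<mu>) *v b"
  shows "mat_norm (shifted A \<mu>) (xs - x) \<le> c * mat_norm (shifted A \<mu>) xs \<longleftrightarrow>
    energy A b \<mu> x \<le> (c\<^sup>2 - 1) * (b \<bullet> xs)"
proof -
  let ?N = "shifted A \<mu>"
  have N: "symmetric_pos_def ?N" by (rule symmetric_pos_def_shifted) fact+
  have "mat_norm ?N (xs - x) \<le> c * mat_norm ?N xs \<longleftrightarrow> (mat_norm ?N (xs - x))\<^sup>2 \<le> (c * mat_norm ?N xs)\<^sup>2"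
    using mat_norm_nonneg[OF N] c by (simp add: abs_le_square_iff[symmetric])
  also have "\<dots> \<longleftrightarrow> energy A b \<mu> x \<le> (c\<^sup>2 - 1) * (b \<bullet> xs)"
    unfolding power_mult_distrib mat_norm_diff_energy(1)[OF A \<mu>, where b = b and x = x, folded xs_def]
      mat_norm_diff_energy(2)[OF A \<mu>, where b = b, folded xs_def] by (auto simp: algebra_simps)
  finally show ?thesis .
qed

lemma ex_energy_minimizer:
  fixes A :: "real^'d^'d"
  assumes A: "symmetric_pos_def A" and \<mu>: "0 \<le> \<mu>" and S: "subspace S"
  shows "\<exists>y\<in>S. \<forall>x\<in>S. energy A b \<mu> y \<le> energy A b \<mu> x"
proof -
  let ?N = "shifted A \<mu>"
  have N: "symmetric_pos_def ?N" by (rule symmetric_pos_def_shifted) fact+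
  obtain y where y: "y \<in> S"
    "\<And>x. x \<in> S \<Longrightarrow> mat_norm ?N (matrix_inv ?N *v b - y) \<le> mat_norm ?N (matrix_inv ?N *v b - x)"
    using ex_form_minimizer[OF N S] by blast
  have "energy A b \<mu> y \<le> energy A b \<mu> x" if "x \<in> S" for x
    using power_mono[OF y(2)[OF that] mat_norm_nonneg[OF N], of 2]
    unfolding mat_norm_diff_energy[OF A \<mu>] by simp
  then show ?thesis using y(1) by blast
qed

text \<open>Coefficients are grouped by the power of \<open>A\<close>, one vector for each power, so that the number of powers can
  vary while the block size is fixed by the type.\<close>

definition krylov_comb :: "nat \<Rightarrow> real^'d^'d \<Rightarrow> real^'k^'d \<Rightarrow> (nat \<Rightarrow> real^'k) \<Rightarrow> real^'d" where
  "krylov_comb t A V c = (\<Sum>i<t. ((*v) A ^^ i) (V *v c i))"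

lemma linear_matrix_power: "linear ((*v) (A :: real^'d^'d) ^^ i)"
  by (induction i) (auto intro: linear_id linear_compose[unfolded o_def] simp: o_def id_def[symmetric])

lemma block_krylov_eq_range: "block_krylov t A V = range (krylov_comb t A V)"
proof
  note lin = linear_matrix_power[where A = A]
  have sub: "subspace (range (krylov_comb t A V))"
    unfolding subspace_def
  proof (intro conjI ballI allI)
    show "0 \<in> range (krylov_comb t A V)"
      by (rule image_eqI[of _ _ "\<lambda>_. 0"]) (simp_all add: krylov_comb_def linear_0[OF lin])
    fix x y assume "x \<in> range (krylov_comb t A V)" "y \<in> range (krylov_comb t A V)"
    then obtain c d where *: "x = krylov_comb t A V c" "y = krylov_comb t A V d" by auto
    show "x + y \<in> range (krylov_comb t A V)"
      by (rule image_eqI[of _ _ "\<lambda>i. c i + d i"])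
        (simp_all add: * krylov_comb_def matrix_vector_right_distrib linear_add[OF lin] sum.distrib)
  next
    fix a x assume "x \<in> range (krylov_comb t A V)"
    then obtain c where *: "x = krylov_comb t A V c" by auto
    show "a *\<^sub>R x \<in> range (krylov_comb t A V)"
      by (rule image_eqI[of _ _ "\<lambda>i. a *\<^sub>R c i"])
        (simp_all add: * krylov_comb_def matrix_vector_mult_scaleR linear_scale[OF lin] scaleR_sum_right)
  qed
  have gen: "((*v) A ^^ i) (column j V) \<in> range (krylov_comb t A V)" if "i < t" for i j
  proof (rule image_eqI[of _ _ "\<lambda>l. if l = i then axis j 1 else 0"])
    have "krylov_comb t A V (\<lambda>l. if l = i then axis j 1 else 0)
        = (\<Sum>l<t. if l = i then ((*v) A ^^ i) (column j V) else 0)"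
      unfolding krylov_comb_def
      by (intro sum.cong refl) (auto simp: linear_0[OF lin] matrix_vector_mul_component vec_eq_iff
          column_def matrix_vector_mult_basis)
    then show "((*v) A ^^ i) (column j V) = krylov_comb t A V (\<lambda>l. if l = i then axis j 1 else 0)"
      using that by simp
  qed simp
  have "krylov t A (column j V) \<subseteq> range (krylov_comb t A V)" for j
    unfolding krylov_def using gen by (intro span_minimal sub) auto
  then show "block_krylov t A V \<subseteq> range (krylov_comb t A V)"
    unfolding block_krylov_def by (auto intro!: subspace_sum[OF sub])
  show "range (krylov_comb t A V) \<subseteq> block_krylov t A V"
  proof
    fix x assume "x \<in> range (krylov_comb t A V)"
    then obtain c where "x = krylov_comb t A V c" by auto
    then have x: "x = (\<Sum>i<t. \<Sum>j\<in>UNIV. (c i $ j) *\<^sub>R ((*v) A ^^ i) (column j V))"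
      by (simp add: krylov_comb_def matrix_mult_sum linear_sum[OF lin] linear_scale[OF lin] scalar_mult_eq_scaleR)
    show "x \<in> block_krylov t A V"
      unfolding x by (intro subspace_sum subspace_scale subspace_block_krylov power_column_in_block_krylov) auto
  qed
qed

lemma hconcat_mult_vector:
  "hconcat V W *v c = V *v (\<chi> k. c $ Inl k) + W *v (\<chi> m. c $ Inr m)"
proof -
  have "(hconcat V W *v c) $ i = (V *v (\<chi> k. c $ Inl k) + W *v (\<chi> m. c $ Inr m)) $ i" for i
    unfolding matrix_vector_mult_def hconcat_def
    by (simp add: UNIV_Plus_UNIV[symmetric] sum.Plus del: UNIV_Plus_UNIV)
  then show ?thesis by (simp add: vec_eq_iff)
qed

lemma continuous_krylov_comb_hconcat:
  "continuous_on UNIV (\<lambda>X. krylov_comb t A (hconcat B X) c)"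
proof -
  have "bounded_linear (\<lambda>X :: real^'k^'d. X *v w)" for w
    unfolding linear_conv_bounded_linear[symmetric]
    by (auto intro!: linearI simp: matrix_vector_mult_add_rdistrib scaleR_matrix_vector_assoc[symmetric])
  note bl = linear_continuous_on[OF this]
  have pw: "continuous_on UNIV ((*v) A ^^ i)" for i
    by (rule linear_continuous_on) (simp add: linear_matrix_power flip: linear_conv_bounded_linear)
  show ?thesis
    unfolding krylov_comb_def hconcat_mult_vector
    by (intro continuous_on_sum continuous_on_compose2[OF pw] continuous_intros bl) auto
qed

lemma krylov_comb_tendsto:
  assumes "\<And>i. i < t \<Longrightarrow> (\<lambda>n. c n i) \<longlonglongrightarrow> d i"
  shows "(\<lambda>n. krylov_comb t A V (c n)) \<longlonglongrightarrow> krylov_comb t A V d"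
proof -
  have bl: "bounded_linear (\<lambda>w. ((*v) A ^^ i) (V *v w))" for i
    unfolding linear_conv_bounded_linear[symmetric]
    using linear_compose[OF matrix_vector_mul_linear linear_matrix_power] by (simp add: o_def)
  show ?thesis
    unfolding krylov_comb_def by (intro tendsto_sum bounded_linear.tendsto[OF bl] assms) simp
qed

text \<open>The minimum over the subspace is attained, so it may be approached by coefficients from a countable dense
  set. For fixed coefficients the energy is a continuous function of the block.\<close>

lemma ex_energy_le_iff_countable:
  fixes A :: "real^'d^'d" and V :: "real^'k^'d"
  assumes A: "symmetric_pos_def A" and \<mu>: "0 \<le> \<mu>"
    and D: "\<And>U :: (real^'k) set. open U \<Longrightarrow> U \<noteq> {} \<Longrightarrow> \<exists>d\<in>D. d \<in> U"
  shows "(\<exists>x\<in>block_krylov t A V. energy A b \<mu> x \<le> h) \<longleftrightarrow>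
    (\<forall>n. \<exists>c\<in>Pi\<^sub>E {..<t} (\<lambda>_. D). energy A b \<mu> (krylov_comb t A V c) < h + 1 / real (Suc n))"
proof
  assume "\<exists>x\<in>block_krylov t A V. energy A b \<mu> x \<le> h"
  then obtain c where c: "energy A b \<mu> (krylov_comb t A V c) \<le> h"
    unfolding block_krylov_eq_range by auto
  have "\<exists>e\<in>D. e \<in> ball (c i) (1 / real (Suc n))" for i n
    by (rule D) auto
  then obtain e where e: "\<And>i n. e i n \<in> D" "\<And>i n. e i n \<in> ball (c i) (1 / real (Suc n))"
    by metis
  define f where "f n = restrict (\<lambda>i. e i n) {..<t}" for n
  have "(\<lambda>n. e i n) \<longlonglongrightarrow> c i" for i
  proof (rule metric_tendsto_imp_tendsto[OF LIMSEQ_inverse_real_of_nat])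
    show "\<forall>\<^sub>F n in sequentially. dist (e i n) (c i) \<le> dist (inverse (real (Suc n))) 0"
      using e(2)[of i] by (intro always_eventually allI) (simp add: dist_commute less_imp_le divide_inverse)
  qed
  then have "(\<lambda>n. krylov_comb t A V (f n)) \<longlonglongrightarrow> krylov_comb t A V c"
    by (intro krylov_comb_tendsto) (simp add: f_def)
  moreover have "isCont (energy A b \<mu>) (krylov_comb t A V c)"
    using continuous_energy by (auto simp: continuous_on_eq_continuous_at)
  ultimately have lim: "(\<lambda>n. energy A b \<mu> (krylov_comb t A V (f n))) \<longlonglongrightarrow> energy A b \<mu> (krylov_comb t A V c)"
    by (rule isCont_tendsto_compose[rotated])
  show "\<forall>n. \<exists>c\<in>Pi\<^sub>E {..<t} (\<lambda>_. D). energy A b \<mu> (krylov_comb t A V c) < h + 1 / real (Suc n)"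
  proof
    fix n
    have "energy A b \<mu> (krylov_comb t A V c) < h + 1 / real (Suc n)"
      using c by (rule le_less_trans) simp
    from order_tendstoD(2)[OF lim this] obtain m
      where "energy A b \<mu> (krylov_comb t A V (f m)) < h + 1 / real (Suc n)"
      by (auto simp: eventually_sequentially)
    moreover have "f m \<in> Pi\<^sub>E {..<t} (\<lambda>_. D)" using e(1) by (auto simp: f_def)
    ultimately show "\<exists>c\<in>Pi\<^sub>E {..<t} (\<lambda>_. D). energy A b \<mu> (krylov_comb t A V c) < h + 1 / real (Suc n)"
      by blast
  qed
next
  assume approx: "\<forall>n. \<exists>c\<in>Pi\<^sub>E {..<t} (\<lambda>_. D). energy A b \<mu> (krylov_comb t A V c) < h + 1 / real (Suc n)"
  obtain y where y: "y \<in> block_krylov t A V"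
    "\<And>x. x \<in> block_krylov t A V \<Longrightarrow> energy A b \<mu> y \<le> energy A b \<mu> x"
    using ex_energy_minimizer[OF A \<mu> subspace_block_krylov] by blast
  have "energy A b \<mu> y \<le> h + 1 / real (Suc n)" for n
    using approx y(2) unfolding block_krylov_eq_range by (meson le_less_trans less_imp_le rangeI)
  moreover have "(\<lambda>n. h + 1 / real (Suc n)) \<longlonglongrightarrow> h + 0"
    by (intro tendsto_add tendsto_const LIMSEQ_Suc lim_1_over_n)
  ultimately have "energy A b \<mu> y \<le> h"
    by (intro LIMSEQ_le_const[of "\<lambda>n. h + 1 / real (Suc n)"]) auto
  then show "\<exists>x\<in>block_krylov t A V. energy A b \<mu> x \<le> h" using y(1) by blast
qed

text \<open>The minimal energy is nondecreasing in the shift, so bounds at rational shifts that decrease to \<open>\<mu>\<close> pass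
  to the limit.\<close>

lemma all_shifts_iff_rational:
  fixes A :: "real^'d^'d" and h :: "real \<Rightarrow> real"
  assumes A: "symmetric_pos_def A" and S: "subspace S" and h: "continuous_on {0..} h"
  shows "(\<forall>\<mu>\<ge>0. \<exists>x\<in>S. energy A b \<mu> x \<le> h \<mu>) \<longleftrightarrow> (\<forall>\<mu>\<in>\<rat> \<inter> {0..}. \<exists>x\<in>S. energy A b \<mu> x \<le> h \<mu>)"
proof (intro iffI allI impI)
  fix \<mu> :: real
  assume rat: "\<forall>\<mu>\<in>\<rat> \<inter> {0..}. \<exists>x\<in>S. energy A b \<mu> x \<le> h \<mu>" and \<mu>: "0 \<le> \<mu>"
  obtain y where y: "y \<in> S" "\<And>x. x \<in> S \<Longrightarrow> energy A b \<mu> y \<le> energy A b \<mu> x"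
    using ex_energy_minimizer[OF A \<mu> S] by blast
  have "\<exists>q\<in>\<rat>. \<mu> < q \<and> q < \<mu> + inverse (real (Suc n))" for n
    by (rule Rats_dense_in_real) simp
  then obtain q where q: "\<And>n. q n \<in> \<rat>" "\<And>n. \<mu> < q n" "\<And>n. q n < \<mu> + inverse (real (Suc n))"
    by metis
  have "q \<longlonglongrightarrow> \<mu>"
  proof (rule metric_tendsto_imp_tendsto[OF LIMSEQ_inverse_real_of_nat])
    have "dist (q n) \<mu> \<le> dist (inverse (real (Suc n))) 0" for n
      using q(2,3)[of n] by (simp add: dist_real_def)
    then show "\<forall>\<^sub>F n in sequentially. dist (q n) \<mu> \<le> dist (inverse (real (Suc n))) 0" by simp
  qed
  then have "(\<lambda>n. h (q n)) \<longlonglongrightarrow> h \<mu>"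
    using \<mu> less_imp_le[OF le_less_trans[OF \<mu> q(2)]] by (intro continuous_on_tendsto_compose[OF h]) auto
  moreover have "energy A b \<mu> y \<le> h (q n)" for n
  proof -
    have "q n \<in> \<rat> \<inter> {0..}" using q(1,2)[of n] \<mu> by auto
    then obtain x where "x \<in> S" "energy A b (q n) x \<le> h (q n)" using rat by blast
    moreover have "energy A b \<mu> x \<le> energy A b (q n) x" using q(2)[of n] by (intro energy_mono) simp
    ultimately show ?thesis using y(2)[of x] by linarith
  qed
  ultimately have "energy A b \<mu> y \<le> h \<mu>" by (intro LIMSEQ_le_const) auto
  then show "\<exists>x\<in>S. energy A b \<mu> x \<le> h \<mu>" using y(1) by blast
qed auto

lemma continuous_inverse_quadratic_form:
  fixes A :: "real^'d^'d"
  assumes A: "symmetric_pos_def A" and u: "eigenbasis A lam u"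
  shows "continuous_on {0..} (\<lambda>\<mu>. b \<bullet> (matrix_inv (shifted A \<mu>) *v b))"
proof -
  have At: "transpose A = A" using A by (simp add: symmetric_pos_def_def)
  have eq: "b \<bullet> (matrix_inv (shifted A \<mu>) *v b) = (\<Sum>i = 1..CARD('d). (u i \<bullet> b) * ((u i \<bullet> b) / (lam i + \<mu>)))"
    if \<mu>: "0 \<le> \<mu>" for \<mu>
    unfolding eigenbasis_inner[OF u, of b "matrix_inv (shifted A \<mu>) *v b"]
  proof (rule sum.cong[OF refl])
    fix i assume i: "i \<in> {1..CARD('d)}"
    let ?xs = "matrix_inv (shifted A \<mu>) *v b"
    have "u i \<bullet> b = u i \<bullet> (shifted A \<mu> *v ?xs)"
      using symmetric_pos_def_invertible[OF symmetric_pos_def_shifted[OF A \<mu>]] by (simp add: matrix_inv_mult_vector)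
    also have "\<dots> = (lam i + \<mu>) * (u i \<bullet> ?xs)"
      by (simp add: shifted_mult_vector inner_add_right eigenbasis_coeff[OF u At i] algebra_simps)
    finally have "u i \<bullet> ?xs = (u i \<bullet> b) / (lam i + \<mu>)"
      using eigenvalue_pos[OF u A i] \<mu> by (simp add: field_simps)
    then show "(u i \<bullet> b) * (u i \<bullet> ?xs) = (u i \<bullet> b) * ((u i \<bullet> b) / (lam i + \<mu>))" by simp
  qed
  have "continuous_on {0..} (\<lambda>\<mu>. \<Sum>i = 1..CARD('d). (u i \<bullet> b) * ((u i \<bullet> b) / (lam i + \<mu>)))"
    using eigenvalue_pos[OF u A] by (intro continuous_intros) (force simp: add_pos_nonneg)+
  then show ?thesis by (rule continuous_on_cong[THEN iffD2, rotated -1]) (auto simp: eq)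
qed

text \<open>Both the quantifier over shifts and the one over elements of the random subspace become
  countable.\<close>

lemma uniform_accuracy_measurable:
  fixes A :: "real^'d^'d" and \<Omega> :: "'a \<Rightarrow> real^'m^'d" and B :: "real^'b^'d" and c :: "real \<Rightarrow> real"
  assumes A: "symmetric_pos_def A" and u: "eigenbasis A lam u" and [measurable]: "\<Omega> \<in> borel_measurable M"
    and c: "continuous_on {0..} c" "\<And>\<mu>. 0 \<le> \<mu> \<Longrightarrow> 0 \<le> c \<mu>"
  shows "{\<omega> \<in> space M. \<forall>\<mu>\<ge>0. \<exists>x\<in>block_krylov t A (hconcat B (\<Omega> \<omega>)).
      mat_norm (shifted A \<mu>) (matrix_inv (shifted A \<mu>) *v b - x)
        \<le> c \<mu> * mat_norm (shifted A \<mu>) (matrix_inv (shifted A \<mu>) *v b)} \<in> sets M"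
    (is "?E \<in> _")
proof -
  define h where "h \<mu> = ((c \<mu>)\<^sup>2 - 1) * (b \<bullet> (matrix_inv (shifted A \<mu>) *v b))" for \<mu>
  have h: "continuous_on {0..} h"
    unfolding h_def by (intro continuous_intros c continuous_inverse_quadratic_form[OF A u])
  obtain D :: "(real^('b + 'm)) set" where D: "countable D"
    "\<And>U. open U \<Longrightarrow> U \<noteq> {} \<Longrightarrow> \<exists>d\<in>D. d \<in> U"
    by (rule countable_dense_setE) blast
  have "?E = {\<omega> \<in> space M. \<forall>\<mu>\<ge>0. \<exists>x\<in>block_krylov t A (hconcat B (\<Omega> \<omega>)). energy A b \<mu> x \<le> h \<mu>}"
    using mat_norm_le_iff_energy[OF A _ c(2)] by (simp add: h_def)
  also have "\<dots> = {\<omega> \<in> space M. \<forall>\<mu>\<in>\<rat> \<inter> {0..}. \<forall>n. \<exists>f\<in>Pi\<^sub>E {..<t} (\<lambda>_. D).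
      energy A b \<mu> (krylov_comb t A (hconcat B (\<Omega> \<omega>)) f) < h \<mu> + 1 / real (Suc n)}"
    unfolding all_shifts_iff_rational[OF A subspace_block_krylov h]
    using ex_energy_le_iff_countable[OF A _ D(2)] by simp
  also have "\<dots> \<in> sets M"
  proof (intro sets.sets_Collect_countable_All' sets.sets_Collect_countable_All sets.sets_Collect_countable_Ex')
    show "countable (\<rat> \<inter> {0..} :: real set)" using countable_rat by (rule countable_subset[rotated]) auto
    show "countable (Pi\<^sub>E {..<t} (\<lambda>_. D))" using D(1) by (intro countable_PiE) auto
    fix \<mu> :: real and n :: nat and f :: "nat \<Rightarrow> real^('b + 'm)"
    have "continuous_on UNIV (\<lambda>X. energy A b \<mu> (krylov_comb t A (hconcat B X) f))"
      by (rule continuous_on_compose2[OF continuous_energy continuous_krylov_comb_hconcat]) auto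
    then have [measurable]: "(\<lambda>X. energy A b \<mu> (krylov_comb t A (hconcat B X) f)) \<in> borel_measurable borel"
      by (rule borel_measurable_continuous_onI)
    show "{\<omega> \<in> space M. energy A b \<mu> (krylov_comb t A (hconcat B (\<Omega> \<omega>)) f) < h \<mu> + 1 / real (Suc n)} \<in> sets M"
      by measurable
  qed
  finally show ?thesis .
qed

section \<open>Independent blocks and the error bound\<close>

lemma ex_disjoint_blocks:
  assumes "CARD('m::finite) = n * q"
  shows "\<exists>J :: nat \<Rightarrow> 'm set. disjoint_family_on J {..<q} \<and> (\<forall>a<q. card (J a) = n)"
proof -
  obtain h :: "nat \<Rightarrow> 'm" where h: "bij_betw h {..<n * q} UNIV"
    using finite_same_card_bij[of "{..<n * q}" "UNIV :: 'm set"] assms by auto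
  have sub: "{a * n..<Suc a * n} \<subseteq> {..<n * q}" if "a < q" for a
  proof -
    have "Suc a * n \<le> q * n" using that by (intro mult_le_mono1) simp
    then show ?thesis by (auto simp: mult.commute)
  qed
  have inj: "inj_on h {..<n * q}" using h by (simp add: bij_betw_def)
  show ?thesis
  proof (intro exI[of _ "\<lambda>a. h ` {a * n..<Suc a * n}"] conjI allI impI)
    show "card (h ` {a * n..<Suc a * n}) = n" if "a < q" for a
      using inj_on_subset[OF inj sub[OF that]] by (simp add: card_image)
    have "{a * n..<Suc a * n} \<inter> {b * n..<Suc b * n} = {}" if "a < b" for a b :: nat
    proof -
      have "Suc a * n \<le> b * n" using that by (intro mult_le_mono1) simp
      then show ?thesis by auto
    qed
    then have disj: "{a * n..<Suc a * n} \<inter> {b * n..<Suc b * n} = {}" if "a \<noteq> b" for a b :: nat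
      using that by (metis Int_commute linorder_neqE_nat)
    show "disjoint_family_on (\<lambda>a. h ` {a * n..<Suc a * n}) {..<q}"
      unfolding disjoint_family_on_def
    proof (intro ballI impI)
      fix a b assume "a \<in> {..<q}" "b \<in> {..<q}" "a \<noteq> b"
      then show "h ` {a * n..<Suc a * n} \<inter> h ` {b * n..<Suc b * n} = {}"
        using inj_on_image_Int[OF inj sub[of a] sub[of b]] disj[of a b] by auto
    qed
  qed
qed

context prob_space
begin

text \<open>Statistics of disjoint blocks depend on disjoint families of independent entries.\<close>

lemma indep_column_blocks:
  fixes \<Omega> :: "'a \<Rightarrow> real^'m^'d" and W :: "nat \<Rightarrow> real^'m^'d \<Rightarrow> real"
  assumes gm: "gaussian_matrix \<Omega>" and J: "disjoint_family_on J {..<q}"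
    and W: "\<And>a. a < q \<Longrightarrow> continuous_on UNIV (W a)"
    and mask: "\<And>a X. a < q \<Longrightarrow> W a (X ** column_mask (J a)) = W a X"
  shows "indep_vars (\<lambda>_. borel) (\<lambda>a \<omega>. W a (\<Omega> \<omega>)) {..<q}"
proof -
  define K where "K a = (UNIV :: 'd set) \<times> J a" for a
  define ext where "ext a f = (\<chi> i j. if j \<in> J a then f (i, j) else 0)" for a and f :: "'d \<times> 'm \<Rightarrow> real"
  have ind: "indep_vars (\<lambda>_. borel) (\<lambda>(i, j) \<omega>. \<Omega> \<omega> $ i $ j) UNIV"
    using gm by (simp add: gaussian_matrix_def)
  have "indep_vars (\<lambda>a. PiM (K a) (\<lambda>_. borel))
      (\<lambda>a \<omega>. restrict (\<lambda>p. (case p of (i, j) \<Rightarrow> \<lambda>\<omega>. \<Omega> \<omega> $ i $ j) \<omega>) (K a)) {..<q}"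
    by (rule indep_vars_restrict[OF ind]) (use J in \<open>auto simp: K_def disjoint_family_on_def\<close>)
  then have "indep_vars (\<lambda>_. borel)
      (\<lambda>a \<omega>. W a (ext a (restrict (\<lambda>p. (case p of (i, j) \<Rightarrow> \<lambda>\<omega>. \<Omega> \<omega> $ i $ j) \<omega>) (K a)))) {..<q}"
  proof (rule indep_vars_compose2)
    fix a assume "a \<in> {..<q}"
    then have "W a \<in> borel_measurable borel" using W by (auto intro: borel_measurable_continuous_onI)
    moreover have "ext a \<in> borel_measurable (PiM (K a) (\<lambda>_. borel))"
    proof -
      have "(\<lambda>f. ext a f $ i $ j) \<in> borel_measurable (PiM (K a) (\<lambda>_. borel))" for i j
        by (cases "j \<in> J a") (auto simp: ext_def K_def)
      then show ?thesis
        unfolding borel_measurable_euclidean_space[of "ext a"] by (auto simp: Basis_vec_def inner_axis)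
    qed
    ultimately show "(\<lambda>f. W a (ext a f)) \<in> borel_measurable (PiM (K a) (\<lambda>_. borel))"
      by (rule measurable_compose[rotated])
  qed
  moreover have "ext a (restrict (\<lambda>p. (case p of (i, j) \<Rightarrow> \<lambda>\<omega>. \<Omega> \<omega> $ i $ j) \<omega>) (K a)) = \<Omega> \<omega> ** column_mask (J a)"
    for a \<omega>
    by (simp add: vec_eq_iff ext_def K_def matrix_mult_column_mask_nth)
  ultimately have "indep_vars (\<lambda>_. borel) (\<lambda>a \<omega>. W a (\<Omega> \<omega> ** column_mask (J a))) {..<q}" by simp
  then show ?thesis
    by (rule indep_vars_cong[THEN iffD1, rotated -1]) (auto simp: mask)
qed

end

text \<open>The logarithmic lower bound on \<open>s\<close> says that \<open>4 + 4 Y \<le> exp (4 s - 6)\<close>. The powers of \<open>36\<close> outgrow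
  this with room for the constant \<open>401\<close>, which comes from the failure probability \<open>1 / 100\<close> and from the factor 4
  lost in \<open>tail_form_bound\<close>.\<close>

lemma oversampling_power_bound:
  fixes Y :: real and s :: int
  assumes Y: "0 \<le> Y" and s: "3 / 2 + 1 / 4 * ln (4 + 4 * Y) \<le> real_of_int s"
  shows "2 \<le> s" and "401 * (1 + Y) \<le> 36 ^ (2 * nat (s - 1))"
proof -
  have "0 \<le> ln (4 + 4 * Y)" using Y by (intro ln_ge_zero) auto
  then have "real_of_int 1 < real_of_int s" using s by simp
  then show s2: "2 \<le> s" by linarith
  define k where "k = nat (s - 2)"
  have k: "real_of_int s = real k + 2" "nat (s - 1) = Suc k" using s2 by (auto simp: k_def)
  have e1: "exp 2 \<le> (9::real)" "exp 4 \<le> (1296::real)"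
  proof -
    have e: "exp (real n) \<le> 3 ^ n" for n
      using power_mono[OF exp_le, of n] by (simp add: exp_of_nat_mult[of n 1, symmetric])
    show "exp 2 \<le> (9::real)" "exp 4 \<le> (1296::real)" using e[of 2] e[of 4] by simp_all
  qed
  have "4 + 4 * Y = exp (ln (4 + 4 * Y))" using Y by simp
  also have "\<dots> \<le> exp (4 * real k + 2)" using s k(1) by simp
  also have "\<dots> = exp 4 ^ k * exp 2" by (simp add: exp_add exp_of_nat_mult[symmetric] mult.commute)
  also have "\<dots> \<le> 1296 ^ k * 9" using e1 by (intro mult_mono power_mono) auto
  finally have "401 * (1 + Y) \<le> 401 / 4 * (1296 ^ k * 9)" by simp
  also have "\<dots> \<le> 1296 * 1296 ^ k" by simp
  also have "\<dots> = 36 ^ (2 * nat (s - 1))" unfolding k(2) power_mult by simp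
  finally show "401 * (1 + Y) \<le> 36 ^ (2 * nat (s - 1))" .
qed

lemma tail_ratio_sum_bound:
  fixes lam :: "nat \<Rightarrow> real"
  assumes mono: "antimono_on {1..d} lam" and pos: "\<And>i. i \<in> {1..d} \<Longrightarrow> 0 < lam i"
    and r: "r < d" and p: "2 \<le> p"
  shows "4 * (real r / (real p - 1) * (\<Sum>i = r + 1..d. (lam i)\<^sup>2 / (lam (r + 1))\<^sup>2)) \<le> (real d)\<^sup>2"
proof -
  have "(\<Sum>i = r + 1..d. (lam i)\<^sup>2 / (lam (r + 1))\<^sup>2) \<le> (\<Sum>i = r + 1..d. 1)"
  proof (rule sum_mono)
    fix i assume i: "i \<in> {r + 1..d}"
    have "0 < lam i" "0 < lam (r + 1)" using pos i r by auto
    moreover have "lam i \<le> lam (r + 1)" using monotone_onD[OF mono, of "r + 1" i] i r by auto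
    ultimately show "(lam i)\<^sup>2 / (lam (r + 1))\<^sup>2 \<le> 1" by (simp add: divide_le_eq power_mono)
  qed
  then have "(\<Sum>i = r + 1..d. (lam i)\<^sup>2 / (lam (r + 1))\<^sup>2) \<le> real d - real r"
    using r by (simp add: of_nat_diff)
  moreover have "real r / (real p - 1) \<le> real r" using p by (simp add: divide_le_eq mult_le_cancel_left1)
  ultimately have "real r / (real p - 1) * (\<Sum>i = r + 1..d. (lam i)\<^sup>2 / (lam (r + 1))\<^sup>2)
      \<le> real r * (real d - real r)"
    by (intro mult_mono) (auto intro: sum_nonneg)
  moreover have "4 * (real r * (real d - real r)) \<le> (real d)\<^sup>2"
    using zero_le_power2[of "real d - 2 * real r"] by (simp add: power2_eq_square algebra_simps)
  ultimately show ?thesis by linarith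
qed

text \<open>The minimum in the lower bound on \<open>s\<close> is always the second expression, since the argument
  of its logarithm is at most a constant times the square of the dimension.\<close>

lemma oversampling_bound_le_dimension_bound:
  fixes Y d :: real
  assumes Y: "0 \<le> Y" "4 * Y \<le> d\<^sup>2" and d: "1 \<le> d"
  shows "3 / 2 + 1 / 4 * ln (4 + 4 * Y) \<le> 3 + ln d / 2"
proof -
  have "1 \<le> d\<^sup>2" using d by (simp add: power_mono one_le_power)
  then have "4 + 4 * Y \<le> 7 * d\<^sup>2" using Y(2) by linarith
  also have "\<dots> \<le> exp 6 * d\<^sup>2" using exp_ge_add_one_self[of 6] by (intro mult_right_mono) auto
  finally have "ln (4 + 4 * Y) \<le> ln (exp 6 * d\<^sup>2)" using Y d by (subst ln_le_cancel_iff) auto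
  also have "\<dots> = 6 + 2 * ln d" using d by (simp add: ln_mult ln_realpow)
  finally show ?thesis by simp
qed

theorem theorem4p2:
  fixes A :: "real^'d^'d" and b :: "real^'d" and lam :: "nat \<Rightarrow> real"
    and P :: "'w measure" and \<Omega> :: "'w \<Rightarrow> real^'m^'d"
    and r p q t :: nat and s :: int and \<delta> :: real
  assumes "symmetric_pos_def A"
    and "ordered_eigenvalues A lam"
    and "b \<noteq> 0"
    and "0 < \<delta>" and "\<delta> < 1"
    and "r < CARD('d)"
    and "q \<ge> 1"
    and "real q \<ge> ln (1 / \<delta>) / ln 100"
    and "p \<ge> 2"
    and "CARD('m) = (r + p) * q"
    and "prob_space P"
    and "prob_space.gaussian_matrix P \<Omega>"
    and "real_of_int s \<ge>
           min (3 + ln (real CARD('d)) / 2)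
               (3 / 2 + 1 / 4 * ln (4 + 4 * real r / (real p - 1) *
                  (\<Sum>i = r + 1..CARD('d). (lam i)\<^sup>2 / (lam (r + 1))\<^sup>2)))"
  shows "measure P {\<omega> \<in> space P. \<forall>\<mu>\<ge>0.
            mat_norm (shifted A \<mu>)
                (matrix_inv (shifted A \<mu>) *v b
                  - bcg A (hconcat (columnvector b :: real^1^'d) (\<Omega> \<omega>)) t (Inl 1) \<mu>)
              / mat_norm (shifted A \<mu>) (matrix_inv (shifted A \<mu>) *v b)
            \<le> 2 * exp (- ((real t - real_of_int s)
                  / (3 * sqrt (shifted_cond lam CARD('d) (r + 1) \<mu>))))}
          \<ge> 1 - \<delta>"
    (is "measure P ?E \<ge> _")
proof -
  note A = assms(1) and r = assms(6) and gm = assms(12)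
  interpret prob_space P by (fact assms(11))
  have mono: "antimono_on {1..CARD('d)} lam" using assms(2) by (simp add: ordered_eigenvalues_def)
  obtain u where u: "eigenbasis A lam u"
    using ex_eigenbasis[of A lam] assms(1,2) by (auto simp: symmetric_pos_def_def ordered_eigenvalues_def)
  have pos: "0 < lam i" if "i \<in> {1..CARD('d)}" for i by (rule eigenvalue_pos[OF u A that])
  define Y where "Y = real r / (real p - 1) * (\<Sum>i = r + 1..CARD('d). (lam i)\<^sup>2 / (lam (r + 1))\<^sup>2)"
  have Y: "0 \<le> Y" unfolding Y_def using assms(9)
    by (intro mult_nonneg_nonneg divide_nonneg_nonneg sum_nonneg) auto
  have "4 * Y \<le> (real CARD('d))\<^sup>2"
    unfolding Y_def by (rule tail_ratio_sum_bound[OF mono pos r assms(9)])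
  then have "3 / 2 + 1 / 4 * ln (4 + 4 * Y) \<le> 3 + ln (real CARD('d)) / 2"
    using Y by (intro oversampling_bound_le_dimension_bound) auto
  then have s: "3 / 2 + 1 / 4 * ln (4 + 4 * Y) \<le> real_of_int s"
    using assms(13) by (simp add: Y_def mult.assoc)
  define k where "k = nat (s - 1)"
  have k: "0 < k" "real_of_int s = real k + 1"
    using oversampling_power_bound(1)[OF Y s] by (auto simp: k_def)
  have big: "401 * (1 + Y) \<le> 36 ^ (2 * k)"
    using oversampling_power_bound(2)[OF Y s] by (simp add: k_def)

  obtain J :: "nat \<Rightarrow> 'm set" where J: "disjoint_family_on J {..<q}" "\<And>a. a < q \<Longrightarrow> card (J a) = r + p"
    using ex_disjoint_blocks[OF assms(10)] by blast
  define test where "test a W \<longleftrightarrow> continuous_on UNIV W \<and> (\<forall>X. W (X ** column_mask (J a)) = W X) \<and>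
      prob {\<omega> \<in> space P. 1 \<le> W (\<Omega> \<omega>)} \<le> 1 / 100 \<and>
      (\<forall>X. W X < 1 \<longrightarrow> (\<forall>z. (\<forall>j\<in>J a. z \<bullet> ((*v) A ^^ k) (column j X) = 0) \<longrightarrow>
        z \<bullet> (A *v z) \<le> 36 * lam (r + 1) * (z \<bullet> z)))" for a and W :: "real^'m^'d \<Rightarrow> real"
  have "\<exists>W. test a W" if "a < q" for a
    unfolding test_def by (rule ex_block_test[OF A u mono r k(1) assms(9) J(2)[OF that] gm big[unfolded Y_def]])
  then obtain W where test: "\<And>a. a < q \<Longrightarrow> test a (W a)" by metis
  have W: "continuous_on UNIV (W a)" "W a (X ** column_mask (J a)) = W a X"
    "prob {\<omega> \<in> space P. 1 \<le> W a (\<Omega> \<omega>)} \<le> 1 / 100" if "a < q" for a X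
    using test[OF that] by (auto simp: test_def)
  have tail: "z \<bullet> (A *v z) \<le> 36 * lam (r + 1) * (z \<bullet> z)"
    if "a < q" "W a X < 1" "\<And>j. j \<in> J a \<Longrightarrow> z \<bullet> ((*v) A ^^ k) (column j X) = 0" for a X z
    using test[OF that(1)] that(2,3) unfolding test_def by blast
  have Wm: "(\<lambda>\<omega>. W a (\<Omega> \<omega>)) \<in> borel_measurable P" if "a < q" for a
    using W(1)[OF that] by (intro measurable_compose[OF gaussian_matrix_measurable[OF gm]] borel_measurable_continuous_onI)

  define Bad where "Bad = (\<Inter>a\<in>{..<q}. (\<lambda>\<omega>. W a (\<Omega> \<omega>)) -` {1..} \<inter> space P)"
  have "0 \<in> {..<q}" using assms(7) by simp
  then have q: "{..<q} \<noteq> {}" by blast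
  have Bad: "Bad \<in> events"
    unfolding Bad_def using q Wm by (intro sets.finite_INT) (auto intro: measurable_sets)
  have "prob Bad = (\<Prod>a<q. prob ((\<lambda>\<omega>. W a (\<Omega> \<omega>)) -` {1..} \<inter> space P))"
    unfolding Bad_def
    by (rule indep_varsD_finite[OF indep_column_blocks[OF gm J(1) W(1,2)] q]) auto
  also have "\<dots> \<le> (\<Prod>a<q. 1 / 100)"
  proof (rule prod_mono)
    fix a assume "a \<in> {..<q}"
    then have "prob {\<omega> \<in> space P. 1 \<le> W a (\<Omega> \<omega>)} \<le> 1 / 100" using W(3) by simp
    moreover have "(\<lambda>\<omega>. W a (\<Omega> \<omega>)) -` {1..} \<inter> space P = {\<omega> \<in> space P. 1 \<le> W a (\<Omega> \<omega>)}" by auto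
    ultimately show "0 \<le> prob ((\<lambda>\<omega>. W a (\<Omega> \<omega>)) -` {1..} \<inter> space P) \<and>
        prob ((\<lambda>\<omega>. W a (\<Omega> \<omega>)) -` {1..} \<inter> space P) \<le> 1 / 100" by simp
  qed
  also have "\<dots> = 1 / 100 ^ q" by (simp add: power_divide)
  also have "\<dots> \<le> \<delta>"
  proof -
    have "ln (1 / \<delta>) \<le> real q * ln 100" using assms(8) by (simp add: pos_divide_le_eq)
    also have "\<dots> = ln (100 ^ q)" by (simp add: ln_realpow)
    finally have "1 / \<delta> \<le> 100 ^ q" using assms(4) by simp
    then show ?thesis using assms(4) by (simp add: field_simps)
  qed
  finally have bad: "prob Bad \<le> \<delta>" .

  define c where "c \<mu> = 2 * exp (- ((real t - real_of_int s) / (3 * sqrt (shifted_cond lam CARD('d) (r + 1) \<mu>))))"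
    for \<mu>
  let ?accurate = "\<lambda>\<mu> \<omega>. \<exists>x\<in>block_krylov t A (hconcat (columnvector b :: real^1^'d) (\<Omega> \<omega>)).
      mat_norm (shifted A \<mu>) (matrix_inv (shifted A \<mu>) *v b - x)
        \<le> c \<mu> * mat_norm (shifted A \<mu>) (matrix_inv (shifted A \<mu>) *v b)"
  define Good where "Good = {\<omega> \<in> space P. \<forall>\<mu>\<ge>0. ?accurate \<mu> \<omega>}"
  have Good_eq: "?E = Good"
    unfolding Good_def c_def
    by (intro Collect_cong conj_cong all_cong refl) (rule bcg_ratio_iff[OF A _ assms(3)], assumption)
  have kpos: "0 < lam (r + 1) + \<mu>" "0 < lam CARD('d) + \<mu>" if "0 \<le> \<mu>" for \<mu>
    using pos[of "r + 1"] pos[of "CARD('d)"] that r by (auto simp: Suc_le_eq)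
  have "continuous_on {0..} c"
    unfolding c_def shifted_cond_def using kpos
    by (intro continuous_intros) (force simp: less_imp_neq[symmetric])+
  then have Good: "Good \<in> events"
    unfolding Good_def
    by (intro uniform_accuracy_measurable[OF A u gaussian_matrix_measurable[OF gm]]) (auto simp: c_def)
  have "space P - Bad \<subseteq> Good"
  proof
    fix \<omega> assume \<omega>: "\<omega> \<in> space P - Bad"
    then obtain a where "a \<in> {..<q}" "\<omega> \<notin> (\<lambda>\<omega>. W a (\<Omega> \<omega>)) -` {1..} \<inter> space P"
      unfolding Bad_def by blast
    with \<omega> have a: "a < q" "W a (\<Omega> \<omega>) < 1" by auto
    have "?accurate \<mu> \<omega>" if \<mu>: "0 \<le> \<mu>" for \<mu>
    proof (cases "k < t")
      case True
      show ?thesis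
        unfolding c_def k(2)
        by (rule block_krylov_error[OF A u mono r \<mu> True]) (rule tail[OF a], simp)
    next
      case False
      have "real t - real_of_int s \<le> 0" using False k(2) by simp
      then have "1 \<le> exp (- ((real t - real_of_int s) / (3 * sqrt (shifted_cond lam CARD('d) (r + 1) \<mu>))))"
        using kpos[OF \<mu>] unfolding one_le_exp_iff
        by (simp add: shifted_cond_def divide_nonpos_nonneg)
      then have "1 \<le> c \<mu>" unfolding c_def by linarith
      then have "mat_norm (shifted A \<mu>) (matrix_inv (shifted A \<mu>) *v b - 0)
          \<le> c \<mu> * mat_norm (shifted A \<mu>) (matrix_inv (shifted A \<mu>) *v b)"
        using mult_right_mono[OF _ mat_norm_nonneg[OF symmetric_pos_def_shifted[OF A \<mu>]], of 1 "c \<mu>"] by simp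
      then show ?thesis using subspace_0[OF subspace_block_krylov] by blast
    qed
    then show "\<omega> \<in> Good" using \<omega> by (simp add: Good_def)
  qed
  then have "prob (space P - Bad) \<le> prob Good" using Good by (rule finite_measure_mono)
  moreover have "prob (space P - Bad) = 1 - prob Bad" using Bad by (rule prob_compl)
  ultimately show ?thesis unfolding Good_eq using bad by simp
qed

end
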